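(* Let $\mathcal{A}$ be a homological category and $(\mathcal{T},\mathcal{F})$ a torsion theory in $\mathcal{A}$, with reflector $F\colon\mathcal{A}\to\mathcal{F}$, such that (P) $F$ is protoadditive; and (N) for any morphism $f\colon A\to B$ in $\mathcal{A}$, the composite $\ker(f)\circ t_{K[f]}\colon T(K[f])\to A$ is a normal monomorphism. Let $\mathbb{E}$ be the class of morphisms of $\mathcal{A}$ inverted by $F$, $\overline{\mathbb{E}}$ the class of normal epimorphisms $f$ with $K[f]\in\mathcal{T}$, and $\overline{\mathbb{M}}$ the class of morphisms $f$ with $K[f]\in\mathcal{F}$. Then: (1) the category $\mathrm{NExt}_{\mathcal{F}}(\mathcal{A})$ of normal extensions is a reflective subcategory of the category $\mathrm{EffDes}(\mathcal{A})$ of effective descent morphisms in $\mathcal{A}$; (2) normal extensions are stable under composition; (3) any effective descent morphism $f\colon A\to B$ factors uniquely (up to isomorphism) as a composite $f=m\circ e$, where $e$ is stably in $\mathbb{E}$ and $m$ is a normal extension; moreover, this factorisation coincides with the $(\overline{\mathbb{E}},\overline{\mathbb{M}})$-factorisation of $f$.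
   Context: A category is pointed if it has a zero object; $\ker(f)\colon K[f]\to A$ is the kernel of $f\colon A\to B$. Normal monomorphisms (epimorphisms) are kernels (cokernels) of some morphism. A short exact sequence is a composable pair $(k,f)$ with $k=\ker(f)$ and $f=\mathrm{coker}(k)$; a split short exact sequence is a triple $(k,f,s)$ with $k=\ker(f)$, $f\circ s=1$. A pointed category with pullbacks along split epimorphisms is protomodular if the split short five lemma holds. A homological category is a pointed protomodular regular category. A functor between pointed protomodular categories is protoadditive if it preserves split short exact sequences. A torsion theory in a pointed category $\mathcal{A}$ is a pair $(\mathcal{T},\mathcal{F})$ of full replete subcategories such that $\mathrm{Hom}_{\mathcal{A}}(T,F)=\{0\}$ for all $T\in\mathcal{T}$, $F\in\mathcal{F}$, and every object $A$ admits a short exact sequence $0\to T(A)\xrightarrow{t_A}A\xrightarrow{\eta_A}F(A)\to 0$ with $T(A)\in\mathcal{T}$, $F(A)\in\mathcal{F}$ ($\eta$ is the unit of the reflector $F$). A morphism $p\colon E\to B$ is an effective descent morphism if the pullback functor $p^*\colon(\mathcal{A}\downarrow B)\to(\mathcal{A}\downarrow E)$ is monadic. A morphism $f\colon A\to B$ is a trivial extension if the naturality square $\eta_B\circ f=F(f)\circ\eta_A$ is a pullback, and a normal extension if it is an effective descent morphism and $f^*(f)$ (a kernel pair projection of $f$) is a trivial extension. $\mathrm{EffDes}(\mathcal{A})$ and $\mathrm{NExt}_{\mathcal{F}}(\mathcal{A})$ denote the full subcategories of the arrow category $\mathrm{Arr}(\mathcal{A})$ on the effective descent morphisms and the normal extensions,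 respectively. A morphism is stably in $\mathbb{E}$ if every pullback of it lies in $\mathbb{E}$. Under condition (N), $(\overline{\mathbb{E}},\overline{\mathbb{M}})$ is a factorisation system on $\mathcal{A}$, so that every morphism $f$ has an essentially unique factorisation $f=m\circ e$ with $e\in\overline{\mathbb{E}}$, $m\in\overline{\mathbb{M}}$, called its $(\overline{\mathbb{E}},\overline{\mathbb{M}})$-factorisation. *)

theory Defs
  imports Main
begin

section \<open>Categories, functors, natural transformations\<close>

text \<open>
  Objects and arrows are carried by arbitrary types; only elements of \<open>Obj C\<close> and \<open>Arr C\<close> count,
  and the operations are unspecified elsewhere.  Composition is in applicative order:
  \<open>g \<cdot>\<^bsub>C\<^esub> f\<close> is ``g after f''.
\<close>

record ('o, 'm) cat =
  Obj :: "'o set"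
  Arr :: "'m set"
  Dom :: "'m \<Rightarrow> 'o"
  Cod :: "'m \<Rightarrow> 'o"
  Ide :: "'o \<Rightarrow> 'm"
  Comp :: "'m \<Rightarrow> 'm \<Rightarrow> 'm"  (infixl "\<cdot>\<index>" 70)

definition hom :: "('o, 'm) cat \<Rightarrow> 'o \<Rightarrow> 'o \<Rightarrow> 'm set" where
  "hom C A B = {f \<in> Arr C. Dom C f = A \<and> Cod C f = B}"

locale category =
  fixes C :: "('o, 'm) cat" (structure)
  assumes Dom_in_Obj: "f \<in> Arr C \<Longrightarrow> Dom C f \<in> Obj C"
    and Cod_in_Obj: "f \<in> Arr C \<Longrightarrow> Cod C f \<in> Obj C"
    and Ide_in_hom: "A \<in> Obj C \<Longrightarrow> Ide C A \<in> hom C A A"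
    and Comp_in_hom: "f \<in> hom C A B \<Longrightarrow> g \<in> hom C B D \<Longrightarrow> g \<cdot> f \<in> hom C A D"
    and Comp_Ide: "f \<in> hom C A B \<Longrightarrow> f \<cdot> Ide C A = f"
    and Ide_Comp: "f \<in> hom C A B \<Longrightarrow> Ide C B \<cdot> f = f"
    and Comp_assoc: "f \<in> hom C A B \<Longrightarrow> g \<in> hom C B D \<Longrightarrow> h \<in> hom C D E \<Longrightarrow>
                       (h \<cdot> g) \<cdot> f = h \<cdot> (g \<cdot> f)"

record ('o, 'm, 'p, 'n) ftor =
  FObj :: "'o \<Rightarrow> 'p"
  FArr :: "'m \<Rightarrow> 'n"

locale cat_functor = source: category A + target: category B
  for A :: "('o, 'm) cat" and B :: "('p, 'n) cat" +
  fixes F :: "('o, 'm, 'p, 'n) ftor"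
  assumes FObj_in_Obj: "X \<in> Obj A \<Longrightarrow> FObj F X \<in> Obj B"
    and FArr_in_hom: "f \<in> hom A X Y \<Longrightarrow> FArr F f \<in> hom B (FObj F X) (FObj F Y)"
    and FArr_Ide: "X \<in> Obj A \<Longrightarrow> FArr F (Ide A X) = Ide B (FObj F X)"
    and FArr_Comp: "f \<in> hom A X Y \<Longrightarrow> g \<in> hom A Y Z \<Longrightarrow>
                      FArr F (g \<cdot>\<^bsub>A\<^esub> f) = FArr F g \<cdot>\<^bsub>B\<^esub> FArr F f"

definition id_ftor :: "('o, 'm, 'o, 'm) ftor" where
  "id_ftor = \<lparr>FObj = (\<lambda>X. X), FArr = (\<lambda>f. f)\<rparr>"

definition comp_ftor ::
  "('p, 'n, 'q, 'k) ftor \<Rightarrow> ('o, 'm, 'p, 'n) ftor \<Rightarrow> ('o, 'm, 'q, 'k) ftor" where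
  "comp_ftor G F = \<lparr>FObj = (\<lambda>X. FObj G (FObj F X)), FArr = (\<lambda>f. FArr G (FArr F f))\<rparr>"

definition nat_trans :: "('o, 'm) cat \<Rightarrow> ('p, 'n) cat \<Rightarrow> ('o, 'm, 'p, 'n) ftor \<Rightarrow>
    ('o, 'm, 'p, 'n) ftor \<Rightarrow> ('o \<Rightarrow> 'n) \<Rightarrow> bool" where
  "nat_trans A B F G \<tau> \<longleftrightarrow>
     (\<forall>X \<in> Obj A. \<tau> X \<in> hom B (FObj F X) (FObj G X)) \<and>
     (\<forall>f \<in> Arr A. \<tau> (Cod A f) \<cdot>\<^bsub>B\<^esub> FArr F f = FArr G f \<cdot>\<^bsub>B\<^esub> \<tau> (Dom A f))"

definition is_iso :: "('o, 'm) cat \<Rightarrow> 'm \<Rightarrow> bool" where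
  "is_iso C f \<longleftrightarrow> f \<in> Arr C \<and>
     (\<exists>g \<in> hom C (Cod C f) (Dom C f).
        g \<cdot>\<^bsub>C\<^esub> f = Ide C (Dom C f) \<and> f \<cdot>\<^bsub>C\<^esub> g = Ide C (Cod C f))"

definition nat_iso :: "('o, 'm) cat \<Rightarrow> ('p, 'n) cat \<Rightarrow> ('o, 'm, 'p, 'n) ftor \<Rightarrow>
    ('o, 'm, 'p, 'n) ftor \<Rightarrow> ('o \<Rightarrow> 'n) \<Rightarrow> bool" where
  "nat_iso A B F G \<tau> \<longleftrightarrow> nat_trans A B F G \<tau> \<and> (\<forall>X \<in> Obj A. is_iso B (\<tau> X))"

definition is_equivalence ::
  "('o, 'm) cat \<Rightarrow> ('p, 'n) cat \<Rightarrow> ('o, 'm, 'p, 'n) ftor \<Rightarrow> bool" where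
  "is_equivalence A B K \<longleftrightarrow> cat_functor A B K \<and>
     (\<exists>H \<sigma> \<tau>. cat_functor B A H \<and>
        nat_iso A A id_ftor (comp_ftor H K) \<sigma> \<and> nat_iso B B (comp_ftor K H) id_ftor \<tau>)"

text \<open>\<open>L \<stileturn> U\<close> with \<open>L : X \<rightarrow> A\<close>, \<open>U : A \<rightarrow> X\<close>, unit \<open>\<eta>\<close> and counit \<open>\<epsilon>\<close>.\<close>

definition adjunction :: "('p, 'n) cat \<Rightarrow> ('o, 'm) cat \<Rightarrow> ('p, 'n, 'o, 'm) ftor \<Rightarrow>
    ('o, 'm, 'p, 'n) ftor \<Rightarrow> ('p \<Rightarrow> 'n) \<Rightarrow> ('o \<Rightarrow> 'm) \<Rightarrow> bool" where
  "adjunction X A L U \<eta> \<epsilon> \<longleftrightarrow>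
     cat_functor X A L \<and> cat_functor A X U \<and>
     nat_trans X X id_ftor (comp_ftor U L) \<eta> \<and> nat_trans A A (comp_ftor L U) id_ftor \<epsilon> \<and>
     (\<forall>x \<in> Obj X. \<epsilon> (FObj L x) \<cdot>\<^bsub>A\<^esub> FArr L (\<eta> x) = Ide A (FObj L x)) \<and>
     (\<forall>a \<in> Obj A. FArr U (\<epsilon> a) \<cdot>\<^bsub>X\<^esub> \<eta> (FObj U a) = Ide X (FObj U a))"

subsection \<open>Full subcategories\<close>

definition full_subcat :: "('o, 'm) cat \<Rightarrow> 'o set \<Rightarrow> ('o, 'm) cat" where
  "full_subcat C S = C\<lparr>Obj := S, Arr := {f \<in> Arr C. Dom C f \<in> S \<and> Cod C f \<in> S}\<rparr>"

definition replete :: "('o, 'm) cat \<Rightarrow> 'o set \<Rightarrow> bool" where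
  "replete C S \<longleftrightarrow> (\<forall>f. is_iso C f \<and> Dom C f \<in> S \<longrightarrow> Cod C f \<in> S)"

text \<open>\<open>F\<close> is a reflector onto the full subcategory on \<open>S\<close> with unit \<open>\<eta>\<close>; \<open>id_ftor\<close> is the inclusion.\<close>

definition reflector ::
  "('o, 'm) cat \<Rightarrow> 'o set \<Rightarrow> ('o, 'm, 'o, 'm) ftor \<Rightarrow> ('o \<Rightarrow> 'm) \<Rightarrow> bool" where
  "reflector C S F \<eta> \<longleftrightarrow> S \<subseteq> Obj C \<and> (\<exists>\<epsilon>. adjunction C (full_subcat C S) F id_ftor \<eta> \<epsilon>)"

definition reflective :: "('o, 'm) cat \<Rightarrow> 'o set \<Rightarrow> bool" where
  "reflective C S \<longleftrightarrow> (\<exists>F \<eta>. reflector C S F \<eta>)"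

subsection \<open>Slice and arrow categories\<close>

text \<open>Arrows of a derived category are triples that record their domain and codomain.\<close>

definition slice :: "('o, 'm) cat \<Rightarrow> 'o \<Rightarrow> ('m, 'm \<times> 'm \<times> 'm) cat" where
  "slice C B =
    \<lparr>Obj = {f \<in> Arr C. Cod C f = B},
     Arr = {(f, u, g). f \<in> Arr C \<and> Cod C f = B \<and> g \<in> Arr C \<and> Cod C g = B \<and>
                       u \<in> hom C (Dom C f) (Dom C g) \<and> g \<cdot>\<^bsub>C\<^esub> u = f},
     Dom = (\<lambda>(f, u, g). f),
     Cod = (\<lambda>(f, u, g). g),
     Ide = (\<lambda>f. (f, Ide C (Dom C f), f)),
     Comp = (\<lambda>(_, v, h) (f, u, _). (f, v \<cdot>\<^bsub>C\<^esub> u, h))\<rparr>"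

definition arrow_cat :: "('o, 'm) cat \<Rightarrow> ('m, 'm \<times> ('m \<times> 'm) \<times> 'm) cat" where
  "arrow_cat C =
    \<lparr>Obj = Arr C,
     Arr = {(f, (u, v), g). f \<in> Arr C \<and> g \<in> Arr C \<and>
                            u \<in> hom C (Dom C f) (Dom C g) \<and> v \<in> hom C (Cod C f) (Cod C g) \<and>
                            g \<cdot>\<^bsub>C\<^esub> u = v \<cdot>\<^bsub>C\<^esub> f},
     Dom = (\<lambda>(f, _, g). f),
     Cod = (\<lambda>(f, _, g). g),
     Ide = (\<lambda>f. (f, (Ide C (Dom C f), Ide C (Cod C f)), f)),
     Comp = (\<lambda>(_, (u', v'), h) (f, (u, v), _). (f, (u' \<cdot>\<^bsub>C\<^esub> u, v' \<cdot>\<^bsub>C\<^esub> v), h))\<rparr>"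

subsection \<open>Monadic functors\<close>

text \<open>The Eilenberg--Moore category of the monad \<open>(T, \<eta>, \<mu>)\<close> on \<open>X\<close>.\<close>

definition em_cat :: "('p, 'n) cat \<Rightarrow> ('p, 'n, 'p, 'n) ftor \<Rightarrow> ('p \<Rightarrow> 'n) \<Rightarrow> ('p \<Rightarrow> 'n) \<Rightarrow>
    ('p \<times> 'n, ('p \<times> 'n) \<times> 'n \<times> ('p \<times> 'n)) cat" where
  "em_cat X T \<eta> \<mu> =
    (let Alg = {(x, h). x \<in> Obj X \<and> h \<in> hom X (FObj T x) x \<and>
                        h \<cdot>\<^bsub>X\<^esub> \<eta> x = Ide X x \<and> h \<cdot>\<^bsub>X\<^esub> \<mu> x = h \<cdot>\<^bsub>X\<^esub> FArr T h}
     in \<lparr>Obj = Alg,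
         Arr = {((x, h), u, (y, k)). (x, h) \<in> Alg \<and> (y, k) \<in> Alg \<and> u \<in> hom X x y \<and>
                                     u \<cdot>\<^bsub>X\<^esub> h = k \<cdot>\<^bsub>X\<^esub> FArr T u},
         Dom = (\<lambda>(a, u, b). a),
         Cod = (\<lambda>(a, u, b). b),
         Ide = (\<lambda>a. (a, Ide X (fst a), a)),
         Comp = (\<lambda>(_, v, c) (a, u, _). (a, v \<cdot>\<^bsub>X\<^esub> u, c))\<rparr>)"

definition comparison_ftor :: "('o, 'm) cat \<Rightarrow> ('o, 'm, 'p, 'n) ftor \<Rightarrow> ('o \<Rightarrow> 'm) \<Rightarrow>
    ('o, 'm, 'p \<times> 'n, ('p \<times> 'n) \<times> 'n \<times> ('p \<times> 'n)) ftor" where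
  "comparison_ftor A U \<epsilon> =
    (let K = (\<lambda>a. (FObj U a, FArr U (\<epsilon> a)))
     in \<lparr>FObj = K, FArr = (\<lambda>f. (K (Dom A f), FArr U f, K (Cod A f)))\<rparr>)"

definition monadic ::
  "('o, 'm) cat \<Rightarrow> ('p, 'n) cat \<Rightarrow> ('o, 'm, 'p, 'n) ftor \<Rightarrow> bool" where
  "monadic A X U \<longleftrightarrow>
     (\<exists>L \<eta> \<epsilon>. adjunction X A L U \<eta> \<epsilon> \<and>
        is_equivalence A (em_cat X (comp_ftor U L) \<eta> (\<lambda>x. FArr U (\<epsilon> (FObj L x))))
          (comparison_ftor A U \<epsilon>))"

section \<open>Homological categories\<close>

subsection \<open>Zero morphisms, kernels, cokernels\<close>

definition zero_obj :: "('o, 'm) cat \<Rightarrow> 'o \<Rightarrow> bool" where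
  "zero_obj C Z \<longleftrightarrow> Z \<in> Obj C \<and>
     (\<forall>A \<in> Obj C. (\<exists>!f. f \<in> hom C A Z) \<and> (\<exists>!f. f \<in> hom C Z A))"

definition pointed :: "('o, 'm) cat \<Rightarrow> bool" where
  "pointed C \<longleftrightarrow> category C \<and> (\<exists>Z. zero_obj C Z)"

definition zero_mor :: "('o, 'm) cat \<Rightarrow> 'm \<Rightarrow> bool" where
  "zero_mor C f \<longleftrightarrow> f \<in> Arr C \<and>
     (\<exists>Z g h. zero_obj C Z \<and> g \<in> hom C (Dom C f) Z \<and> h \<in> hom C Z (Cod C f) \<and> f = h \<cdot>\<^bsub>C\<^esub> g)"

definition is_kernel :: "('o, 'm) cat \<Rightarrow> 'm \<Rightarrow> 'm \<Rightarrow> bool" where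
  "is_kernel C k f \<longleftrightarrow>
     k \<in> Arr C \<and> f \<in> Arr C \<and> Cod C k = Dom C f \<and> zero_mor C (f \<cdot>\<^bsub>C\<^esub> k) \<and>
     (\<forall>x \<in> Arr C. Cod C x = Dom C f \<and> zero_mor C (f \<cdot>\<^bsub>C\<^esub> x) \<longrightarrow>
        (\<exists>!u. u \<in> hom C (Dom C x) (Dom C k) \<and> k \<cdot>\<^bsub>C\<^esub> u = x))"

definition is_cokernel :: "('o, 'm) cat \<Rightarrow> 'm \<Rightarrow> 'm \<Rightarrow> bool" where
  "is_cokernel C q f \<longleftrightarrow>
     q \<in> Arr C \<and> f \<in> Arr C \<and> Dom C q = Cod C f \<and> zero_mor C (q \<cdot>\<^bsub>C\<^esub> f) \<and>
     (\<forall>x \<in> Arr C. Dom C x = Cod C f \<and> zero_mor C (x \<cdot>\<^bsub>C\<^esub> f) \<longrightarrow>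
        (\<exists>!u. u \<in> hom C (Cod C q) (Cod C x) \<and> u \<cdot>\<^bsub>C\<^esub> q = x))"

definition normal_mono :: "('o, 'm) cat \<Rightarrow> 'm \<Rightarrow> bool" where
  "normal_mono C k \<longleftrightarrow> (\<exists>f. is_kernel C k f)"

definition normal_epi :: "('o, 'm) cat \<Rightarrow> 'm \<Rightarrow> bool" where
  "normal_epi C q \<longleftrightarrow> (\<exists>f. is_cokernel C q f)"

definition short_exact :: "('o, 'm) cat \<Rightarrow> 'm \<Rightarrow> 'm \<Rightarrow> bool" where
  "short_exact C k f \<longleftrightarrow> is_kernel C k f \<and> is_cokernel C f k"

definition split_short_exact :: "('o, 'm) cat \<Rightarrow> 'm \<Rightarrow> 'm \<Rightarrow> 'm \<Rightarrow> bool" where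
  "split_short_exact C k f s \<longleftrightarrow>
     is_kernel C k f \<and> s \<in> hom C (Cod C f) (Dom C f) \<and> f \<cdot>\<^bsub>C\<^esub> s = Ide C (Cod C f)"

text \<open>\<open>K[f] \<in> S\<close>; kernels being determined up to isomorphism, the choice of the kernel is
  irrelevant for replete \<open>S\<close>.\<close>

definition kernel_obj_in :: "('o, 'm) cat \<Rightarrow> 'm \<Rightarrow> 'o set \<Rightarrow> bool" where
  "kernel_obj_in C f S \<longleftrightarrow> (\<exists>k. is_kernel C k f \<and> Dom C k \<in> S)"

subsection \<open>Pullbacks, regular and protomodular categories\<close>

text \<open>In \<open>is_pullback C p q f g\<close> the pullback of the cospan \<open>(f, g)\<close> has projections \<open>p\<close> to
  the domain of \<open>f\<close> and \<open>q\<close> to the domain of \<open>g\<close>.  Thus \<open>q\<close> is the pullback of \<open>f\<close> along \<open>g\<close>.\<close>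

definition is_pullback :: "('o, 'm) cat \<Rightarrow> 'm \<Rightarrow> 'm \<Rightarrow> 'm \<Rightarrow> 'm \<Rightarrow> bool" where
  "is_pullback C p q f g \<longleftrightarrow>
     f \<in> Arr C \<and> g \<in> Arr C \<and> Cod C f = Cod C g \<and>
     p \<in> Arr C \<and> q \<in> Arr C \<and> Dom C p = Dom C q \<and> Cod C p = Dom C f \<and> Cod C q = Dom C g \<and>
     f \<cdot>\<^bsub>C\<^esub> p = g \<cdot>\<^bsub>C\<^esub> q \<and>
     (\<forall>x \<in> Arr C. \<forall>y \<in> Arr C.
        Dom C x = Dom C y \<and> Cod C x = Dom C f \<and> Cod C y = Dom C g \<and> f \<cdot>\<^bsub>C\<^esub> x = g \<cdot>\<^bsub>C\<^esub> y \<longrightarrow>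
        (\<exists>!u. u \<in> hom C (Dom C x) (Dom C p) \<and> p \<cdot>\<^bsub>C\<^esub> u = x \<and> q \<cdot>\<^bsub>C\<^esub> u = y))"

definition has_pullbacks :: "('o, 'm) cat \<Rightarrow> bool" where
  "has_pullbacks C \<longleftrightarrow>
     (\<forall>f \<in> Arr C. \<forall>g \<in> Arr C. Cod C f = Cod C g \<longrightarrow> (\<exists>p q. is_pullback C p q f g))"

definition split_epi :: "('o, 'm) cat \<Rightarrow> 'm \<Rightarrow> bool" where
  "split_epi C f \<longleftrightarrow> f \<in> Arr C \<and> (\<exists>s \<in> hom C (Cod C f) (Dom C f). f \<cdot>\<^bsub>C\<^esub> s = Ide C (Cod C f))"

definition has_pullbacks_along_split_epis :: "('o, 'm) cat \<Rightarrow> bool" where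
  "has_pullbacks_along_split_epis C \<longleftrightarrow>
     (\<forall>f \<in> Arr C. \<forall>g. split_epi C g \<and> Cod C f = Cod C g \<longrightarrow> (\<exists>p q. is_pullback C p q f g))"

definition has_terminal :: "('o, 'm) cat \<Rightarrow> bool" where
  "has_terminal C \<longleftrightarrow> (\<exists>Z \<in> Obj C. \<forall>A \<in> Obj C. \<exists>!f. f \<in> hom C A Z)"

definition is_coequalizer :: "('o, 'm) cat \<Rightarrow> 'm \<Rightarrow> 'm \<Rightarrow> 'm \<Rightarrow> bool" where
  "is_coequalizer C q u v \<longleftrightarrow>
     u \<in> Arr C \<and> v \<in> hom C (Dom C u) (Cod C u) \<and>
     q \<in> Arr C \<and> Dom C q = Cod C u \<and> q \<cdot>\<^bsub>C\<^esub> u = q \<cdot>\<^bsub>C\<^esub> v \<and>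
     (\<forall>x \<in> Arr C. Dom C x = Cod C u \<and> x \<cdot>\<^bsub>C\<^esub> u = x \<cdot>\<^bsub>C\<^esub> v \<longrightarrow>
        (\<exists>!w. w \<in> hom C (Cod C q) (Cod C x) \<and> w \<cdot>\<^bsub>C\<^esub> q = x))"

definition regular_epi :: "('o, 'm) cat \<Rightarrow> 'm \<Rightarrow> bool" where
  "regular_epi C q \<longleftrightarrow> (\<exists>u v. is_coequalizer C q u v)"

text \<open>Finite completeness is rendered as existence of a terminal object and of pullbacks.\<close>

definition regular_cat :: "('o, 'm) cat \<Rightarrow> bool" where
  "regular_cat C \<longleftrightarrow> category C \<and> has_terminal C \<and> has_pullbacks C \<and>
     (\<forall>f p q. is_pullback C p q f f \<longrightarrow> (\<exists>c. is_coequalizer C c p q)) \<and>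
     (\<forall>f g p q. is_pullback C p q f g \<and> regular_epi C f \<longrightarrow> regular_epi C q)"

definition split_short_five :: "('o, 'm) cat \<Rightarrow> bool" where
  "split_short_five C \<longleftrightarrow>
     (\<forall>k f s k' f' s' a b c.
        split_short_exact C k f s \<and> split_short_exact C k' f' s' \<and>
        a \<in> hom C (Dom C k) (Dom C k') \<and> b \<in> hom C (Dom C f) (Dom C f') \<and>
        c \<in> hom C (Cod C f) (Cod C f') \<and>
        b \<cdot>\<^bsub>C\<^esub> k = k' \<cdot>\<^bsub>C\<^esub> a \<and> f' \<cdot>\<^bsub>C\<^esub> b = c \<cdot>\<^bsub>C\<^esub> f \<and> b \<cdot>\<^bsub>C\<^esub> s = s' \<cdot>\<^bsub>C\<^esub> c \<and>
        is_iso C a \<and> is_iso C c \<longrightarrow> is_iso C b)"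

definition pointed_protomodular :: "('o, 'm) cat \<Rightarrow> bool" where
  "pointed_protomodular C \<longleftrightarrow>
     pointed C \<and> has_pullbacks_along_split_epis C \<and> split_short_five C"

definition homological :: "('o, 'm) cat \<Rightarrow> bool" where
  "homological C \<longleftrightarrow> pointed_protomodular C \<and> regular_cat C"

definition protoadditive ::
  "('o, 'm) cat \<Rightarrow> ('p, 'n) cat \<Rightarrow> ('o, 'm, 'p, 'n) ftor \<Rightarrow> bool" where
  "protoadditive A B F \<longleftrightarrow> cat_functor A B F \<and>
     (\<forall>k f s. split_short_exact A k f s \<longrightarrow>
        split_short_exact B (FArr F k) (FArr F f) (FArr F s))"

subsection \<open>Effective descent morphisms\<close>

text \<open>A choice of pullbacks along \<open>p\<close>: \<open>c f\<close> is the pair of projections of the pullback of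
  \<open>(f, p)\<close>, so that \<open>p\<^sup>*(f)\<close> is the second one.\<close>

definition pullback_choice :: "('o, 'm) cat \<Rightarrow> 'm \<Rightarrow> ('m \<Rightarrow> 'm \<times> 'm) \<Rightarrow> bool" where
  "pullback_choice C p c \<longleftrightarrow>
     (\<forall>f \<in> Arr C. Cod C f = Cod C p \<longrightarrow> is_pullback C (fst (c f)) (snd (c f)) f p)"

definition pullback_ftor :: "('o, 'm) cat \<Rightarrow> ('m \<Rightarrow> 'm \<times> 'm) \<Rightarrow>
    ('m, 'm \<times> 'm \<times> 'm, 'm, 'm \<times> 'm \<times> 'm) ftor" where
  "pullback_ftor C c =
    \<lparr>FObj = (\<lambda>f. snd (c f)),
     FArr = (\<lambda>(f, u, g).
       (snd (c f),
        THE w. w \<in> hom C (Dom C (snd (c f))) (Dom C (snd (c g))) \<and>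
               fst (c g) \<cdot>\<^bsub>C\<^esub> w = u \<cdot>\<^bsub>C\<^esub> fst (c f) \<and> snd (c g) \<cdot>\<^bsub>C\<^esub> w = snd (c f),
        snd (c g)))\<rparr>"

text \<open>Pullback functors for different choices are naturally isomorphic, so monadicity does not
  depend on the choice.\<close>

definition effective_descent :: "('o, 'm) cat \<Rightarrow> 'm \<Rightarrow> bool" where
  "effective_descent C p \<longleftrightarrow> p \<in> Arr C \<and>
     (\<exists>c. pullback_choice C p c \<and>
          monadic (slice C (Cod C p)) (slice C (Dom C p)) (pullback_ftor C c))"

definition EffDes :: "('o, 'm) cat \<Rightarrow> ('m, 'm \<times> ('m \<times> 'm) \<times> 'm) cat" where
  "EffDes C = full_subcat (arrow_cat C) {f. effective_descent C f}"

section \<open>Torsion theories and normal extensions\<close>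

definition torsion_theory :: "('o, 'm) cat \<Rightarrow> 'o set \<Rightarrow> 'o set \<Rightarrow> bool" where
  "torsion_theory C \<T> \<F> \<longleftrightarrow> pointed C \<and>
     \<T> \<subseteq> Obj C \<and> \<F> \<subseteq> Obj C \<and> replete C \<T> \<and> replete C \<F> \<and>
     (\<forall>A \<in> \<T>. \<forall>B \<in> \<F>. \<forall>f \<in> hom C A B. zero_mor C f) \<and>
     (\<forall>A \<in> Obj C. \<exists>t e. short_exact C t e \<and> Cod C t = A \<and> Dom C t \<in> \<T> \<and> Cod C e \<in> \<F>)"

text \<open>\<open>F\<close> is the reflector of a torsion theory, with unit \<open>\<eta>\<close>, and \<open>t A : T(A) \<rightarrow> A\<close> is the
  chosen torsion part of \<open>A\<close>.\<close>

definition torsion_reflector :: "('o, 'm) cat \<Rightarrow> 'o set \<Rightarrow> 'o set \<Rightarrow>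
    ('o, 'm, 'o, 'm) ftor \<Rightarrow> ('o \<Rightarrow> 'm) \<Rightarrow> ('o \<Rightarrow> 'm) \<Rightarrow> bool" where
  "torsion_reflector C \<T> \<F> F \<eta> t \<longleftrightarrow> reflector C \<F> F \<eta> \<and>
     (\<forall>A \<in> Obj C. short_exact C (t A) (\<eta> A) \<and> Dom C (t A) \<in> \<T>)"

definition trivial_extension ::
  "('o, 'm) cat \<Rightarrow> ('o, 'm, 'o, 'm) ftor \<Rightarrow> ('o \<Rightarrow> 'm) \<Rightarrow> 'm \<Rightarrow> bool" where
  "trivial_extension C F \<eta> f \<longleftrightarrow>
     is_pullback C f (\<eta> (Dom C f)) (\<eta> (Cod C f)) (FArr F f)"

definition normal_extension ::
  "('o, 'm) cat \<Rightarrow> ('o, 'm, 'o, 'm) ftor \<Rightarrow> ('o \<Rightarrow> 'm) \<Rightarrow> 'm \<Rightarrow> bool" where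
  "normal_extension C F \<eta> f \<longleftrightarrow> effective_descent C f \<and>
     (\<exists>p q. is_pullback C p q f f \<and> trivial_extension C F \<eta> q)"

definition NExt ::
  "('o, 'm) cat \<Rightarrow> ('o, 'm, 'o, 'm) ftor \<Rightarrow> ('o \<Rightarrow> 'm) \<Rightarrow> 'm set" where
  "NExt C F \<eta> = {f. normal_extension C F \<eta> f}"

definition inverted :: "('o, 'm) cat \<Rightarrow> ('p, 'n) cat \<Rightarrow> ('o, 'm, 'p, 'n) ftor \<Rightarrow> 'm set" where
  "inverted A B F = {f \<in> Arr A. is_iso B (FArr F f)}"

definition stably :: "('o, 'm) cat \<Rightarrow> 'm set \<Rightarrow> 'm set" where
  "stably C E = {f \<in> Arr C. \<forall>g p q. is_pullback C p q f g \<longrightarrow> q \<in> E}"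

definition E_bar :: "('o, 'm) cat \<Rightarrow> 'o set \<Rightarrow> 'm set" where
  "E_bar C \<T> = {f. normal_epi C f \<and> kernel_obj_in C f \<T>}"

definition M_bar :: "('o, 'm) cat \<Rightarrow> 'o set \<Rightarrow> 'm set" where
  "M_bar C \<F> = {f \<in> Arr C. kernel_obj_in C f \<F>}"

definition factors_as ::
  "('o, 'm) cat \<Rightarrow> 'm set \<Rightarrow> 'm set \<Rightarrow> 'm \<Rightarrow> 'm \<Rightarrow> 'm \<Rightarrow> bool" where
  "factors_as C E M f m e \<longleftrightarrow>
     e \<in> Arr C \<and> m \<in> Arr C \<and> Cod C e = Dom C m \<and> f = m \<cdot>\<^bsub>C\<^esub> e \<and> e \<in> E \<and> m \<in> M"

definition iso_factorisations ::
  "('o, 'm) cat \<Rightarrow> 'm \<Rightarrow> 'm \<Rightarrow> 'm \<Rightarrow> 'm \<Rightarrow> bool" where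
  "iso_factorisations C m e m' e' \<longleftrightarrow>
     (\<exists>i. is_iso C i \<and> i \<in> hom C (Cod C e) (Cod C e') \<and> i \<cdot>\<^bsub>C\<^esub> e = e' \<and> m' \<cdot>\<^bsub>C\<^esub> i = m)"

end

theory Submission
  imports Defs
begin

text \<open>
  Since a monadic \<open>p\<^sup>*\<close> reflects isomorphisms and every algebra comes from an arrow into the
  codomain of \<open>p\<close>, effective descent in a regular category means: \<open>p\<close> is a regular epimorphism and
  every descent datum along \<open>p\<close>, expressed on generalised elements, is effective.  In this form
  composites of effective descent morphisms are effective, and so is \<open>g\<close> whenever \<open>g \<cdot> f\<close> is
  effective and \<open>f\<close> is a regular epimorphism.

  Protoadditivity makes the normal extensions exactly the effective descent morphisms with
  torsion-free kernel.  Condition (N) allows one to divide \<open>A\<close> by \<open>T(K[f])\<close>; this is the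
  factorisation \<open>f = m \<cdot> e\<close>, and cancellation makes \<open>m\<close> effective.  Conversely, if \<open>e\<close> is stably
  inverted by \<open>F\<close> and \<open>K[m]\<close> is torsion-free, then \<open>K[f] \<rightarrow> K[m]\<close> is a pullback of \<open>e\<close>, hence
  the reflection of \<open>K[f]\<close> and a regular epimorphism; the short five lemma then forces \<open>e\<close> itself
  to be a regular epimorphism.
\<close>

text \<open>The obstacle is that \<open>monadic\<close> only asserts the existence of some left
  adjoint and some quasi-inverse, whereas the theorem needs effective descent morphisms to compose
  and to cancel. Both properties are proved for \<open>effdesc\<close>, with arrows read as
  generalised elements: arrows may be defined or compared over a regular epimorphism on which the
  elements involved have been lifted (\<open>cover\<close>, \<open>regular_epi_descend\<close>). The
  only link with monads is \<open>effective_descent_iff\<close>. The kernel criterion for normal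
  extensions rests on the diagonal. Protoadditivity concerns split sequences only, and
  \<open>f\<close> need not split, but the diagonal splits the projections of its kernel pair. The
  same device turns the split short five lemma into the statement that regular epimorphisms are
  cokernels, and into the short five lemma. The comparison with the pair of \<open>E_bar\<close> and
  \<open>M_bar\<close> therefore comes first, and uniqueness is read off from that pair.\<close>

lemma hom_iff: "f \<in> hom C A B \<longleftrightarrow> f \<in> Arr C \<and> Dom C f = A \<and> Cod C f = B"
  by (auto simp: hom_def)

section \<open>Pullbacks and generalised elements\<close>

context category
begin

lemma arr_comp [simp]:
  assumes "g \<in> Arr C" "f \<in> Arr C" "Cod C f = Dom C g"
  shows "g \<cdot> f \<in> Arr C" "Dom C (g \<cdot> f) = Dom C f" "Cod C (g \<cdot> f) = Cod C g"
  using Comp_in_hom[of f "Dom C f" "Dom C g" g "Cod C g"] assms by (auto simp: hom_iff)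

lemma comp_assoc [simp]:
  assumes "f \<in> Arr C" "g \<in> Arr C" "h \<in> Arr C" "Cod C f = Dom C g" "Cod C g = Dom C h"
  shows "(h \<cdot> g) \<cdot> f = h \<cdot> (g \<cdot> f)"
  using Comp_assoc[of f "Dom C f" "Dom C g" g "Dom C h" h "Cod C h"] assms by (auto simp: hom_iff)

lemma ide_arr [simp]:
  assumes "A \<in> Obj C"
  shows "Ide C A \<in> Arr C" "Dom C (Ide C A) = A" "Cod C (Ide C A) = A"
  using Ide_in_hom[OF assms] by (auto simp: hom_iff)

lemma dom_cod_obj [simp]: "f \<in> Arr C \<Longrightarrow> Dom C f \<in> Obj C" "f \<in> Arr C \<Longrightarrow> Cod C f \<in> Obj C"
  by (auto intro: Dom_in_Obj Cod_in_Obj)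

lemma comp_ide [simp]: "f \<in> Arr C \<Longrightarrow> Dom C f = A \<Longrightarrow> f \<cdot> Ide C A = f"
  using Comp_Ide[of f A "Cod C f"] by (auto simp: hom_iff)

lemma ide_comp [simp]: "f \<in> Arr C \<Longrightarrow> Cod C f = A \<Longrightarrow> Ide C A \<cdot> f = f"
  using Ide_Comp[of f "Dom C f" A] by (auto simp: hom_iff)

text \<open>Simplification brackets composites to the right, so an equation between two composites
  no longer matches once a further arrow precedes both sides. This is the equation with that arrow
  \<open>t\<close> built in; \<open>comp_eq_extend1\<close> is the version with an unsplit
  right-hand side.\<close>

lemma comp_eq_extend:
  assumes "a \<cdot> b = c \<cdot> d" "a \<in> Arr C" "b \<in> Arr C" "c \<in> Arr C" "d \<in> Arr C" "t \<in> Arr C"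
    "Cod C b = Dom C a" "Cod C d = Dom C c" "Cod C t = Dom C b" "Dom C d = Dom C b"
  shows "a \<cdot> (b \<cdot> t) = c \<cdot> (d \<cdot> t)"
  using assms comp_assoc[of t b a] comp_assoc[of t d c] by simp

lemma comp_eq_extend1:
  assumes "a \<cdot> b = c" "a \<in> Arr C" "b \<in> Arr C" "t \<in> Arr C"
    "Cod C b = Dom C a" "Cod C t = Dom C b"
  shows "a \<cdot> (b \<cdot> t) = c \<cdot> t"
  using assms comp_assoc[of t b a] by simp

text \<open>The description operator parallels the one in \<open>pullback_ftor\<close>, so that
  \<open>U_simps\<close> can later express the action of the pullback functor on arrows through
  \<open>pair\<close>.\<close>

definition pair :: "'m \<Rightarrow> 'm \<Rightarrow> 'm \<Rightarrow> 'm \<Rightarrow> 'm" where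
  "pair p q x y = (THE u. u \<in> hom C (Dom C x) (Dom C p) \<and> p \<cdot> u = x \<and> q \<cdot> u = y)"

lemma pbD:
  assumes "is_pullback C p q f g"
  shows "f \<in> Arr C" "g \<in> Arr C" "p \<in> Arr C" "q \<in> Arr C"
    "Cod C f = Cod C g" "Dom C p = Dom C q" "Cod C p = Dom C f" "Cod C q = Dom C g" "f \<cdot> p = g \<cdot> q"
  using assms by (auto simp: is_pullback_def)

lemma pb_comm:
  assumes "is_pullback C p q f g" "x \<in> Arr C" "Cod C x = Dom C q"
  shows "f \<cdot> (p \<cdot> x) = g \<cdot> (q \<cdot> x)"
  by (rule comp_eq_extend[OF pbD(9)[OF assms(1)]]) (simp_all add: pbD[OF assms(1)] assms(2,3))

lemma pair:
  assumes "is_pullback C p q f g" "x \<in> Arr C" "y \<in> Arr C" "Dom C x = Dom C y"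
    "Cod C x = Dom C f" "Cod C y = Dom C g" "f \<cdot> x = g \<cdot> y"
  shows "pair p q x y \<in> Arr C" "Dom C (pair p q x y) = Dom C y" "Cod C (pair p q x y) = Dom C p"
    "p \<cdot> pair p q x y = x" "q \<cdot> pair p q x y = y"
proof -
  have "\<exists>!u. u \<in> hom C (Dom C x) (Dom C p) \<and> p \<cdot> u = x \<and> q \<cdot> u = y"
    using assms unfolding is_pullback_def by blast
  from theI'[OF this, folded pair_def] show "pair p q x y \<in> Arr C"
    "Dom C (pair p q x y) = Dom C y" "Cod C (pair p q x y) = Dom C p"
    "p \<cdot> pair p q x y = x" "q \<cdot> pair p q x y = y"
    using assms(4) by (auto simp: hom_iff)
qed

lemma pb_ext:
  assumes pb: "is_pullback C p q f g" and uv: "u \<in> Arr C" "v \<in> Arr C" "Dom C u = Dom C v"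
    "Cod C u = Dom C q" "Cod C v = Dom C q" "p \<cdot> u = p \<cdot> v" "q \<cdot> u = q \<cdot> v"
  shows "u = v"
proof -
  note [simp] = pbD[OF pb]
  have *: "\<exists>!w. w \<in> hom C (Dom C x) (Dom C p) \<and> p \<cdot> w = x \<and> q \<cdot> w = y"
    if "x \<in> Arr C" "y \<in> Arr C" "Dom C x = Dom C y" "Cod C x = Dom C f" "Cod C y = Dom C g" "f \<cdot> x = g \<cdot> y" for x y
    using pb that unfolding is_pullback_def by blast
  have "\<exists>!w. w \<in> hom C (Dom C (p \<cdot> u)) (Dom C p) \<and> p \<cdot> w = p \<cdot> u \<and> q \<cdot> w = q \<cdot> u"
    by (rule *) (simp_all add: pb_comm[OF pb uv(1,4)] uv(1,4))
  thus ?thesis using uv by (auto simp: hom_iff)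
qed

lemma pbI:
  assumes "f \<in> Arr C" "g \<in> Arr C" "p \<in> Arr C" "q \<in> Arr C"
    "Cod C f = Cod C g" "Dom C p = Dom C q" "Cod C p = Dom C f" "Cod C q = Dom C g" "f \<cdot> p = g \<cdot> q"
    and ex: "\<And>x y. \<lbrakk>x \<in> Arr C; y \<in> Arr C; Dom C x = Dom C y; Cod C x = Dom C f; Cod C y = Dom C g;
      f \<cdot> x = g \<cdot> y\<rbrakk> \<Longrightarrow> \<exists>u. u \<in> Arr C \<and> Dom C u = Dom C y \<and> Cod C u = Dom C q \<and> p \<cdot> u = x \<and> q \<cdot> u = y"
    and un: "\<And>u v. \<lbrakk>u \<in> Arr C; v \<in> Arr C; Dom C u = Dom C v; Cod C u = Dom C q; Cod C v = Dom C q;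
      p \<cdot> u = p \<cdot> v; q \<cdot> u = q \<cdot> v\<rbrakk> \<Longrightarrow> u = v"
  shows "is_pullback C p q f g"
  unfolding is_pullback_def
proof (intro conjI ballI impI)
  fix x y assume xy: "x \<in> Arr C" "y \<in> Arr C"
    "Dom C x = Dom C y \<and> Cod C x = Dom C f \<and> Cod C y = Dom C g \<and> f \<cdot> x = g \<cdot> y"
  then obtain u where u: "u \<in> Arr C" "Dom C u = Dom C y" "Cod C u = Dom C q" "p \<cdot> u = x" "q \<cdot> u = y"
    using ex[of x y] by auto
  show "\<exists>!u. u \<in> hom C (Dom C x) (Dom C p) \<and> p \<cdot> u = x \<and> q \<cdot> u = y"
    using u xy assms(6) un by (intro ex1I[of _ u]) (auto simp: hom_iff)
qed (use assms in auto)

lemma pb_swap: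
  assumes "is_pullback C p q f g" shows "is_pullback C q p g f"
proof -
  note [simp] = pbD[OF assms]
  show ?thesis
  proof (rule pbI)
    fix x y assume "x \<in> Arr C" "y \<in> Arr C" "Dom C x = Dom C y" "Cod C x = Dom C g" "Cod C y = Dom C f"
      "g \<cdot> x = f \<cdot> y"
    thus "\<exists>u. u \<in> Arr C \<and> Dom C u = Dom C y \<and> Cod C u = Dom C p \<and> q \<cdot> u = x \<and> p \<cdot> u = y"
      by (intro exI[of _ "pair p q y x"]) (simp add: pair[OF assms])
  next
    fix u v assume "u \<in> Arr C" "v \<in> Arr C" "Dom C u = Dom C v" "Cod C u = Dom C p" "Cod C v = Dom C p"
      "q \<cdot> u = q \<cdot> v" "p \<cdot> u = p \<cdot> v"
    thus "u = v" by - (rule pb_ext[OF assms]; auto)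
  qed auto
qed

lemma pb_paste:
  assumes 1: "is_pullback C p q f g" and 2: "is_pullback C p' q' q h"
  shows "is_pullback C (p \<cdot> p') q' f (g \<cdot> h)"
proof -
  note [simp] = pbD[OF 1] pbD[OF 2]
  have [simp]: "Cod C h = Dom C g" using pbD(5)[OF 2] by simp
  show ?thesis
  proof (rule pbI)
    show "f \<cdot> (p \<cdot> p') = (g \<cdot> h) \<cdot> q'" using pb_comm[OF 1, of p'] by simp
  next
    fix x y assume x: "x \<in> Arr C" "y \<in> Arr C" "Dom C x = Dom C y" "Cod C x = Dom C f"
      "Cod C y = Dom C (g \<cdot> h)" "f \<cdot> x = (g \<cdot> h) \<cdot> y"
    show "\<exists>u. u \<in> Arr C \<and> Dom C u = Dom C y \<and> Cod C u = Dom C q' \<and> (p \<cdot> p') \<cdot> u = x \<and> q' \<cdot> u = y"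
      using x by (intro exI[of _ "pair p' q' (pair p q x (h \<cdot> y)) y"]) (simp add: pair[OF 1] pair[OF 2])
  next
    fix u v assume u: "u \<in> Arr C" "v \<in> Arr C" "Dom C u = Dom C v" "Cod C u = Dom C q'" "Cod C v = Dom C q'"
      "(p \<cdot> p') \<cdot> u = (p \<cdot> p') \<cdot> v" "q' \<cdot> u = q' \<cdot> v"
    have "p' \<cdot> u = p' \<cdot> v"
      using u by - (rule pb_ext[OF 1]; (auto simp: pb_comm[OF 2]))
    thus "u = v" using u by - (rule pb_ext[OF 2]; auto)
  qed auto
qed

section \<open>Monomorphisms, epimorphisms, coequalisers and isomorphisms\<close>

definition monic :: "'m \<Rightarrow> bool" where
  "monic m \<longleftrightarrow> m \<in> Arr C \<and> (\<forall>u\<in>Arr C. \<forall>v\<in>Arr C. Dom C u = Dom C v \<longrightarrow> Cod C u = Dom C m \<longrightarrow>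
     Cod C v = Dom C m \<longrightarrow> m \<cdot> u = m \<cdot> v \<longrightarrow> u = v)"

lemma monicD: "\<lbrakk>monic m; m \<cdot> u = m \<cdot> v; u \<in> Arr C; v \<in> Arr C; Dom C u = Dom C v; Cod C u = Dom C m;
  Cod C v = Dom C m\<rbrakk> \<Longrightarrow> u = v"
  by (auto simp: monic_def)

definition epic :: "'m \<Rightarrow> bool" where
  "epic q \<longleftrightarrow> q \<in> Arr C \<and> (\<forall>u\<in>Arr C. \<forall>v\<in>Arr C. Dom C u = Cod C q \<longrightarrow> Dom C v = Cod C q \<longrightarrow>
     u \<cdot> q = v \<cdot> q \<longrightarrow> u = v)"

lemma epicD: "\<lbrakk>epic q; u \<cdot> q = v \<cdot> q; u \<in> Arr C; v \<in> Arr C; Dom C u = Cod C q; Dom C v = Cod C q\<rbrakk>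
  \<Longrightarrow> u = v"
  by (auto simp: epic_def)

lemma coequalizer_epic:
  assumes "is_coequalizer C q u v" shows "epic q"
proof -
  have *: "q \<in> Arr C" "u \<in> Arr C" "v \<in> Arr C" "Cod C u = Dom C q" "Cod C v = Dom C q" "Dom C v = Dom C u" "q \<cdot> u = q \<cdot> v"
    using assms by (auto simp: is_coequalizer_def hom_iff)
  show ?thesis unfolding epic_def
  proof (intro conjI ballI impI)
    fix a b assume a: "a \<in> Arr C" "b \<in> Arr C" "Dom C a = Cod C q" "Dom C b = Cod C q" "a \<cdot> q = b \<cdot> q"
    have cod: "Cod C b = Cod C a" using a *(1) by (metis arr_comp(3))
    have uni: "\<exists>!w. w \<in> hom C (Cod C q) (Cod C x) \<and> w \<cdot> q = x"
      if "x \<in> Arr C" "Dom C x = Cod C u" "x \<cdot> u = x \<cdot> v" for x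
      using assms that unfolding is_coequalizer_def by blast
    have "\<exists>!w. w \<in> hom C (Cod C q) (Cod C (a \<cdot> q)) \<and> w \<cdot> q = a \<cdot> q"
      by (rule uni) (use a * in simp_all)
    thus "a = b" using a * cod by (auto simp: hom_iff)
  qed (use * in auto)
qed

lemma regular_epi_epic: "regular_epi C q \<Longrightarrow> epic q"
  unfolding regular_epi_def by (auto intro: coequalizer_epic)

lemma regular_epi_arr: "regular_epi C q \<Longrightarrow> q \<in> Arr C"
  using regular_epi_epic by (auto simp: epic_def)

text \<open>The arrow \<open>h\<close> is asked to be constant on all pairs of elements that
  \<open>q\<close> identifies, so that uses of this lemma need not know which pair of arrows
  \<open>q\<close> coequalises. The hypothesis is applied to exactly that pair.\<close>

lemma regular_epi_descend:
  assumes q: "regular_epi C q" and h: "h \<in> Arr C" "Dom C h = Dom C q"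
    and compat: "\<And>x y. \<lbrakk>x \<in> Arr C; y \<in> Arr C; Dom C x = Dom C y; Cod C x = Dom C q; Cod C y = Dom C q;
      q \<cdot> x = q \<cdot> y\<rbrakk> \<Longrightarrow> h \<cdot> x = h \<cdot> y"
  obtains l where "l \<in> Arr C" "Dom C l = Cod C q" "Cod C l = Cod C h" "l \<cdot> q = h"
proof -
  obtain u v where uv: "is_coequalizer C q u v" using q by (auto simp: regular_epi_def)
  have *: "q \<in> Arr C" "u \<in> Arr C" "v \<in> Arr C" "Cod C u = Dom C q" "Cod C v = Dom C q" "Dom C v = Dom C u" "q \<cdot> u = q \<cdot> v"
    using uv by (auto simp: is_coequalizer_def hom_iff)
  have "h \<cdot> u = h \<cdot> v" by (rule compat) (use * in simp_all)
  hence "\<exists>!w. w \<in> hom C (Cod C q) (Cod C h) \<and> w \<cdot> q = h"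
    using uv h *(4) unfolding is_coequalizer_def by simp
  thus ?thesis using that by (auto simp: hom_iff)
qed

lemma coequalizerI:
  assumes "u \<in> Arr C" "v \<in> Arr C" "Dom C v = Dom C u" "Cod C v = Cod C u" "epic q"
    "Dom C q = Cod C u" "q \<cdot> u = q \<cdot> v"
    and "\<And>x. \<lbrakk>x \<in> Arr C; Dom C x = Cod C u; x \<cdot> u = x \<cdot> v\<rbrakk> \<Longrightarrow>
      \<exists>w. w \<in> Arr C \<and> Dom C w = Cod C q \<and> Cod C w = Cod C x \<and> w \<cdot> q = x"
  shows "is_coequalizer C q u v"
  unfolding is_coequalizer_def
proof (intro conjI ballI impI)
  fix x assume x: "x \<in> Arr C" "Dom C x = Cod C u \<and> x \<cdot> u = x \<cdot> v"
  then obtain w where w: "w \<in> Arr C" "Dom C w = Cod C q" "Cod C w = Cod C x" "w \<cdot> q = x"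
    using assms(8)[of x] by auto
  show "\<exists>!w. w \<in> hom C (Cod C q) (Cod C x) \<and> w \<cdot> q = x"
    using w epicD[OF assms(5)] by (intro ex1I[of _ w]) (auto simp: hom_iff)
qed (use assms in \<open>auto simp: hom_iff epic_def\<close>)

lemma isoI:
  assumes "f \<in> Arr C" "g \<in> Arr C" "Dom C g = Cod C f" "Cod C g = Dom C f"
    "g \<cdot> f = Ide C (Dom C f)" "f \<cdot> g = Ide C (Cod C f)"
  shows "is_iso C f"
  using assms by (auto simp: is_iso_def hom_iff)

lemma isoE:
  assumes "is_iso C f"
  obtains g where "f \<in> Arr C" "g \<in> Arr C" "Dom C g = Cod C f" "Cod C g = Dom C f"
    "g \<cdot> f = Ide C (Dom C f)" "f \<cdot> g = Ide C (Cod C f)" "is_iso C g"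
proof -
  obtain g where g: "f \<in> Arr C" "g \<in> Arr C" "Dom C g = Cod C f" "Cod C g = Dom C f"
    "g \<cdot> f = Ide C (Dom C f)" "f \<cdot> g = Ide C (Cod C f)"
    using assms by (auto simp: is_iso_def hom_iff)
  moreover have "is_iso C g" by (rule isoI[of _ f]) (use g in auto)
  ultimately show ?thesis by (rule that)
qed

lemma iso_ide [simp]: "A \<in> Obj C \<Longrightarrow> is_iso C (Ide C A)"
  by (rule isoI[of _ "Ide C A"]) auto

lemma iso_comp:
  assumes "is_iso C f" "is_iso C g" "Cod C f = Dom C g" shows "is_iso C (g \<cdot> f)"
proof -
  obtain f' where f: "f \<in> Arr C" "f' \<in> Arr C" "Dom C f' = Cod C f" "Cod C f' = Dom C f"
    "f' \<cdot> f = Ide C (Dom C f)" "f \<cdot> f' = Ide C (Cod C f)" using isoE[OF assms(1)] .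
  obtain g' where g: "g \<in> Arr C" "g' \<in> Arr C" "Dom C g' = Cod C g" "Cod C g' = Dom C g"
    "g' \<cdot> g = Ide C (Dom C g)" "g \<cdot> g' = Ide C (Cod C g)" using isoE[OF assms(2)] .
  show ?thesis
    using f g assms(3) by (intro isoI[of _ "f' \<cdot> g'"])
      (auto simp: comp_eq_extend1[OF g(5)] comp_eq_extend1[OF f(6)])
qed

lemma monic_split_iso:
  assumes "monic m" "w \<in> Arr C" "Dom C w = Cod C m" "Cod C w = Dom C m" "m \<cdot> w = Ide C (Cod C m)"
  shows "is_iso C m"
proof -
  have m: "m \<in> Arr C" using assms by (simp add: monic_def)
  have "w \<cdot> m = Ide C (Dom C m)"
    using assms m by - (rule monicD[OF assms(1)]; (auto simp: comp_eq_extend1[OF assms(5)]))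
  thus ?thesis using assms m by (intro isoI[of _ w]) auto
qed

text \<open>Regular epimorphisms are strong: elements identified by \<open>q\<close> have the same
  image under \<open>m \<cdot> u\<close>, hence under \<open>u\<close>, so \<open>u\<close> descends
  along \<open>q\<close> to the diagonal.\<close>

lemma regular_epi_lift:
  assumes q: "regular_epi C q" and m: "monic m" and uv: "u \<in> Arr C" "v \<in> Arr C" "Dom C u = Dom C q"
    "Cod C u = Dom C m" "Dom C v = Cod C q" "m \<cdot> u = v \<cdot> q"
  obtains w where "w \<in> Arr C" "Dom C w = Cod C q" "Cod C w = Dom C m" "w \<cdot> q = u" "m \<cdot> w = v"
proof -
  have [simp]: "q \<in> Arr C" "m \<in> Arr C" using q m by (auto simp: regular_epi_arr monic_def)
  obtain w where w: "w \<in> Arr C" "Dom C w = Cod C q" "Cod C w = Cod C u" "w \<cdot> q = u"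
  proof (rule regular_epi_descend[OF q uv(1,3)])
    fix x y assume x: "x \<in> Arr C" "y \<in> Arr C" "Dom C x = Dom C y" "Cod C x = Dom C q" "Cod C y = Dom C q"
      "q \<cdot> x = q \<cdot> y"
    show "u \<cdot> x = u \<cdot> y" using x uv by - (rule monicD[OF m]; (auto simp: comp_eq_extend[OF uv(6)]))
  qed
  moreover have "m \<cdot> w = v"
    using w uv by - (rule epicD[OF regular_epi_epic[OF q]]; auto)
  ultimately show ?thesis using that uv by auto
qed

end

section \<open>Regular categories\<close>

locale regcat = category C for C :: "('o, 'm) cat" (structure) +
  assumes regular: "regular_cat C"
begin

lemma pb_exists:
  assumes "f \<in> Arr C" "g \<in> Arr C" "Cod C f = Cod C g"
  obtains p q where "is_pullback C p q f g"
  using regular assms unfolding regular_cat_def has_pullbacks_def by blast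

lemma regular_epi_pb: "is_pullback C p q f g \<Longrightarrow> regular_epi C f \<Longrightarrow> regular_epi C q"
  using regular unfolding regular_cat_def by blast

text \<open>Stability of regular epimorphisms in the form of an existence principle: an element
  \<open>y\<close> of the codomain of \<open>q\<close> acquires a preimage \<open>x\<close> after
  passing to a cover \<open>c\<close>. Since \<open>c\<close> is epic, equations proved over it hold
  before.\<close>

lemma cover:
  assumes "regular_epi C q" "y \<in> Arr C" "Cod C y = Cod C q"
  obtains c x where "regular_epi C c" "epic c" "c \<in> Arr C" "x \<in> Arr C" "Dom C x = Dom C c"
    "Cod C c = Dom C y" "Cod C x = Dom C q" "q \<cdot> x = y \<cdot> c"
proof -
  obtain x c where pb: "is_pullback C x c q y"
    using assms regular_epi_arr pb_exists[of q y] by metis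
  show ?thesis
    using regular_epi_pb[OF pb assms(1)] pbD[OF pb] by (intro that[of c x]) (auto simp: regular_epi_epic)
qed

text \<open>Converse to \<open>regular_epi_descend\<close>. The coequalised pair is the kernel pair
  of \<open>q\<close>, through which every pair of elements identified by \<open>q\<close>
  factors.\<close>

lemma regular_epiI:
  assumes q: "epic q"
    and desc: "\<And>h. \<lbrakk>h \<in> Arr C; Dom C h = Dom C q; \<And>x y. \<lbrakk>x \<in> Arr C; y \<in> Arr C; Dom C x = Dom C y;
        Cod C x = Dom C q; Cod C y = Dom C q; q \<cdot> x = q \<cdot> y\<rbrakk> \<Longrightarrow> h \<cdot> x = h \<cdot> y\<rbrakk> \<Longrightarrow>
      \<exists>l. l \<in> Arr C \<and> Dom C l = Cod C q \<and> Cod C l = Cod C h \<and> l \<cdot> q = h"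
  shows "regular_epi C q"
proof -
  have [simp]: "q \<in> Arr C" using q by (simp add: epic_def)
  obtain u v where pb: "is_pullback C u v q q" using pb_exists[of q q] by auto
  note [simp] = pbD(3,4,6-8)[OF pb]
  have "is_coequalizer C q u v"
  proof (rule coequalizerI)
    fix h assume h: "h \<in> Arr C" "Dom C h = Cod C u" "h \<cdot> u = h \<cdot> v"
    show "\<exists>w. w \<in> Arr C \<and> Dom C w = Cod C q \<and> Cod C w = Cod C h \<and> w \<cdot> q = h"
    proof (rule desc)
      fix x y assume x: "x \<in> Arr C" "y \<in> Arr C" "Dom C x = Dom C y" "Cod C x = Dom C q"
        "Cod C y = Dom C q" "q \<cdot> x = q \<cdot> y"
      note t = pair[OF pb x(1,2,3,4,5,6)]
      have "h \<cdot> (u \<cdot> pair u v x y) = h \<cdot> (v \<cdot> pair u v x y)"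
        by (rule comp_eq_extend[OF h(3)]) (use t(1-3) h in auto)
      thus "h \<cdot> x = h \<cdot> y" by (simp only: t)
    qed (use h in auto)
  qed (use q pbD(9)[OF pb] in auto)
  thus ?thesis by (auto simp: regular_epi_def)
qed

lemma epic_comp:
  assumes "epic f" "epic g" "Cod C f = Dom C g" shows "epic (g \<cdot> f)"
proof -
  have [simp]: "f \<in> Arr C" "g \<in> Arr C" using assms by (auto simp: epic_def)
  show ?thesis unfolding epic_def
  proof (intro conjI ballI impI)
    fix u v assume u: "u \<in> Arr C" "v \<in> Arr C" "Dom C u = Cod C (g \<cdot> f)" "Dom C v = Cod C (g \<cdot> f)"
      "u \<cdot> (g \<cdot> f) = v \<cdot> (g \<cdot> f)"
    have "u \<cdot> g = v \<cdot> g" using u assms(3) by - (rule epicD[OF assms(1)]; simp)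
    thus "u = v" using u assms(3) by - (rule epicD[OF assms(2)]; simp)
  qed (use assms in auto)
qed

lemma iso_regular_epi:
  assumes i: "is_iso C i" and q: "regular_epi C q" and "Cod C q = Dom C i"
  shows "regular_epi C (i \<cdot> q)"
proof -
  obtain j where j [simp]: "i \<in> Arr C" "j \<in> Arr C" "Dom C j = Cod C i" "Cod C j = Dom C i"
    "j \<cdot> i = Ide C (Dom C i)" "i \<cdot> j = Ide C (Cod C i)" using isoE[OF i] .
  have [simp]: "q \<in> Arr C" "Cod C q = Dom C i" using q assms by (auto simp: regular_epi_arr)
  have ji: "j \<cdot> (i \<cdot> x) = x" if "x \<in> Arr C" "Cod C x = Dom C i" for x
    using that by (simp add: comp_eq_extend1[OF j(5)])
  show ?thesis
  proof (rule regular_epiI)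
    show "epic (i \<cdot> q)"
    proof (rule epic_comp)
      show "epic i" unfolding epic_def
      proof (intro conjI ballI impI)
        fix u v assume u: "u \<in> Arr C" "v \<in> Arr C" "Dom C u = Cod C i" "Dom C v = Cod C i" "u \<cdot> i = v \<cdot> i"
        have "u \<cdot> (i \<cdot> j) = v \<cdot> (i \<cdot> j)"
          by (rule comp_eq_extend[OF u(5)]) (use u in auto)
        thus "u = v" using u by simp
      qed auto
    qed (auto simp: regular_epi_epic q)
  next
    fix h assume h: "h \<in> Arr C" "Dom C h = Dom C (i \<cdot> q)" "\<And>x y. \<lbrakk>x \<in> Arr C; y \<in> Arr C; Dom C x = Dom C y;
        Cod C x = Dom C (i \<cdot> q); Cod C y = Dom C (i \<cdot> q); (i \<cdot> q) \<cdot> x = (i \<cdot> q) \<cdot> y\<rbrakk> \<Longrightarrow> h \<cdot> x = h \<cdot> y"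
    obtain l where l: "l \<in> Arr C" "Dom C l = Cod C q" "Cod C l = Cod C h" "l \<cdot> q = h"
    proof (rule regular_epi_descend[OF q, of h])
      fix x y assume "x \<in> Arr C" "y \<in> Arr C" "Dom C x = Dom C y"
        "Cod C x = Dom C q" "Cod C y = Dom C q" "q \<cdot> x = q \<cdot> y"
      thus "h \<cdot> x = h \<cdot> y" by - (rule h(3); simp)
    qed (use h in auto)
    show "\<exists>l. l \<in> Arr C \<and> Dom C l = Cod C (i \<cdot> q) \<and> Cod C l = Cod C h \<and> l \<cdot> (i \<cdot> q) = h"
      using l by (intro exI[of _ "l \<cdot> j"]) (simp add: ji)
  qed
qed

text \<open>The regular part is the coequaliser of the kernel pair of \<open>f\<close>; the content
  is that the induced \<open>m\<close> is monic.\<close>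

lemma image_factorisation:
  assumes f: "f \<in> Arr C"
  obtains e m where "regular_epi C e" "monic m" "e \<in> Arr C" "m \<in> Arr C" "Dom C m = Cod C e" "m \<cdot> e = f"
proof -
  obtain p q where pb: "is_pullback C p q f f" using pb_exists[of f f] f by auto
  obtain e where e: "is_coequalizer C e p q" using regular pb unfolding regular_cat_def by blast
  note [simp] = f pbD(3,4,6,7,8)[OF pb]
  have e' [simp]: "e \<in> Arr C" "Dom C e = Dom C f" and epq: "e \<cdot> p = e \<cdot> q" using e by (auto simp: is_coequalizer_def)
  have re: "regular_epi C e" using e by (auto simp: regular_epi_def)
  have "\<exists>!w. w \<in> hom C (Cod C e) (Cod C f) \<and> w \<cdot> e = f"
    using e pbD(9)[OF pb] unfolding is_coequalizer_def by simp
  then obtain m where m [simp]: "m \<in> Arr C" "Dom C m = Cod C e" and "Cod C m = Cod C f" and me: "m \<cdot> e = f"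
    by (auto simp: hom_iff)
  have "monic m" unfolding monic_def
  proof (intro conjI ballI impI)
    fix u v assume u: "u \<in> Arr C" "v \<in> Arr C" "Dom C u = Dom C v" "Cod C u = Dom C m" "Cod C v = Dom C m"
      "m \<cdot> u = m \<cdot> v"
    \<comment> \<open>Over successive covers \<open>c\<close> and \<open>d\<close>, both
      \<open>u\<close> and \<open>v\<close> lift along \<open>e\<close> to elements of the domain of
      \<open>f\<close>. The lifts have the same image under \<open>f\<close>, so they form an
      element of the kernel pair, and \<open>e\<close> identifies them.\<close>
    obtain c x where c: "epic c" "c \<in> Arr C" "x \<in> Arr C" "Dom C x = Dom C c"
      "Cod C c = Dom C u" "Cod C x = Dom C e" "e \<cdot> x = u \<cdot> c"
      by (rule cover[OF re, of u]) (use u in auto)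
    obtain d y where d: "epic d" "d \<in> Arr C" "y \<in> Arr C" "Dom C y = Dom C d"
      "Cod C d = Dom C c" "Cod C y = Dom C e" "e \<cdot> y = (v \<cdot> c) \<cdot> d"
      by (rule cover[OF re, of "v \<cdot> c"]) (use u c in auto)
    have ex: "e \<cdot> (x \<cdot> d) = u \<cdot> (c \<cdot> d)" by (rule comp_eq_extend[OF c(7)]) (use c d u in auto)
    have "m \<cdot> (e \<cdot> (x \<cdot> d)) = m \<cdot> (v \<cdot> (c \<cdot> d))"
      unfolding ex by (rule comp_eq_extend[OF u(6)]) (use c d u in auto)
    also have "\<dots> = m \<cdot> (e \<cdot> y)" unfolding d(7) using c d u by simp
    finally have *: "m \<cdot> (e \<cdot> (x \<cdot> d)) = m \<cdot> (e \<cdot> y)" .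
    have me_comp: "m \<cdot> (e \<cdot> s) = f \<cdot> s" if "s \<in> Arr C" "Cod C s = Dom C e" for s
      by (rule comp_eq_extend1[OF me]) (use that in auto)
    have fx: "f \<cdot> (x \<cdot> d) = f \<cdot> y"
      using c(1-6) d(1-6) me_comp[of "x \<cdot> d"] me_comp[of y] * by simp
    note t = pair[OF pb _ _ _ _ _ fx]
    have t': "pair p q (x \<cdot> d) y \<in> Arr C" "Cod C (pair p q (x \<cdot> d) y) = Dom C q"
      "p \<cdot> pair p q (x \<cdot> d) y = x \<cdot> d" "q \<cdot> pair p q (x \<cdot> d) y = y"
      using c d by (simp_all add: t)
    have "e \<cdot> (p \<cdot> pair p q (x \<cdot> d) y) = e \<cdot> (q \<cdot> pair p q (x \<cdot> d) y)"
      by (rule comp_eq_extend[OF epq]) (use t' in auto)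
    hence "e \<cdot> (x \<cdot> d) = e \<cdot> y" by (simp only: t')
    hence "(u \<cdot> c) \<cdot> d = (v \<cdot> c) \<cdot> d" unfolding ex using d c u by simp
    hence "u \<cdot> c = v \<cdot> c" using c d u by - (rule epicD[OF d(1)]; simp)
    thus "u = v" using c u by - (rule epicD[OF c(1)]; simp)
  qed simp
  thus ?thesis using that re me by simp
qed

text \<open>Lifting the identity of the codomain through \<open>m\<close>, along the regular
  epimorphism \<open>m \<cdot> u\<close>, gives a section of the monomorphism
  \<open>m\<close>.\<close>

lemma monic_regular_epi_iso:
  assumes m: "monic m" and u: "u \<in> Arr C" "Cod C u = Dom C m" and mu: "regular_epi C (m \<cdot> u)"
  shows "is_iso C m"
proof -
  have [simp]: "m \<in> Arr C" using m by (simp add: monic_def)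
  obtain w where "w \<in> Arr C" "Dom C w = Cod C (m \<cdot> u)" "Cod C w = Dom C m" "w \<cdot> (m \<cdot> u) = u" "m \<cdot> w = Ide C (Cod C m)"
    by (rule regular_epi_lift[OF mu m, of u "Ide C (Cod C m)"]) (use u in auto)
  thus ?thesis using u by (intro monic_split_iso[OF m, of w]) auto
qed

text \<open>The monic part of the image factorisation of \<open>g\<close> is a last factor of the
  regular epimorphism \<open>g \<cdot> f\<close>, hence invertible.\<close>

lemma regular_epi_cancel:
  assumes gf: "regular_epi C (g \<cdot> f)" and [simp]: "f \<in> Arr C" "g \<in> Arr C" "Cod C f = Dom C g"
  shows "regular_epi C g"
proof -
  obtain e m where e: "regular_epi C e" "monic m" "e \<in> Arr C" "m \<in> Arr C" "Dom C m = Cod C e" "m \<cdot> e = g"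
    using image_factorisation[of g] by auto
  have "Dom C e = Dom C g" using e by auto
  moreover have "m \<cdot> (e \<cdot> f) = g \<cdot> f"
    by (rule comp_eq_extend1[OF e(6)]) (use e calculation in auto)
  ultimately have "is_iso C m" using gf e by (intro monic_regular_epi_iso[of m "e \<cdot> f"]) auto
  thus ?thesis using iso_regular_epi[of m e] e by auto
qed

text \<open>With \<open>m\<close> the image of the composite, lifting along \<open>f\<close> shows
  that \<open>g\<close> itself factors through \<open>m\<close>. As \<open>g\<close> is a regular
  epimorphism, \<open>m\<close> is invertible.\<close>

lemma regular_epi_comp:
  assumes f: "regular_epi C f" and g: "regular_epi C g" and [simp]: "Cod C f = Dom C g"
  shows "regular_epi C (g \<cdot> f)"
proof -
  have [simp]: "f \<in> Arr C" "g \<in> Arr C" using f g by (auto simp: regular_epi_arr)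
  obtain e m where e: "regular_epi C e" "monic m" "e \<in> Arr C" "m \<in> Arr C" "Dom C m = Cod C e" "m \<cdot> e = g \<cdot> f"
    using image_factorisation[of "g \<cdot> f"] by auto
  have "Dom C e = Dom C f" using e arr_comp(2)[of m e] by auto
  then obtain w where "w \<in> Arr C" "Dom C w = Cod C f" "Cod C w = Dom C m" "w \<cdot> f = e" "m \<cdot> w = g"
    using e by (elim regular_epi_lift[OF f e(2), of e g, rotated -1]) auto
  hence "is_iso C m" using g e by (intro monic_regular_epi_iso[of m w]) auto
  thus ?thesis using iso_regular_epi[of m e] e by auto
qed

end

section \<open>Descent data\<close>

context category
begin

text \<open>By the Yoneda lemma, an algebra for the monad of \<open>p\<^sup>*\<close> on \<open>\<xi>\<close> amounts to an operation on
  generalised elements: \<open>act x e\<close> transports \<open>x\<close> to the fibre over \<open>e\<close>.\<close>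

definition compat :: "'m \<Rightarrow> 'm \<Rightarrow> 'm \<Rightarrow> 'm \<Rightarrow> bool" where
  "compat p \<xi> x e \<longleftrightarrow> x \<in> Arr C \<and> e \<in> Arr C \<and> Dom C x = Dom C e \<and> Cod C x = Dom C \<xi> \<and>
     Cod C e = Dom C p \<and> p \<cdot> (\<xi> \<cdot> x) = p \<cdot> e"

text \<open>After the typing come naturality in the stage of definition, which is what the Yoneda
  lemma requires, and then the unit and associativity laws of an algebra.\<close>

definition descent_datum :: "'m \<Rightarrow> 'm \<Rightarrow> ('m \<Rightarrow> 'm \<Rightarrow> 'm) \<Rightarrow> bool" where
  "descent_datum p \<xi> act \<longleftrightarrow> p \<in> Arr C \<and> \<xi> \<in> Arr C \<and> Cod C \<xi> = Dom C p \<and>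
     (\<forall>x e. compat p \<xi> x e \<longrightarrow> act x e \<in> Arr C \<and> Dom C (act x e) = Dom C e \<and>
        Cod C (act x e) = Dom C \<xi> \<and> \<xi> \<cdot> act x e = e) \<and>
     (\<forall>x e t. compat p \<xi> x e \<longrightarrow> t \<in> Arr C \<longrightarrow> Cod C t = Dom C e \<longrightarrow> act (x \<cdot> t) (e \<cdot> t) = act x e \<cdot> t) \<and>
     (\<forall>x\<in>Arr C. Cod C x = Dom C \<xi> \<longrightarrow> act x (\<xi> \<cdot> x) = x) \<and>
     (\<forall>x e e'. compat p \<xi> x e \<longrightarrow> compat p \<xi> x e' \<longrightarrow> act (act x e) e' = act x e')"

text \<open>When \<xi> is the pullback of \<open>z\<close> along \<open>p\<close>, the canonical
  transport keeps the \<open>q\<close>-coordinate and replaces the other one by \<open>e\<close>. As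
  \<xi> sends \<open>act x e\<close> to \<open>e\<close> anyway, only the first coordinate has to be
  prescribed.\<close>

definition effective_datum :: "'m \<Rightarrow> 'm \<Rightarrow> ('m \<Rightarrow> 'm \<Rightarrow> 'm) \<Rightarrow> bool" where
  "effective_datum p \<xi> act \<longleftrightarrow>
     (\<exists>q z. is_pullback C q \<xi> z p \<and> (\<forall>x e. compat p \<xi> x e \<longrightarrow> q \<cdot> act x e = q \<cdot> x))"

definition effdesc :: "'m \<Rightarrow> bool" where
  "effdesc p \<longleftrightarrow> regular_epi C p \<and> (\<forall>\<xi> act. descent_datum p \<xi> act \<longrightarrow> effective_datum p \<xi> act)"

lemma descent_datumD:
  assumes "descent_datum p \<xi> act"
  shows "p \<in> Arr C" "\<xi> \<in> Arr C" "Cod C \<xi> = Dom C p"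
    and "compat p \<xi> x e \<Longrightarrow> act x e \<in> Arr C" "compat p \<xi> x e \<Longrightarrow> Dom C (act x e) = Dom C e"
      "compat p \<xi> x e \<Longrightarrow> Cod C (act x e) = Dom C \<xi>" "compat p \<xi> x e \<Longrightarrow> \<xi> \<cdot> act x e = e"
    and "compat p \<xi> x e \<Longrightarrow> t \<in> Arr C \<Longrightarrow> Cod C t = Dom C e \<Longrightarrow> act (x \<cdot> t) (e \<cdot> t) = act x e \<cdot> t"
    and "x \<in> Arr C \<Longrightarrow> Cod C x = Dom C \<xi> \<Longrightarrow> act x (\<xi> \<cdot> x) = x"
    and "compat p \<xi> x e \<Longrightarrow> compat p \<xi> x e' \<Longrightarrow> act (act x e) e' = act x e'"
  using assms unfolding descent_datum_def by blast+

lemma descent_datumI: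
  assumes "p \<in> Arr C" "\<xi> \<in> Arr C" "Cod C \<xi> = Dom C p"
    and "\<And>x e. compat p \<xi> x e \<Longrightarrow> act x e \<in> Arr C \<and> Dom C (act x e) = Dom C e \<and>
        Cod C (act x e) = Dom C \<xi> \<and> \<xi> \<cdot> act x e = e"
    and "\<And>x e t. compat p \<xi> x e \<Longrightarrow> t \<in> Arr C \<Longrightarrow> Cod C t = Dom C e \<Longrightarrow> act (x \<cdot> t) (e \<cdot> t) = act x e \<cdot> t"
    and "\<And>x. x \<in> Arr C \<Longrightarrow> Cod C x = Dom C \<xi> \<Longrightarrow> act x (\<xi> \<cdot> x) = x"
    and "\<And>x e e'. compat p \<xi> x e \<Longrightarrow> compat p \<xi> x e' \<Longrightarrow> act (act x e) e' = act x e'"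
  shows "descent_datum p \<xi> act"
  using assms unfolding descent_datum_def by blast

end

context regcat
begin

text \<open>Descent happens in two stages. Restricted to the fibres of \<open>f\<close>, the datum
  descends \<xi> to some \<open>z\<close>; what is left of it should be a datum on \<open>z\<close>
  for \<open>g\<close>. That datum is forced to satisfy
  \<open>act' (q \<cdot> x) (f \<cdot> a) = q \<cdot> act x a\<close>, and the work is to show that
  this defines an operation on all compatible pairs.\<close>

lemma effdesc_comp:
  assumes f: "effdesc f" and g: "effdesc g" and fg [simp]: "Cod C f = Dom C g"
  shows "effdesc (g \<cdot> f)"
proof -
  have rf: "regular_epi C f" and rg: "regular_epi C g" using f g by (auto simp: effdesc_def)
  have [simp]: "f \<in> Arr C" "g \<in> Arr C" using rf rg by (auto simp: regular_epi_arr)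
  show ?thesis unfolding effdesc_def
  proof (intro conjI allI impI)
    show "regular_epi C (g \<cdot> f)" by (rule regular_epi_comp[OF rf rg fg])
    fix \<xi> act assume dd: "descent_datum (g \<cdot> f) \<xi> act"
    note act = descent_datumD[OF dd]
    have [simp]: "\<xi> \<in> Arr C" "Cod C \<xi> = Dom C f" using act(2,3) by auto
    have compat_gf: "compat (g \<cdot> f) \<xi> x e" if "x \<in> Arr C" "e \<in> Arr C" "Dom C x = Dom C e" "Cod C x = Dom C \<xi>"
      "Cod C e = Dom C f" "g \<cdot> (f \<cdot> (\<xi> \<cdot> x)) = g \<cdot> (f \<cdot> e)" for x e
      using that by (simp add: compat_def)
    have compat_f: "compat f \<xi> x e" if "x \<in> Arr C" "e \<in> Arr C" "Dom C x = Dom C e" "Cod C x = Dom C \<xi>"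
      "Cod C e = Dom C f" "f \<cdot> (\<xi> \<cdot> x) = f \<cdot> e" for x e
      using that by (simp add: compat_def)
    have gf: "compat (g \<cdot> f) \<xi> x e" if "compat f \<xi> x e" for x e
      using that by (simp add: compat_def)
    \<comment> \<open>Elements in one fibre of \<open>f\<close> lie in one fibre of
      \<open>g \<cdot> f\<close>, so the datum restricts.\<close>
    have "descent_datum f \<xi> act"
      by (rule descent_datumI) (auto intro!: act gf)
    then obtain q z where pb: "is_pullback C q \<xi> z f"
      and inv: "\<And>x e. compat f \<xi> x e \<Longrightarrow> q \<cdot> act x e = q \<cdot> x"
      using f unfolding effdesc_def effective_datum_def by blast
    have [simp]: "q \<in> Arr C" "z \<in> Arr C" "Dom C q = Dom C \<xi>" "Cod C q = Dom C z" "Cod C z = Dom C g"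
      using pbD[OF pb] by auto
    have zq: "z \<cdot> (q \<cdot> x) = f \<cdot> (\<xi> \<cdot> x)" if "x \<in> Arr C" "Cod C x = Dom C \<xi>" for x
      using pb_comm[OF pb, of x] that by simp
    have rq: "regular_epi C q" using regular_epi_pb[OF pb_swap[OF pb] rf] .
    \<comment> \<open>Independence of the lifts: the value intended for the action of
      \<open>g\<close> depends only on \<open>q \<cdot> x\<close> and
      \<open>f \<cdot> a\<close>.\<close>
    have indep: "q \<cdot> act x1 a1 = q \<cdot> act x2 a2"
      if [simp]: "x1 \<in> Arr C" "x2 \<in> Arr C" "a1 \<in> Arr C" "a2 \<in> Arr C"
        "Dom C x1 = Dom C a2" "Dom C x2 = Dom C a2" "Dom C a1 = Dom C a2"
        "Cod C x1 = Dom C \<xi>" "Cod C x2 = Dom C \<xi>" "Cod C a1 = Dom C f" "Cod C a2 = Dom C f"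
        and c: "g \<cdot> (f \<cdot> (\<xi> \<cdot> x1)) = g \<cdot> (f \<cdot> a1)" "q \<cdot> x1 = q \<cdot> x2" "f \<cdot> a1 = f \<cdot> a2" for x1 x2 a1 a2
    proof -
      have fx: "f \<cdot> (\<xi> \<cdot> x1) = f \<cdot> (\<xi> \<cdot> x2)" using c(2) zq[of x1] zq[of x2] by simp
      have c1: "compat f \<xi> x1 (\<xi> \<cdot> x2)" by (rule compat_f) (auto simp: fx)
      \<comment> \<open>Two elements with the same image under \<open>q\<close> are transports of
        each other; the associativity law then compares their transports to further fibres.\<close>
      have x2: "act x1 (\<xi> \<cdot> x2) = x2"
        by (rule pb_ext[OF pb]) (use inv[OF c1] c(2) in \<open>auto simp: act gf[OF c1]\<close>)
      have c2: "compat (g \<cdot> f) \<xi> x1 a2" "compat (g \<cdot> f) \<xi> x1 a1" by (auto intro!: compat_gf simp: c)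
      have c3: "compat f \<xi> (act x1 a1) a2" using c2 by (intro compat_f) (auto simp: act c)
      have "act x2 a2 = act x1 a2" using act(10)[OF gf[OF c1] c2(1)] x2 by simp
      also have "\<dots> = act (act x1 a1) a2" using act(10)[OF c2(2,1)] by simp
      finally show ?thesis using inv[OF c3] by simp
    qed
    \<comment> \<open>The universal compatible pair for \<open>g\<close> and \<open>z\<close>: by
      naturality an action is determined by its value here.\<close>
    obtain y0 b0 where P: "is_pullback C y0 b0 (g \<cdot> z) g" using pb_exists[of "g \<cdot> z" g] by auto
    have [simp]: "y0 \<in> Arr C" "b0 \<in> Arr C" "Dom C y0 = Dom C b0" "Cod C y0 = Dom C z" "Cod C b0 = Dom C g"
      using pbD[OF P] by auto
    have P_comm: "g \<cdot> (z \<cdot> (y0 \<cdot> t)) = g \<cdot> (b0 \<cdot> t)" if "t \<in> Arr C" "Cod C t = Dom C b0" for t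
      using pb_comm[OF P, of t] that by simp
    \<comment> \<open>\<open>W1\<close> lifts \<open>y0\<close> along \<open>q\<close>, and
      \<open>W2\<close> then lifts \<open>b0\<close> along \<open>f\<close>, both universally. Over
      the cover \<open>r1 \<cdot> r2\<close> of the universal pair the lifts are
      \<open>x1 \<cdot> r2\<close> and \<open>aw\<close>, where the old action can be
      applied.\<close>
    obtain x1 r1 where W1: "is_pullback C x1 r1 q y0" using pb_exists[of q y0] by auto
    have [simp]: "x1 \<in> Arr C" "r1 \<in> Arr C" "Dom C x1 = Dom C r1" "Cod C x1 = Dom C \<xi>" "Cod C r1 = Dom C b0"
      using pbD[OF W1] by auto
    obtain aw r2 where W2: "is_pullback C aw r2 f (b0 \<cdot> r1)" using pb_exists[of f "b0 \<cdot> r1"] by auto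
    have [simp]: "aw \<in> Arr C" "r2 \<in> Arr C" "Dom C aw = Dom C r2" "Cod C aw = Dom C f" "Cod C r2 = Dom C r1"
      using pbD[OF W2] by auto
    have rr: "regular_epi C (r1 \<cdot> r2)"
      using regular_epi_pb[OF W1 rq] regular_epi_pb[OF W2 rf] by (intro regular_epi_comp) auto
    have W1_comm: "q \<cdot> (x1 \<cdot> t) = y0 \<cdot> (r1 \<cdot> t)" if "t \<in> Arr C" "Cod C t = Dom C r1" for t
      using pb_comm[OF W1, of t] that by simp
    have W2_comm: "f \<cdot> (aw \<cdot> t) = b0 \<cdot> (r1 \<cdot> (r2 \<cdot> t))" if "t \<in> Arr C" "Cod C t = Dom C r2" for t
      using pb_comm[OF W2, of t] that by simp
    have W_compat: "g \<cdot> (f \<cdot> (\<xi> \<cdot> (x1 \<cdot> (r2 \<cdot> t)))) = g \<cdot> (f \<cdot> (aw \<cdot> t))" if "t \<in> Arr C" "Cod C t = Dom C r2" for t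
      using that zq[of "x1 \<cdot> (r2 \<cdot> t)", symmetric] W1_comm[of "r2 \<cdot> t"] W2_comm[of t] P_comm[of "r1 \<cdot> (r2 \<cdot> t)"] by simp
    have W_compat': "compat (g \<cdot> f) \<xi> (x1 \<cdot> r2) aw"
      using W_compat[of "Ide C (Dom C r2)"] by (intro compat_gf) auto
    \<comment> \<open>By \<open>indep\<close> the value computed over the cover is constant on its
      fibres, so it descends to the universal pair; \<open>h\<close> is the new action on that
      pair.\<close>
    obtain h where h [simp]: "h \<in> Arr C" "Dom C h = Dom C b0" "Cod C h = Dom C z"
      and hW: "h \<cdot> (r1 \<cdot> r2) = q \<cdot> act (x1 \<cdot> r2) aw"
    proof (rule regular_epi_descend[OF rr, of "q \<cdot> act (x1 \<cdot> r2) aw"])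
      fix u v assume u: "u \<in> Arr C" "v \<in> Arr C" "Dom C u = Dom C v" "Cod C u = Dom C (r1 \<cdot> r2)" "Cod C v = Dom C (r1 \<cdot> r2)"
        "(r1 \<cdot> r2) \<cdot> u = (r1 \<cdot> r2) \<cdot> v"
      have "q \<cdot> act ((x1 \<cdot> r2) \<cdot> u) (aw \<cdot> u) = q \<cdot> act ((x1 \<cdot> r2) \<cdot> v) (aw \<cdot> v)"
        using u by (intro indep) (auto simp: W_compat W1_comm W2_comm)
      thus "(q \<cdot> act (x1 \<cdot> r2) aw) \<cdot> u = (q \<cdot> act (x1 \<cdot> r2) aw) \<cdot> v"
        using u by (simp add: act W_compat' del: comp_assoc add: comp_assoc[of _ "act (x1 \<cdot> r2) aw" q])
    qed (auto simp: act W_compat')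
    define act' where "act' = (\<lambda>y b. h \<cdot> pair y0 b0 y b)"
    have act'_typ: "act' y b \<in> Arr C" "Dom C (act' y b) = Dom C b" "Cod C (act' y b) = Dom C z"
      if "compat g z y b" for y b
      using that unfolding compat_def act'_def by (simp_all add: pair[OF P])
    have nat: "act' (y \<cdot> t) (b \<cdot> t) = act' y b \<cdot> t"
      if y: "compat g z y b" and t: "t \<in> Arr C" "Cod C t = Dom C b" for y b t
    proof -
      have "pair y0 b0 (y \<cdot> t) (b \<cdot> t) = pair y0 b0 y b \<cdot> t"
      proof (rule pb_ext[OF P])
        have c: "y \<in> Arr C" "b \<in> Arr C" "Dom C y = Dom C b" "Cod C y = Dom C z" "Cod C b = Dom C g" "g \<cdot> (z \<cdot> y) = g \<cdot> b"
          using y by (auto simp: compat_def)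
        note [simp] = t c(1-5)
        have "g \<cdot> ((z \<cdot> y) \<cdot> t) = g \<cdot> (b \<cdot> t)" by (rule comp_eq_extend[OF c(6)]) auto
        hence eq: "g \<cdot> (z \<cdot> (y \<cdot> t)) = g \<cdot> (b \<cdot> t)" by simp
        have 1: "y0 \<cdot> pair y0 b0 y b = y" "b0 \<cdot> pair y0 b0 y b = b" "pair y0 b0 y b \<in> Arr C"
          "Dom C (pair y0 b0 y b) = Dom C b" "Cod C (pair y0 b0 y b) = Dom C b0"
          using c(6) by (simp_all add: pair[OF P])
        show "y0 \<cdot> pair y0 b0 (y \<cdot> t) (b \<cdot> t) = y0 \<cdot> (pair y0 b0 y b \<cdot> t)"
             "b0 \<cdot> pair y0 b0 (y \<cdot> t) (b \<cdot> t) = b0 \<cdot> (pair y0 b0 y b \<cdot> t)"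
             "pair y0 b0 (y \<cdot> t) (b \<cdot> t) \<in> Arr C" "pair y0 b0 y b \<cdot> t \<in> Arr C"
             "Dom C (pair y0 b0 (y \<cdot> t) (b \<cdot> t)) = Dom C (pair y0 b0 y b \<cdot> t)"
             "Cod C (pair y0 b0 (y \<cdot> t) (b \<cdot> t)) = Dom C b0" "Cod C (pair y0 b0 y b \<cdot> t) = Dom C b0"
          by (simp_all add: eq pair[OF P] 1 comp_eq_extend1[OF 1(1)] comp_eq_extend1[OF 1(2)])
      qed
      thus ?thesis using y t unfolding act'_def compat_def by (simp add: pair[OF P])
    qed
    \<comment> \<open>The defining relation of the new action for arbitrary lifts: \<open>v\<close>
      locates the pair of \<open>x\<close> and \<open>a\<close> inside the universal pair of lifts,
      where \<open>h\<close> is known by construction.\<close>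
    have star: "act' (q \<cdot> x) (f \<cdot> a) = q \<cdot> act x a"
      if [simp]: "x \<in> Arr C" "a \<in> Arr C" "Dom C x = Dom C a" "Cod C x = Dom C \<xi>" "Cod C a = Dom C f"
        and c: "g \<cdot> (f \<cdot> (\<xi> \<cdot> x)) = g \<cdot> (f \<cdot> a)" for x a
    proof -
      define p where "p = pair y0 b0 (q \<cdot> x) (f \<cdot> a)"
      have p [simp]: "p \<in> Arr C" "Dom C p = Dom C a" "Cod C p = Dom C b0" and p': "y0 \<cdot> p = q \<cdot> x" "b0 \<cdot> p = f \<cdot> a"
        unfolding p_def by (simp_all add: pair[OF P] zq c)
      define w where "w = pair x1 r1 x p"
      have w [simp]: "w \<in> Arr C" "Dom C w = Dom C a" "Cod C w = Dom C r1" and w': "x1 \<cdot> w = x" "r1 \<cdot> w = p"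
        unfolding w_def by (simp_all add: pair[OF W1] p')
      define v where "v = pair aw r2 a w"
      have v [simp]: "v \<in> Arr C" "Dom C v = Dom C a" "Cod C v = Dom C r2" and v': "aw \<cdot> v = a" "r2 \<cdot> v = w"
        unfolding v_def by (simp_all add: pair[OF W2] p' w')
      have "act' (q \<cdot> x) (f \<cdot> a) = h \<cdot> (r1 \<cdot> (r2 \<cdot> v))" by (simp add: act'_def p_def[symmetric] v' w')
      also have "\<dots> = (h \<cdot> (r1 \<cdot> r2)) \<cdot> v" by simp
      also have "\<dots> = q \<cdot> (act (x1 \<cdot> r2) aw \<cdot> v)" unfolding hW by (simp add: act W_compat')
      also have "act (x1 \<cdot> r2) aw \<cdot> v = act ((x1 \<cdot> r2) \<cdot> v) (aw \<cdot> v)"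
        by (rule act(8)[symmetric]) (auto simp: W_compat')
      finally show ?thesis by (simp add: v' w')
    qed
    \<comment> \<open>This law and the unit and associativity laws below follow one pattern: lift
      along \<open>q\<close> and \<open>f\<close> over covers, translate by \<open>nat\<close> and
      \<open>star\<close> into the corresponding law of \<open>act\<close>, and cancel the
      covers.\<close>
    have zact: "z \<cdot> act' y b = b" if y: "compat g z y b" for y b
    proof -
      note y' [simp] = y[unfolded compat_def, THEN conjunct1] 
      have [simp]: "b \<in> Arr C" "Dom C y = Dom C b" "Cod C y = Dom C z" "Cod C b = Dom C g" and gz: "g \<cdot> (z \<cdot> y) = g \<cdot> b"
        using y by (auto simp: compat_def)
      obtain c x where c [simp]: "epic c" "c \<in> Arr C" "x \<in> Arr C" "Dom C x = Dom C c"
        "Cod C c = Dom C y" "Cod C x = Dom C q" and cx: "q \<cdot> x = y \<cdot> c"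
        by (rule cover[OF rq, of y]) auto
      obtain d a where d [simp]: "epic d" "d \<in> Arr C" "a \<in> Arr C" "Dom C a = Dom C d"
        "Cod C d = Dom C c" "Cod C a = Dom C f" and da: "f \<cdot> a = (b \<cdot> c) \<cdot> d"
        by (rule cover[OF rf, of "b \<cdot> c"]) auto
      have qxd: "q \<cdot> (x \<cdot> d) = y \<cdot> (c \<cdot> d)" by (rule comp_eq_extend[OF cx]) auto
      have e: "g \<cdot> (f \<cdot> (\<xi> \<cdot> (x \<cdot> d))) = g \<cdot> (f \<cdot> a)"
      proof -
        have "f \<cdot> (\<xi> \<cdot> (x \<cdot> d)) = (z \<cdot> y) \<cdot> (c \<cdot> d)" by (simp add: zq[symmetric] qxd)
        moreover have "g \<cdot> ((z \<cdot> y) \<cdot> (c \<cdot> d)) = g \<cdot> (b \<cdot> (c \<cdot> d))" by (rule comp_eq_extend[OF gz]) auto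
        ultimately show ?thesis by (simp add: da)
      qed
      have "act' y b \<cdot> (c \<cdot> d) = act' (y \<cdot> (c \<cdot> d)) (b \<cdot> (c \<cdot> d))"
        by (rule nat[OF y, symmetric]) auto
      also have "\<dots> = q \<cdot> act (x \<cdot> d) a"
        using star[of "x \<cdot> d" a] e qxd da by simp
      finally have "z \<cdot> (act' y b \<cdot> (c \<cdot> d)) = b \<cdot> (c \<cdot> d)"
        using compat_gf[of "x \<cdot> d" a] e da by (simp add: zq act)
      thus "z \<cdot> act' y b = b"
        by - (rule epicD[OF epic_comp[OF d(1) c(1)]]; simp add: act'_typ[OF y])
    qed
    have dd': "descent_datum g z act'"
    proof (rule descent_datumI)
      fix y assume y [simp]: "y \<in> Arr C" "Cod C y = Dom C z"
      have cy: "compat g z y (z \<cdot> y)" by (simp add: compat_def)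
      obtain c x where c [simp]: "epic c" "c \<in> Arr C" "x \<in> Arr C" "Dom C x = Dom C c"
        "Cod C c = Dom C y" "Cod C x = Dom C q" and cx: "q \<cdot> x = y \<cdot> c"
        by (rule cover[OF rq, of y]) auto
      have "act' y (z \<cdot> y) \<cdot> c = act' (q \<cdot> x) (f \<cdot> (\<xi> \<cdot> x))"
        using cx zq[of x] by (simp add: nat[OF cy, symmetric])
      also have "\<dots> = y \<cdot> c" using star[of x "\<xi> \<cdot> x"] cx by (simp add: act)
      finally show "act' y (z \<cdot> y) = y"
        by - (rule epicD[OF c(1)]; simp add: act'_typ[OF cy])
    next
      fix y b b' assume y: "compat g z y b" and y2: "compat g z y b'"
      have [simp]: "y \<in> Arr C" "b \<in> Arr C" "Dom C y = Dom C b" "Cod C y = Dom C z" "Cod C b = Dom C g" and gz: "g \<cdot> (z \<cdot> y) = g \<cdot> b"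
        using y by (auto simp: compat_def)
      have [simp]: "b' \<in> Arr C" "Dom C b' = Dom C b" "Cod C b' = Dom C g" and gz': "g \<cdot> b = g \<cdot> b'"
        using y2 gz by (auto simp: compat_def)
      obtain c x where c [simp]: "epic c" "c \<in> Arr C" "x \<in> Arr C" "Dom C x = Dom C c"
        "Cod C c = Dom C y" "Cod C x = Dom C q" and cx: "q \<cdot> x = y \<cdot> c"
        by (rule cover[OF rq, of y]) auto
      obtain d a where d [simp]: "epic d" "d \<in> Arr C" "a \<in> Arr C" "Dom C a = Dom C d"
        "Cod C d = Dom C c" "Cod C a = Dom C f" and da: "f \<cdot> a = (b \<cdot> c) \<cdot> d"
        by (rule cover[OF rf, of "b \<cdot> c"]) auto
      obtain k a' where k [simp]: "epic k" "k \<in> Arr C" "a' \<in> Arr C" "Dom C a' = Dom C k"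
        "Cod C k = Dom C d" "Cod C a' = Dom C f" and ka: "f \<cdot> a' = (b' \<cdot> (c \<cdot> d)) \<cdot> k"
        by (rule cover[OF rf, of "b' \<cdot> (c \<cdot> d)"]) auto
      let ?x = "x \<cdot> (d \<cdot> k)" and ?a = "a \<cdot> k" and ?c = "c \<cdot> (d \<cdot> k)"
      have qx: "q \<cdot> ?x = y \<cdot> ?c" by (rule comp_eq_extend[OF cx]) auto
      have fa: "f \<cdot> ?a = b \<cdot> ?c" by (subst comp_eq_extend1[OF da]) auto
      have fa': "f \<cdot> a' = b' \<cdot> ?c" using ka by simp
      have e: "g \<cdot> (f \<cdot> (\<xi> \<cdot> ?x)) = g \<cdot> (f \<cdot> ?a)"
      proof -
        have "f \<cdot> (\<xi> \<cdot> ?x) = (z \<cdot> y) \<cdot> ?c" by (simp add: zq[symmetric] qx)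
        moreover have "g \<cdot> ((z \<cdot> y) \<cdot> ?c) = g \<cdot> (b \<cdot> ?c)" by (rule comp_eq_extend[OF gz]) auto
        ultimately show ?thesis by (simp add: fa)
      qed
      have e': "g \<cdot> (f \<cdot> ?a) = g \<cdot> (f \<cdot> a')"
        unfolding fa fa' by (rule comp_eq_extend[OF gz']) auto
      have cc: "compat (g \<cdot> f) \<xi> ?x ?a" "compat (g \<cdot> f) \<xi> ?x a'" using e e' by (auto intro!: compat_gf)
      have c2: "compat g z (act' y b) b'"
        using gz' by (simp add: compat_def act'_typ[OF y] zact[OF y])
      have "act' (act' y b) b' \<cdot> ?c = act' (act' y b \<cdot> ?c) (b' \<cdot> ?c)"
        by (rule nat[OF c2, symmetric]) auto
      also have "act' y b \<cdot> ?c = act' (y \<cdot> ?c) (b \<cdot> ?c)"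
        by (rule nat[OF y, symmetric]) auto
      also have "\<dots> = q \<cdot> act ?x ?a" using star[of ?x ?a] e qx fa by simp
      also have "act' (q \<cdot> act ?x ?a) (b' \<cdot> ?c) = q \<cdot> act (act ?x ?a) a'"
        using star[of "act ?x ?a" a'] e' fa' by (simp add: act cc)
      also have "\<dots> = q \<cdot> act ?x a'" by (simp add: act(10)[OF cc])
      also have "\<dots> = act' (y \<cdot> ?c) (b' \<cdot> ?c)" using star[of ?x a'] e e' qx fa' by simp
      also have "\<dots> = act' y b' \<cdot> ?c" by (rule nat[OF y2]) auto
      finally show "act' (act' y b) b' = act' y b'"
        by - (rule epicD[OF epic_comp[OF epic_comp[OF k(1) d(1)] c(1)]]; simp add: act'_typ c2 y y2)
    qed (auto simp: nat act'_typ zact)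
    obtain q' z' where pb': "is_pullback C q' z z' g"
      and inv': "\<And>x e. compat g z x e \<Longrightarrow> q' \<cdot> act' x e = q' \<cdot> x"
      using g dd' unfolding effdesc_def effective_datum_def by blast
    have [simp]: "q' \<in> Arr C" "Dom C q' = Dom C z" using pbD[OF pb'] by auto
    \<comment> \<open>The two stages paste to a single pullback, and invariance under the given
      action follows from that of \<open>q'\<close> through \<open>star\<close>.\<close>
    have "is_pullback C (q' \<cdot> q) \<xi> z' (g \<cdot> f)" by (rule pb_paste[OF pb' pb])
    moreover have "(q' \<cdot> q) \<cdot> act x e = (q' \<cdot> q) \<cdot> x" if x: "compat (g \<cdot> f) \<xi> x e" for x e
    proof -
      have [simp]: "x \<in> Arr C" "e \<in> Arr C" "Dom C x = Dom C e" "Cod C x = Dom C \<xi>" "Cod C e = Dom C f" and e: "g \<cdot> (f \<cdot> (\<xi> \<cdot> x)) = g \<cdot> (f \<cdot> e)"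
        using x by (auto simp: compat_def)
      have "compat g z (q \<cdot> x) (f \<cdot> e)" by (simp add: compat_def zq e)
      from inv'[OF this] show ?thesis using star[of x e] e x by (simp add: act)
    qed
    ultimately show "effective_datum (g \<cdot> f) \<xi> act" unfolding effective_datum_def by blast
  qed
qed

text \<open>A datum on \<open>z\<close> for \<open>g\<close> is pulled back along \<open>f\<close>
  to a datum for \<open>g \<cdot> f\<close>, which descends to some \<open>z'\<close>. The resulting
  projection \<open>k\<close> is constant on the fibres of \<open>q\<close>, hence factors as
  \<open>l \<cdot> q\<close>, and \<open>l\<close> is shown to exhibit \<open>z\<close> as the
  pullback of \<open>z'\<close> along \<open>g\<close>.\<close>

lemma effdesc_cancel:
  assumes gf: "effdesc (g \<cdot> f)" and rf: "regular_epi C f" and [simp]: "g \<in> Arr C" and fg [simp]: "Cod C f = Dom C g"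
  shows "effdesc g"
proof -
  have [simp]: "f \<in> Arr C" using rf by (auto simp: regular_epi_arr)
  show ?thesis unfolding effdesc_def
  proof (intro conjI allI impI)
    show "regular_epi C g" using gf by (intro regular_epi_cancel[of g f]) (auto simp: effdesc_def)
    fix z act assume dd: "descent_datum g z act"
    note act = descent_datumD[OF dd]
    have [simp]: "z \<in> Arr C" "Cod C z = Dom C g" using act(2,3) by auto
    have compat_g: "compat g z y b" if "y \<in> Arr C" "b \<in> Arr C" "Dom C y = Dom C b" "Cod C y = Dom C z"
      "Cod C b = Dom C g" "g \<cdot> (z \<cdot> y) = g \<cdot> b" for y b
      using that by (simp add: compat_def)
    obtain q \<xi> where X: "is_pullback C q \<xi> z f" using pb_exists[of z f] by auto
    have [simp]: "q \<in> Arr C" "\<xi> \<in> Arr C" "Dom C q = Dom C \<xi>" "Cod C q = Dom C z" "Cod C \<xi> = Dom C f"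
      using pbD[OF X] by auto
    have zq: "z \<cdot> (q \<cdot> x) = f \<cdot> (\<xi> \<cdot> x)" if "x \<in> Arr C" "Cod C x = Dom C \<xi>" for x
      using pb_comm[OF X, of x] that by simp
    have rq: "regular_epi C q" using regular_epi_pb[OF pb_swap[OF X] rf] .
    \<comment> \<open>An element of the pullback has a coordinate over \<open>z\<close>, moved by
      the given action, and a coordinate over the domain of \<open>f\<close>, replaced by
      \<open>a\<close>.\<close>
    define act' where "act' = (\<lambda>x a. pair q \<xi> (act (q \<cdot> x) (f \<cdot> a)) a)"
    have compat': "x \<in> Arr C" "a \<in> Arr C" "Dom C x = Dom C a" "Cod C x = Dom C \<xi>" "Cod C a = Dom C f"
      "g \<cdot> (f \<cdot> (\<xi> \<cdot> x)) = g \<cdot> (f \<cdot> a)" "compat g z (q \<cdot> x) (f \<cdot> a)"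
      if "compat (g \<cdot> f) \<xi> x a" for x a
      using that by (auto simp: compat_def zq)
    have act': "act' x a \<in> Arr C" "Dom C (act' x a) = Dom C a" "Cod C (act' x a) = Dom C \<xi>" "\<xi> \<cdot> act' x a = a"
      "q \<cdot> act' x a = act (q \<cdot> x) (f \<cdot> a)" if "compat (g \<cdot> f) \<xi> x a" for x a
      using compat'[OF that] unfolding act'_def by (simp_all add: pair[OF X] act)
    have dd': "descent_datum (g \<cdot> f) \<xi> act'"
    proof (rule descent_datumI)
      fix x a t assume c: "compat (g \<cdot> f) \<xi> x a" and t: "t \<in> Arr C" "Cod C t = Dom C a"
      note c' = compat'[OF c]
      have "g \<cdot> ((f \<cdot> (\<xi> \<cdot> x)) \<cdot> t) = g \<cdot> ((f \<cdot> a) \<cdot> t)"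
        by (rule comp_eq_extend[OF c'(6)]) (use c'(1-5) t in auto)
      hence ct: "compat (g \<cdot> f) \<xi> (x \<cdot> t) (a \<cdot> t)" using c'(1-5) t by (simp add: compat_def)
      show "act' (x \<cdot> t) (a \<cdot> t) = act' x a \<cdot> t"
      proof (rule pb_ext[OF X])
        have "act (q \<cdot> (x \<cdot> t)) (f \<cdot> (a \<cdot> t)) = act (q \<cdot> x) (f \<cdot> a) \<cdot> t"
          using act(8)[OF c'(7), of t] c'(1-5) t by simp
        moreover have "q \<cdot> (act' x a \<cdot> t) = act (q \<cdot> x) (f \<cdot> a) \<cdot> t"
          by (rule comp_eq_extend1[OF act'(5)[OF c]]) (use act'[OF c] t in auto)
        ultimately show "q \<cdot> act' (x \<cdot> t) (a \<cdot> t) = q \<cdot> (act' x a \<cdot> t)" by (simp add: act'[OF ct])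
        have "\<xi> \<cdot> (act' x a \<cdot> t) = a \<cdot> t"
          by (rule comp_eq_extend1[OF act'(4)[OF c]]) (use act'[OF c] t in auto)
        thus "\<xi> \<cdot> act' (x \<cdot> t) (a \<cdot> t) = \<xi> \<cdot> (act' x a \<cdot> t)" by (simp add: act'[OF ct])
      qed (use c'(1-5) t in \<open>simp_all add: act'[OF c] act'[OF ct]\<close>)
    next
      fix x assume x: "x \<in> Arr C" "Cod C x = Dom C \<xi>"
      hence c: "compat (g \<cdot> f) \<xi> x (\<xi> \<cdot> x)" by (simp add: compat_def)
      show "act' x (\<xi> \<cdot> x) = x"
        by (rule pb_ext[OF X]) (use x in \<open>simp_all add: act'[OF c] zq[symmetric] act\<close>)
    next
      fix x a b assume c: "compat (g \<cdot> f) \<xi> x a" and c2: "compat (g \<cdot> f) \<xi> x b"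
      have c3: "compat (g \<cdot> f) \<xi> (act' x a) b"
        using compat'(1-6)[OF c] compat'(1-6)[OF c2] by (simp add: compat_def act'[OF c])
      show "act' (act' x a) b = act' x b"
        by (rule pb_ext[OF X])
          (use compat'(1-5)[OF c] compat'(1-5)[OF c2] in \<open>simp_all add: act'[OF c] act'[OF c2] act'[OF c3]
             act(10)[OF compat'(7)[OF c] compat'(7)[OF c2]]\<close>)
    qed (auto simp: act')
    obtain k z' where pb: "is_pullback C k \<xi> z' (g \<cdot> f)"
      and inv: "\<And>x e. compat (g \<cdot> f) \<xi> x e \<Longrightarrow> k \<cdot> act' x e = k \<cdot> x"
      using gf dd' unfolding effdesc_def effective_datum_def by blast
    have [simp]: "k \<in> Arr C" "z' \<in> Arr C" "Dom C k = Dom C \<xi>" "Cod C k = Dom C z'" "Cod C z' = Cod C g"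
      using pbD[OF pb] by auto
    have zk: "z' \<cdot> (k \<cdot> x) = g \<cdot> (f \<cdot> (\<xi> \<cdot> x))" if "x \<in> Arr C" "Cod C x = Dom C \<xi>" for x
      using pb_comm[OF pb, of x] that by simp
    obtain l where l [simp]: "l \<in> Arr C" "Dom C l = Dom C z" "Cod C l = Dom C z'" and lq: "l \<cdot> q = k"
    proof (rule regular_epi_descend[OF rq, of k])
      fix x y assume x [simp]: "x \<in> Arr C" "y \<in> Arr C" "Dom C x = Dom C y" "Cod C x = Dom C q" "Cod C y = Dom C q"
        and qx: "q \<cdot> x = q \<cdot> y"
      have fx: "f \<cdot> (\<xi> \<cdot> x) = f \<cdot> (\<xi> \<cdot> y)" using zq[of x] zq[of y] qx by simp
      have c: "compat (g \<cdot> f) \<xi> x (\<xi> \<cdot> y)" using fx by (simp add: compat_def)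
      \<comment> \<open>With equal first coordinates, the unit law of \<open>act\<close> makes
        \<open>y\<close> the transport of \<open>x\<close>; invariance of \<open>k\<close> then
        identifies their images.\<close>
      have "act' x (\<xi> \<cdot> y) = y"
        by (rule pb_ext[OF X]) (simp_all add: act'[OF c] qx zq[symmetric] act)
      thus "k \<cdot> x = k \<cdot> y" using inv[OF c] by simp
    qed auto
    have lqx: "l \<cdot> (q \<cdot> x) = k \<cdot> x" if "x \<in> Arr C" "Cod C x = Dom C \<xi>" for x
      by (rule comp_eq_extend1[OF lq]) (use that in auto)
    have "is_pullback C l z z' g"
    proof (rule pbI)
      have "z' \<cdot> (l \<cdot> q) = g \<cdot> (z \<cdot> q)" using pbD(9)[OF pb] pbD(9)[OF X] lq by simp
      thus "z' \<cdot> l = g \<cdot> z"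
        by - (rule epicD[OF regular_epi_epic[OF rq]]; simp)
    next
      fix u b assume u [simp]: "u \<in> Arr C" "b \<in> Arr C" "Dom C u = Dom C b" "Cod C u = Dom C z'" "Cod C b = Dom C g"
        and ub: "z' \<cdot> u = g \<cdot> b"
      \<comment> \<open>Once \<open>b\<close> lifts along \<open>f\<close> to \<open>a\<close>, the
        pullback for \<open>g \<cdot> f\<close> supplies the element \<open>x\<close>. Its image
        \<open>q \<cdot> x\<close> is independent of the lift and descends along the cover to the
        required element.\<close>
      obtain c a where rc: "regular_epi C c" and c [simp]: "c \<in> Arr C" "a \<in> Arr C" "Dom C a = Dom C c"
        "Cod C c = Dom C b" "Cod C a = Dom C f" and ca: "f \<cdot> a = b \<cdot> c"
        by (rule cover[OF rf, of b]) auto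
      define x where "x = pair k \<xi> (u \<cdot> c) a"
      have "z' \<cdot> (u \<cdot> c) = g \<cdot> (b \<cdot> c)" by (rule comp_eq_extend[OF ub]) auto
      hence x [simp]: "x \<in> Arr C" "Dom C x = Dom C c" "Cod C x = Dom C \<xi>" and kx: "k \<cdot> x = u \<cdot> c" and \<xi>x: "\<xi> \<cdot> x = a"
        unfolding x_def by (simp_all add: pair[OF pb] ca)
      obtain y where y [simp]: "y \<in> Arr C" "Dom C y = Cod C c" "Cod C y = Dom C z" and yc: "y \<cdot> c = q \<cdot> x"
      proof (rule regular_epi_descend[OF rc, of "q \<cdot> x"])
        fix s t assume s [simp]: "s \<in> Arr C" "t \<in> Arr C" "Dom C s = Dom C t" "Cod C s = Dom C c" "Cod C t = Dom C c"
          and st: "c \<cdot> s = c \<cdot> t"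
        have fa: "f \<cdot> (a \<cdot> s) = f \<cdot> (a \<cdot> t)"
          by (simp add: comp_eq_extend[OF ca] st)
        have ks: "k \<cdot> (x \<cdot> s) = k \<cdot> (x \<cdot> t)" by (simp add: comp_eq_extend[OF kx] st)
        have \<xi>s: "\<xi> \<cdot> (x \<cdot> r) = a \<cdot> r" if "r \<in> Arr C" "Cod C r = Dom C c" for r
          by (rule comp_eq_extend1[OF \<xi>x]) (use that in auto)
        have c: "compat (g \<cdot> f) \<xi> (x \<cdot> s) (a \<cdot> t)" by (simp add: compat_def \<xi>s fa)
        \<comment> \<open>Changing the lift moves \<open>x\<close> by the action. The lifts
          \<open>a \<cdot> s\<close> and \<open>a \<cdot> t\<close> have the same image under
          \<open>f\<close>, so on the first coordinate the transport is along an identity and the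
          unit law applies.\<close>
        have "act' (x \<cdot> s) (a \<cdot> t) = x \<cdot> t"
          by (rule pb_ext[OF pb]) (simp_all add: act'(1-4)[OF c] inv[OF c] ks \<xi>s)
        hence "q \<cdot> (x \<cdot> t) = act (q \<cdot> (x \<cdot> s)) (f \<cdot> (a \<cdot> t))" using act'(5)[OF c] by simp
        also have "f \<cdot> (a \<cdot> t) = z \<cdot> (q \<cdot> (x \<cdot> s))" by (simp add: zq \<xi>s fa)
        also have "act (q \<cdot> (x \<cdot> s)) (z \<cdot> (q \<cdot> (x \<cdot> s))) = q \<cdot> (x \<cdot> s)" by (simp add: act del: comp_assoc)
        finally show "(q \<cdot> x) \<cdot> s = (q \<cdot> x) \<cdot> t" by simp
      qed auto
      have "l \<cdot> y = u"
      proof (rule epicD[OF regular_epi_epic[OF rc]])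
        show "(l \<cdot> y) \<cdot> c = u \<cdot> c" by (simp add: yc lqx kx)
      qed auto
      moreover have "z \<cdot> y = b"
      proof (rule epicD[OF regular_epi_epic[OF rc]])
        show "(z \<cdot> y) \<cdot> c = b \<cdot> c" by (simp add: yc zq \<xi>x ca)
      qed auto
      ultimately show "\<exists>y. y \<in> Arr C \<and> Dom C y = Dom C b \<and> Cod C y = Dom C z \<and> l \<cdot> y = u \<and> z \<cdot> y = b"
        by (intro exI[of _ y]) simp
    next
      fix u v assume u [simp]: "u \<in> Arr C" "v \<in> Arr C" "Dom C u = Dom C v" "Cod C u = Dom C z" "Cod C v = Dom C z"
        and l: "l \<cdot> u = l \<cdot> v" and z: "z \<cdot> u = z \<cdot> v"
      obtain c x where ec: "epic c" and c [simp]: "c \<in> Arr C" "x \<in> Arr C" "Dom C x = Dom C c"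
        "Cod C c = Dom C u" "Cod C x = Dom C q" and cx: "q \<cdot> x = u \<cdot> c"
        by (rule cover[OF rq, of u]) auto
      have "z \<cdot> (u \<cdot> c) = z \<cdot> (v \<cdot> c)" by (rule comp_eq_extend[OF z]) auto
      hence zv: "z \<cdot> (v \<cdot> c) = f \<cdot> (\<xi> \<cdot> x)" using zq[of x] cx by simp
      \<comment> \<open>A lift of \<open>v\<close> chosen over the same point of the domain of
        \<open>f\<close> as the lift \<open>x\<close> of \<open>u\<close>. The two lifts then agree
        under both \<open>k\<close> and \<xi>, so they coincide.\<close>
      define y where "y = pair q \<xi> (v \<cdot> c) (\<xi> \<cdot> x)"
      have y [simp]: "y \<in> Arr C" "Dom C y = Dom C c" "Cod C y = Dom C \<xi>" and qy: "q \<cdot> y = v \<cdot> c" and \<xi>y: "\<xi> \<cdot> y = \<xi> \<cdot> x"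
        unfolding y_def by (simp_all add: pair[OF X] zv)
      have "l \<cdot> (u \<cdot> c) = l \<cdot> (v \<cdot> c)" by (rule comp_eq_extend[OF l]) auto
      hence "k \<cdot> x = k \<cdot> y" using lqx[of x] lqx[of y] cx qy by simp
      hence "x = y" by - (rule pb_ext[OF pb]; simp add: \<xi>y)
      thus "u = v" using cx qy by - (rule epicD[OF ec]; simp)
    qed auto
    moreover have "l \<cdot> act y b = l \<cdot> y" if yb: "compat g z y b" for y b
    proof -
      have [simp]: "y \<in> Arr C" "b \<in> Arr C" "Dom C y = Dom C b" "Cod C y = Dom C z" "Cod C b = Dom C g" and gz: "g \<cdot> (z \<cdot> y) = g \<cdot> b"
        using yb by (auto simp: compat_def)
      obtain c x where c [simp]: "epic c" "c \<in> Arr C" "x \<in> Arr C" "Dom C x = Dom C c"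
        "Cod C c = Dom C y" "Cod C x = Dom C q" and cx: "q \<cdot> x = y \<cdot> c"
        by (rule cover[OF rq, of y]) auto
      obtain d a where d [simp]: "epic d" "d \<in> Arr C" "a \<in> Arr C" "Dom C a = Dom C d"
        "Cod C d = Dom C c" "Cod C a = Dom C f" and da: "f \<cdot> a = (b \<cdot> c) \<cdot> d"
        by (rule cover[OF rf, of "b \<cdot> c"]) auto
      have qx: "q \<cdot> (x \<cdot> d) = y \<cdot> (c \<cdot> d)" by (rule comp_eq_extend[OF cx]) auto
      have "f \<cdot> (\<xi> \<cdot> (x \<cdot> d)) = (z \<cdot> y) \<cdot> (c \<cdot> d)" by (simp add: zq[symmetric] qx)
      moreover have "g \<cdot> ((z \<cdot> y) \<cdot> (c \<cdot> d)) = g \<cdot> (b \<cdot> (c \<cdot> d))" by (rule comp_eq_extend[OF gz]) auto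
      ultimately have cc: "compat (g \<cdot> f) \<xi> (x \<cdot> d) a" by (simp add: compat_def da)
      have "(l \<cdot> act y b) \<cdot> (c \<cdot> d) = l \<cdot> act (y \<cdot> (c \<cdot> d)) (b \<cdot> (c \<cdot> d))"
        by (simp add: act yb)
      also have "\<dots> = l \<cdot> (q \<cdot> act' (x \<cdot> d) a)" using act'(5)[OF cc] qx da by simp
      also have "\<dots> = k \<cdot> act' (x \<cdot> d) a" by (rule lqx) (simp_all add: act'[OF cc])
      also have "\<dots> = l \<cdot> (q \<cdot> (x \<cdot> d))" by (simp add: inv[OF cc] lqx)
      also have "\<dots> = (l \<cdot> y) \<cdot> (c \<cdot> d)" by (simp add: qx)
      finally show ?thesis by - (rule epicD[OF epic_comp[OF d(1) c(1)]]; simp add: act yb)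
    qed
    ultimately show "effective_datum g z act" unfolding effective_datum_def by blast
  qed
qed

end

section \<open>Adjunctions and comparison functors\<close>

lemma comp_ftor_simps [simp]:
  "FObj (comp_ftor G F) x = FObj G (FObj F x)" "FArr (comp_ftor G F) f = FArr G (FArr F f)"
  "FObj id_ftor x = x" "FArr id_ftor f = f"
  by (auto simp: comp_ftor_def id_ftor_def)

context cat_functor
begin

lemma ftor_simps [simp]:
  assumes "f \<in> Arr A"
  shows "FArr F f \<in> Arr B" "Dom B (FArr F f) = FObj F (Dom A f)" "Cod B (FArr F f) = FObj F (Cod A f)"
  using FArr_in_hom[of f "Dom A f" "Cod A f"] assms by (auto simp: hom_iff)

lemma ftor_obj [simp]: "X \<in> Obj A \<Longrightarrow> FObj F X \<in> Obj B" by (rule FObj_in_Obj)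

lemma ftor_ide [simp]: "X \<in> Obj A \<Longrightarrow> FArr F (Ide A X) = Ide B (FObj F X)" by (rule FArr_Ide)

lemma ftor_comp:
  assumes "f \<in> Arr A" "g \<in> Arr A" "Cod A f = Dom A g"
  shows "FArr F (g \<cdot>\<^bsub>A\<^esub> f) = FArr F g \<cdot>\<^bsub>B\<^esub> FArr F f"
  using FArr_Comp[of f "Dom A f" "Cod A f" g "Cod A g"] assms by (auto simp: hom_iff)

lemma ftor_iso:
  assumes "is_iso A f" shows "is_iso B (FArr F f)"
proof -
  obtain g where g: "f \<in> Arr A" "g \<in> Arr A" "Dom A g = Cod A f" "Cod A g = Dom A f"
    "g \<cdot>\<^bsub>A\<^esub> f = Ide A (Dom A f)" "f \<cdot>\<^bsub>A\<^esub> g = Ide A (Cod A f)" using source.isoE[OF assms] .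
  show ?thesis
    by (rule target.isoI[of _ "FArr F g"]) (use g in \<open>simp_all flip: ftor_comp\<close>)
qed

end

locale adjn =
  fixes X :: "('p, 'n) cat" and A :: "('o, 'm) cat" and L U \<eta> \<epsilon>
  assumes adjunction: "adjunction X A L U \<eta> \<epsilon>"
begin

sublocale L: cat_functor X A L using adjunction by (simp add: adjunction_def)
sublocale U: cat_functor A X U using adjunction by (simp add: adjunction_def)

lemma unit_typ [simp]:
  assumes "x \<in> Obj X"
  shows "\<eta> x \<in> Arr X" "Dom X (\<eta> x) = x" "Cod X (\<eta> x) = FObj U (FObj L x)"
  using adjunction assms by (auto simp: adjunction_def nat_trans_def hom_iff)

lemma counit_typ [simp]:
  assumes "a \<in> Obj A"
  shows "\<epsilon> a \<in> Arr A" "Dom A (\<epsilon> a) = FObj L (FObj U a)" "Cod A (\<epsilon> a) = a"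
  using adjunction assms by (auto simp: adjunction_def nat_trans_def hom_iff)

lemma unit_nat: "f \<in> Arr X \<Longrightarrow> \<eta> (Cod X f) \<cdot>\<^bsub>X\<^esub> f = FArr U (FArr L f) \<cdot>\<^bsub>X\<^esub> \<eta> (Dom X f)"
  using adjunction by (auto simp: adjunction_def nat_trans_def)

lemma counit_nat: "f \<in> Arr A \<Longrightarrow> \<epsilon> (Cod A f) \<cdot>\<^bsub>A\<^esub> FArr L (FArr U f) = f \<cdot>\<^bsub>A\<^esub> \<epsilon> (Dom A f)"
  using adjunction by (auto simp: adjunction_def nat_trans_def)

lemma triangle_L: "x \<in> Obj X \<Longrightarrow> \<epsilon> (FObj L x) \<cdot>\<^bsub>A\<^esub> FArr L (\<eta> x) = Ide A (FObj L x)"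
  using adjunction by (auto simp: adjunction_def)

lemma triangle_U: "a \<in> Obj A \<Longrightarrow> FArr U (\<epsilon> a) \<cdot>\<^bsub>X\<^esub> \<eta> (FObj U a) = Ide X (FObj U a)"
  using adjunction by (auto simp: adjunction_def)

lemma transpose:
  assumes "x \<in> Obj X" "f \<in> Arr A" "Dom A f = FObj L x"
  shows "f = \<epsilon> (Cod A f) \<cdot>\<^bsub>A\<^esub> FArr L (FArr U f \<cdot>\<^bsub>X\<^esub> \<eta> x)"
proof -
  have "\<epsilon> (Cod A f) \<cdot>\<^bsub>A\<^esub> FArr L (FArr U f \<cdot>\<^bsub>X\<^esub> \<eta> x) = \<epsilon> (Cod A f) \<cdot>\<^bsub>A\<^esub> (FArr L (FArr U f) \<cdot>\<^bsub>A\<^esub> FArr L (\<eta> x))"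
    using assms by (simp add: L.ftor_comp)
  also have "\<dots> = f \<cdot>\<^bsub>A\<^esub> (\<epsilon> (Dom A f) \<cdot>\<^bsub>A\<^esub> FArr L (\<eta> x))"
    by (rule L.target.comp_eq_extend[OF counit_nat]) (use assms in auto)
  also have "\<dots> = f" using assms by (simp add: triangle_L)
  finally show ?thesis by simp
qed

lemma transpose_inj:
  assumes "x \<in> Obj X" "f \<in> Arr A" "Dom A f = FObj L x" "g \<in> Arr A" "Dom A g = FObj L x" "Cod A f = Cod A g"
    "FArr U f \<cdot>\<^bsub>X\<^esub> \<eta> x = FArr U g \<cdot>\<^bsub>X\<^esub> \<eta> x"
  shows "f = g"
  using transpose[OF assms(1-3)] transpose[OF assms(1,4,5)] assms(6,7) by simp

abbreviation "EM \<equiv> em_cat X (comp_ftor U L) \<eta> (\<lambda>x. FArr U (\<epsilon> (FObj L x)))"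
abbreviation "K \<equiv> comparison_ftor A U \<epsilon>"

definition algebra :: "'p \<times> 'n \<Rightarrow> bool" where
  "algebra = (\<lambda>(x, h). x \<in> Obj X \<and> h \<in> Arr X \<and> Dom X h = FObj U (FObj L x) \<and> Cod X h = x \<and>
     h \<cdot>\<^bsub>X\<^esub> \<eta> x = Ide X x \<and> h \<cdot>\<^bsub>X\<^esub> FArr U (\<epsilon> (FObj L x)) = h \<cdot>\<^bsub>X\<^esub> FArr U (FArr L h))"

lemma algebraD:
  assumes "algebra a"
  shows "fst a \<in> Obj X" "snd a \<in> Arr X" "Dom X (snd a) = FObj U (FObj L (fst a))" "Cod X (snd a) = fst a"
    "snd a \<cdot>\<^bsub>X\<^esub> \<eta> (fst a) = Ide X (fst a)"
    "snd a \<cdot>\<^bsub>X\<^esub> FArr U (\<epsilon> (FObj L (fst a))) = snd a \<cdot>\<^bsub>X\<^esub> FArr U (FArr L (snd a))"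
  using assms by (auto simp: algebra_def)

lemma EM_simps:
  "Obj EM = Collect algebra"
  "Arr EM = {(a, u, b). algebra a \<and> algebra b \<and> u \<in> hom X (fst a) (fst b) \<and>
     u \<cdot>\<^bsub>X\<^esub> snd a = snd b \<cdot>\<^bsub>X\<^esub> FArr U (FArr L u)}"
  "Dom EM (a, u, b) = a" "Cod EM (a, u, b) = b" "Ide EM a = (a, Ide X (fst a), a)"
  "Comp EM (b', v, c) (a, u, b) = (a, v \<cdot>\<^bsub>X\<^esub> u, c)"
  by (auto simp: em_cat_def Let_def algebra_def hom_iff)

lemma EM_homI:
  assumes "algebra a" "algebra b" "u \<in> Arr X" "Dom X u = fst a" "Cod X u = fst b"
    "u \<cdot>\<^bsub>X\<^esub> snd a = snd b \<cdot>\<^bsub>X\<^esub> FArr U (FArr L u)"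
  shows "(a, u, b) \<in> hom EM a b"
  using assms unfolding hom_iff EM_simps by simp

lemma EM_homE:
  assumes "w \<in> hom EM a b"
  obtains u where "w = (a, u, b)" "algebra a" "algebra b" "u \<in> Arr X" "Dom X u = fst a" "Cod X u = fst b"
    "u \<cdot>\<^bsub>X\<^esub> snd a = snd b \<cdot>\<^bsub>X\<^esub> FArr U (FArr L u)"
proof -
  obtain a' u b' where w: "w = (a', u, b')" by (cases w) auto
  from assms have 1: "w \<in> Arr EM" "Dom EM w = a" "Cod EM w = b" by (simp_all only: hom_iff)
  have "w = (a, u, b)" using 1(2,3) by (simp only: w EM_simps)
  moreover from 1(1) have "algebra a \<and> algebra b \<and> u \<in> hom X (fst a) (fst b) \<and>
    u \<cdot>\<^bsub>X\<^esub> snd a = snd b \<cdot>\<^bsub>X\<^esub> FArr U (FArr L u)"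
    by (simp only: calculation EM_simps mem_Collect_eq prod.case)
  ultimately show ?thesis using that[of u] by (simp only: hom_iff)
qed

lemma category_EM: "category EM"
proof
  fix f assume "f \<in> Arr EM"
  then obtain a u b where "f = (a, u, b)" "algebra a" "algebra b" unfolding EM_simps by auto
  thus "Dom EM f \<in> Obj EM" "Cod EM f \<in> Obj EM" by (simp_all add: EM_simps)
next
  fix a assume "a \<in> Obj EM"
  hence a: "algebra a" by (simp add: EM_simps)
  show "Ide EM a \<in> hom EM a a"
    unfolding EM_simps by (rule EM_homI) (simp_all add: a algebraD(1-4)[OF a])
next
  fix f a b g d assume "f \<in> hom EM a b" "g \<in> hom EM b d"
  then obtain u v where *: "algebra a" "algebra b" "algebra d" and fg: "f = (a, u, b)" "g = (b, v, d)"
    and [simp]: "u \<in> Arr X" "Dom X u = fst a" "Cod X u = fst b" "v \<in> Arr X" "Dom X v = fst b" "Cod X v = fst d"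
    and u: "u \<cdot>\<^bsub>X\<^esub> snd a = snd b \<cdot>\<^bsub>X\<^esub> FArr U (FArr L u)"
    and v: "v \<cdot>\<^bsub>X\<^esub> snd b = snd d \<cdot>\<^bsub>X\<^esub> FArr U (FArr L v)"
    by (elim EM_homE) blast
  note [simp] = algebraD(1-4)[OF *(1)] algebraD(1-4)[OF *(2)] algebraD(1-4)[OF *(3)]
  have "v \<cdot>\<^bsub>X\<^esub> (u \<cdot>\<^bsub>X\<^esub> snd a) = snd d \<cdot>\<^bsub>X\<^esub> (FArr U (FArr L v) \<cdot>\<^bsub>X\<^esub> FArr U (FArr L u))"
    unfolding u by (rule L.source.comp_eq_extend[OF v]) auto
  thus "g \<cdot>\<^bsub>EM\<^esub> f \<in> hom EM a d"
    unfolding fg EM_simps by (intro EM_homI) (simp_all add: * L.ftor_comp U.ftor_comp)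
next
  fix f a b assume "f \<in> hom EM a b"
  then obtain u where u: "f = (a, u, b)" "algebra a" "algebra b" "u \<in> Arr X" "Dom X u = fst a" "Cod X u = fst b"
    by (rule EM_homE)
  thus "f \<cdot>\<^bsub>EM\<^esub> Ide EM a = f" "Ide EM b \<cdot>\<^bsub>EM\<^esub> f = f"
    by (simp_all only: EM_simps) (simp_all add: u(5,6))
next
  fix f a b g d h e assume "f \<in> hom EM a b" "g \<in> hom EM b d" "h \<in> hom EM d e"
  then obtain u v w where "f = (a, u, b)" "g = (b, v, d)" "h = (d, w, e)" "u \<in> Arr X" "Dom X u = fst a" "Cod X u = fst b"
    "v \<in> Arr X" "Dom X v = fst b" "Cod X v = fst d" "w \<in> Arr X" "Dom X w = fst d" "Cod X w = fst e"
    by (elim EM_homE) blast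
  thus "(h \<cdot>\<^bsub>EM\<^esub> g) \<cdot>\<^bsub>EM\<^esub> f = h \<cdot>\<^bsub>EM\<^esub> (g \<cdot>\<^bsub>EM\<^esub> f)"
    by (simp only: EM_simps) simp
qed

text \<open>The unit law is a triangle identity; the associativity law is naturality of the counit
  at \<open>\<epsilon> a\<close>.\<close>

lemma algebra_counit: "a \<in> Obj A \<Longrightarrow> algebra (FObj U a, FArr U (\<epsilon> a))"
  using counit_nat[of "\<epsilon> a"] by (simp add: algebra_def triangle_U flip: U.ftor_comp)

lemma K_simps [simp]:
  "FObj K a = (FObj U a, FArr U (\<epsilon> a))"
  "FArr K f = ((FObj U (Dom A f), FArr U (\<epsilon> (Dom A f))), FArr U f, (FObj U (Cod A f), FArr U (\<epsilon> (Cod A f))))"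
  by (auto simp: comparison_ftor_def Let_def)

lemma functor_K: "cat_functor A EM K"
proof (intro_locales)
  show "category EM" by (rule category_EM)
  show "cat_functor_axioms A EM K"
  proof
    fix f x y assume "f \<in> hom A x y"
    hence [simp]: "f \<in> Arr A" "Dom A f = x" "Cod A f = y" and o: "x \<in> Obj A" "y \<in> Obj A"
      using L.target.dom_cod_obj[of f] by (auto simp: hom_iff)
    have "FArr U (\<epsilon> (Cod A f) \<cdot>\<^bsub>A\<^esub> FArr L (FArr U f)) = FArr U (f \<cdot>\<^bsub>A\<^esub> \<epsilon> (Dom A f))"
      by (simp only: counit_nat \<open>f \<in> Arr A\<close>)
    hence "FArr U f \<cdot>\<^bsub>X\<^esub> FArr U (\<epsilon> x) = FArr U (\<epsilon> y) \<cdot>\<^bsub>X\<^esub> FArr U (FArr L (FArr U f))"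
      using o by (simp add: U.ftor_comp)
    thus "FArr K f \<in> hom EM (FObj K x) (FObj K y)"
      unfolding K_simps by (simp, intro EM_homI) (simp_all add: o algebra_counit)
  next
    fix x assume "x \<in> Obj A"
    thus "FObj K x \<in> Obj EM" "FArr K (Ide A x) = Ide EM (FObj K x)"
      unfolding K_simps EM_simps by (simp_all add: algebra_counit)
  next
    fix f x y g z assume "f \<in> hom A x y" "g \<in> hom A y z"
    thus "FArr K (g \<cdot>\<^bsub>A\<^esub> f) = FArr K g \<cdot>\<^bsub>EM\<^esub> FArr K f"
      unfolding K_simps EM_simps hom_iff by (simp add: U.ftor_comp)
  qed
qed

end

section \<open>Equivalences of categories\<close>

lemma equivalence_essentially_surjective:
  assumes "is_equivalence A B K" "b \<in> Obj B"
  obtains a i where "a \<in> Obj A" "is_iso B i" "i \<in> Arr B" "Dom B i = FObj K a" "Cod B i = b"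
  using assms unfolding is_equivalence_def nat_iso_def nat_trans_def hom_iff
  by (metis cat_functor.FObj_in_Obj comp_ftor_simps(1,3))

text \<open>The natural isomorphism \<sigma> presents \<open>f\<close> as a conjugate of the image
  of \<open>FArr K f\<close> under the quasi-inverse.\<close>

lemma equivalence_reflects_iso:
  assumes eq: "is_equivalence A B K" and f: "f \<in> Arr A" and Kf: "is_iso B (FArr K f)"
  shows "is_iso A f"
proof -
  obtain H \<sigma> where H: "cat_functor B A H" "nat_iso A A id_ftor (comp_ftor H K) \<sigma>" and K: "cat_functor A B K"
    using eq by (auto simp: is_equivalence_def)
  interpret H: cat_functor B A H by (rule H)
  interpret K: cat_functor A B K by (rule K)
  have s: "is_iso A (\<sigma> x)" "\<sigma> x \<in> Arr A" "Dom A (\<sigma> x) = x" "Cod A (\<sigma> x) = FObj H (FObj K x)" if "x \<in> Obj A" for x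
    using H(2) that by (auto simp: nat_iso_def nat_trans_def hom_iff)
  obtain t where t: "t \<in> Arr A" "Dom A t = Cod A (\<sigma> (Cod A f))" "Cod A t = Dom A (\<sigma> (Cod A f))"
    "t \<cdot>\<^bsub>A\<^esub> \<sigma> (Cod A f) = Ide A (Dom A (\<sigma> (Cod A f)))" "is_iso A t"
    using H.target.isoE[OF s(1)[OF H.target.dom_cod_obj(2)[OF f]]] by metis
  have "\<sigma> (Cod A f) \<cdot>\<^bsub>A\<^esub> f = FArr H (FArr K f) \<cdot>\<^bsub>A\<^esub> \<sigma> (Dom A f)"
    using H(2) f by (auto simp: nat_iso_def nat_trans_def)
  hence "t \<cdot>\<^bsub>A\<^esub> (FArr H (FArr K f) \<cdot>\<^bsub>A\<^esub> \<sigma> (Dom A f)) = t \<cdot>\<^bsub>A\<^esub> (\<sigma> (Cod A f) \<cdot>\<^bsub>A\<^esub> f)" by simp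
  also have "\<dots> = f" using f s t by (subst H.target.comp_eq_extend1[OF t(4)]) auto
  finally have "f = t \<cdot>\<^bsub>A\<^esub> (FArr H (FArr K f) \<cdot>\<^bsub>A\<^esub> \<sigma> (Dom A f))" by simp
  also have "is_iso A \<dots>"
    using f s t H.ftor_iso[OF Kf] by (intro H.target.iso_comp) auto
  finally show ?thesis .
qed

text \<open>Full, faithful and essentially surjective functors are equivalences. For each
  \<open>b\<close> an object \<open>h b\<close> and an isomorphism \<open>\<tau> b\<close> onto
  \<open>b\<close> are chosen, with inverse \<open>t b\<close>.\<close>

lemma equivalenceI:
  assumes K: "cat_functor A B K"
    and full: "\<And>x y g. \<lbrakk>x \<in> Obj A; y \<in> Obj A; g \<in> Arr B; Dom B g = FObj K x; Cod B g = FObj K y\<rbrakk> \<Longrightarrow>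
      \<exists>f. f \<in> Arr A \<and> Dom A f = x \<and> Cod A f = y \<and> FArr K f = g"
    and faithful: "\<And>f g. \<lbrakk>f \<in> Arr A; g \<in> Arr A; Dom A f = Dom A g; Cod A f = Cod A g; FArr K f = FArr K g\<rbrakk> \<Longrightarrow> f = g"
    and es: "\<And>b. b \<in> Obj B \<Longrightarrow> \<exists>a i. a \<in> Obj A \<and> is_iso B i \<and> Dom B i = FObj K a \<and> Cod B i = b"
  shows "is_equivalence A B K"
proof -
  interpret K: cat_functor A B K by (rule K)
  obtain h \<tau> where ht: "\<And>b. b \<in> Obj B \<Longrightarrow> h b \<in> Obj A \<and> is_iso B (\<tau> b) \<and> Dom B (\<tau> b) = FObj K (h b) \<and> Cod B (\<tau> b) = b"
    using es by metis
  have "\<exists>t. b \<in> Obj B \<longrightarrow> t \<in> Arr B \<and> Dom B t = b \<and> Cod B t = FObj K (h b) \<and> t \<cdot>\<^bsub>B\<^esub> \<tau> b = Ide B (FObj K (h b)) \<and> \<tau> b \<cdot>\<^bsub>B\<^esub> t = Ide B b \<and> is_iso B t" for b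
  proof (cases "b \<in> Obj B")
    case True
    show ?thesis using K.target.isoE[of "\<tau> b"] ht[OF True] by metis
  qed auto
  then obtain t where t: "\<And>b. b \<in> Obj B \<Longrightarrow> t b \<in> Arr B \<and> Dom B (t b) = b \<and> Cod B (t b) = FObj K (h b) \<and> t b \<cdot>\<^bsub>B\<^esub> \<tau> b = Ide B (FObj K (h b)) \<and> \<tau> b \<cdot>\<^bsub>B\<^esub> t b = Ide B b \<and> is_iso B (t b)"
    by metis
  have \<tau>: "\<tau> b \<in> Arr B" if "b \<in> Obj B" for b using ht[OF that] by (auto simp: is_iso_def)
  define pre where "pre = (\<lambda>x y g. SOME f. f \<in> Arr A \<and> Dom A f = x \<and> Cod A f = y \<and> FArr K f = g)"
  have pre: "pre x y g \<in> Arr A" "Dom A (pre x y g) = x" "Cod A (pre x y g) = y" "FArr K (pre x y g) = g"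
    if "x \<in> Obj A" "y \<in> Obj A" "g \<in> Arr B" "Dom B g = FObj K x" "Cod B g = FObj K y" for x y g
    using someI_ex[OF full[OF that]] unfolding pre_def by auto
  \<comment> \<open>Conjugation by the chosen isomorphisms carries an arrow of \<open>B\<close> into
    the image of \<open>K\<close>; the quasi-inverse is its preimage, and faithfulness makes it
    functorial.\<close>
  define c where "c = (\<lambda>g. t (Cod B g) \<cdot>\<^bsub>B\<^esub> (g \<cdot>\<^bsub>B\<^esub> \<tau> (Dom B g)))"
  have c: "c g \<in> Arr B" "Dom B (c g) = FObj K (h (Dom B g))" "Cod B (c g) = FObj K (h (Cod B g))" if "g \<in> Arr B" for g
    using that ht[of "Dom B g"] t[of "Cod B g"] \<tau>[of "Dom B g"] by (simp_all add: c_def)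
  define H where "H = \<lparr>FObj = h, FArr = (\<lambda>g. pre (h (Dom B g)) (h (Cod B g)) (c g))\<rparr>"
  have H_simps [simp]: "FObj H = h" and H_arr: "FArr H g = pre (h (Dom B g)) (h (Cod B g)) (c g)" for g by (auto simp: H_def)
  have H_pre: "FArr H g \<in> Arr A" "Dom A (FArr H g) = h (Dom B g)" "Cod A (FArr H g) = h (Cod B g)" "FArr K (FArr H g) = c g"
    if "g \<in> Arr B" for g
    unfolding H_arr using that by (intro pre; simp add: ht c)+
  have cat_H: "cat_functor B A H"
  proof (intro_locales)
    show "cat_functor_axioms B A H"
    proof
      fix b assume b: "b \<in> Obj B"
      thus "FObj H b \<in> Obj A" using ht by simp
      show "FArr H (Ide B b) = Ide A (FObj H b)"
        using b ht t[OF b] \<tau>[OF b] by (intro faithful) (simp_all add: H_pre, simp add: c_def)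
    next
      fix f x y assume "f \<in> hom B x y"
      thus "FArr H f \<in> hom A (FObj H x) (FObj H y)" by (simp add: hom_iff H_pre)
    next
      fix f x y g z assume "f \<in> hom B x y" "g \<in> hom B y z"
      hence [simp]: "f \<in> Arr B" "Dom B f = x" "Cod B f = y" "g \<in> Arr B" "Dom B g = y" "Cod B g = z" by (auto simp: hom_iff)
      have o [simp]: "x \<in> Obj B" "y \<in> Obj B" "z \<in> Obj B"
        using K.target.dom_cod_obj[of f] K.target.dom_cod_obj[of g] by auto
      have t': "\<tau> y \<cdot>\<^bsub>B\<^esub> (t y \<cdot>\<^bsub>B\<^esub> s) = s" if "s \<in> Arr B" "Cod B s = y" for s
        using that t[of y] ht[of y] \<tau>[of y] by (subst K.target.comp_eq_extend1[of "\<tau> y" "t y"]) auto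
      have "c (g \<cdot>\<^bsub>B\<^esub> f) = c g \<cdot>\<^bsub>B\<^esub> c f"
        using t[of y] t[of z] ht[of x] ht[of y] \<tau> by (simp add: c_def t')
      thus "FArr H (g \<cdot>\<^bsub>B\<^esub> f) = FArr H g \<cdot>\<^bsub>A\<^esub> FArr H f"
        by - (rule faithful; simp add: H_pre K.ftor_comp)
    qed
  qed
  \<comment> \<open>The unit of the equivalence is the preimage under \<open>K\<close> of the
    inverse isomorphism at \<open>FObj K a\<close>.\<close>
  define \<sigma> where "\<sigma> = (\<lambda>a. pre a (h (FObj K a)) (t (FObj K a)))"
  have \<sigma>: "\<sigma> a \<in> Arr A" "Dom A (\<sigma> a) = a" "Cod A (\<sigma> a) = h (FObj K a)" "FArr K (\<sigma> a) = t (FObj K a)" if "a \<in> Obj A" for a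
    unfolding \<sigma>_def using that t[of "FObj K a"] ht[of "FObj K a"] by (intro pre; simp)+
  have "is_iso A (\<sigma> a)" if a: "a \<in> Obj A" for a
  proof -
    let ?b = "FObj K a"
    have b: "?b \<in> Obj B" using a by simp
    let ?r = "pre (h ?b) a (\<tau> ?b)"
    have r: "?r \<in> Arr A" "Dom A ?r = h ?b" "Cod A ?r = a" "FArr K ?r = \<tau> ?b"
      using a ht[OF b] \<tau>[OF b] by (intro pre; simp)+
    show ?thesis
    proof (rule K.source.isoI[of _ ?r])
      show "?r \<cdot>\<^bsub>A\<^esub> \<sigma> a = Ide A (Dom A (\<sigma> a))"
        by (rule faithful) (use r \<sigma>[OF a] a t[OF b] in \<open>simp_all add: K.ftor_comp\<close>)
      show "\<sigma> a \<cdot>\<^bsub>A\<^esub> ?r = Ide A (Cod A (\<sigma> a))"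
        by (rule faithful) (use r \<sigma>[OF a] a t[OF b] ht[OF b] in \<open>simp_all add: K.ftor_comp\<close>)
    qed (use r \<sigma>[OF a] in auto)
  qed
  moreover have "\<sigma> (Cod A f) \<cdot>\<^bsub>A\<^esub> f = FArr H (FArr K f) \<cdot>\<^bsub>A\<^esub> \<sigma> (Dom A f)" if f: "f \<in> Arr A" for f
  proof (rule faithful)
    have o: "Dom A f \<in> Obj A" "Cod A f \<in> Obj A" using f by auto
    have "\<tau> (FObj K (Dom A f)) \<cdot>\<^bsub>B\<^esub> t (FObj K (Dom A f)) = Ide B (FObj K (Dom A f))" using t o by simp
    thus "FArr K (\<sigma> (Cod A f) \<cdot>\<^bsub>A\<^esub> f) = FArr K (FArr H (FArr K f) \<cdot>\<^bsub>A\<^esub> \<sigma> (Dom A f))"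
      using f o \<sigma> t[of "FObj K (Dom A f)"] t[of "FObj K (Cod A f)"] ht[of "FObj K (Dom A f)"] \<tau>[of "FObj K (Dom A f)"]
      by (simp add: K.ftor_comp H_pre c_def)
  qed (use f \<sigma> H_pre[of "FArr K f"] in auto)
  ultimately have "nat_iso A A id_ftor (comp_ftor H K) \<sigma>"
    using \<sigma> by (simp add: nat_iso_def nat_trans_def hom_iff)
  moreover have "nat_iso B B (comp_ftor K H) id_ftor \<tau>"
    unfolding nat_iso_def nat_trans_def
  proof (intro conjI ballI)
    fix f assume f: "f \<in> Arr B"
    let ?x = "Dom B f" and ?y = "Cod B f"
    have "\<tau> ?y \<cdot>\<^bsub>B\<^esub> (t ?y \<cdot>\<^bsub>B\<^esub> (f \<cdot>\<^bsub>B\<^esub> \<tau> ?x)) = f \<cdot>\<^bsub>B\<^esub> \<tau> ?x"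
      using f t[of ?y] ht[of ?y] \<tau>[of ?y] \<tau>[of ?x] ht[of ?x] by (subst K.target.comp_eq_extend1[of "\<tau> ?y" "t ?y"]) auto
    thus "\<tau> (Cod B f) \<cdot>\<^bsub>B\<^esub> FArr (comp_ftor K H) f = FArr id_ftor f \<cdot>\<^bsub>B\<^esub> \<tau> (Dom B f)"
      using f by (simp add: H_pre c_def)
  qed (auto simp: ht \<tau> hom_iff)
  ultimately show ?thesis using K cat_H unfolding is_equivalence_def by blast
qed

text \<open>The definition of \<open>monadic\<close> leaves the left adjoint unspecified; \<open>\<theta>\<close> compares an arbitrary
  one with the canonical one, along which algebras are transported.\<close>

locale two_adjn = adjn X A L U \<eta> \<epsilon> + R: adjn X A L' U \<eta>' \<epsilon>'
  for X :: "('p, 'n) cat" and A :: "('o, 'm) cat" and L U \<eta> \<epsilon> L' \<eta>' \<epsilon>'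
begin

text \<open>This is the transpose, under the first adjunction, of the unit \<eta>' of the
  second.\<close>

definition \<theta> :: "'p \<Rightarrow> 'm" where
  "\<theta> x = \<epsilon> (FObj L' x) \<cdot>\<^bsub>A\<^esub> FArr L (\<eta>' x)"

lemma theta_typ [simp]:
  assumes "x \<in> Obj X"
  shows "\<theta> x \<in> Arr A" "Dom A (\<theta> x) = FObj L x" "Cod A (\<theta> x) = FObj L' x"
  using assms by (simp_all add: \<theta>_def)

lemma theta_nat:
  assumes "f \<in> Arr X" shows "\<theta> (Cod X f) \<cdot>\<^bsub>A\<^esub> FArr L f = FArr L' f \<cdot>\<^bsub>A\<^esub> \<theta> (Dom X f)"
proof -
  let ?x = "Dom X f" and ?y = "Cod X f"
  have o [simp]: "?x \<in> Obj X" "?y \<in> Obj X" and f [simp]: "f \<in> Arr X" using assms by auto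
  have "FArr L (\<eta>' ?y) \<cdot>\<^bsub>A\<^esub> FArr L f = FArr L (FArr U (FArr L' f)) \<cdot>\<^bsub>A\<^esub> FArr L (\<eta>' ?x)"
    by (simp add: R.unit_nat flip: L.ftor_comp)
  hence "\<theta> ?y \<cdot>\<^bsub>A\<^esub> FArr L f = \<epsilon> (FObj L' ?y) \<cdot>\<^bsub>A\<^esub> (FArr L (FArr U (FArr L' f)) \<cdot>\<^bsub>A\<^esub> FArr L (\<eta>' ?x))"
    by (simp add: \<theta>_def)
  also have "\<dots> = FArr L' f \<cdot>\<^bsub>A\<^esub> (\<epsilon> (FObj L' ?x) \<cdot>\<^bsub>A\<^esub> FArr L (\<eta>' ?x))"
    using counit_nat[of "FArr L' f"] by (intro L.target.comp_eq_extend) simp_all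
  finally show ?thesis by (simp add: \<theta>_def)
qed

text \<open>Together with naturality and \<open>theta_unit\<close>, this makes the image of \<theta>
  under \<open>U\<close> compatible with the two monad structures, as needed to transport
  algebras.\<close>

lemma theta_counit:
  assumes [simp]: "a \<in> Obj A" shows "\<epsilon>' a \<cdot>\<^bsub>A\<^esub> \<theta> (FObj U a) = \<epsilon> a"
proof -
  have "\<epsilon>' a \<cdot>\<^bsub>A\<^esub> (\<epsilon> (FObj L' (FObj U a)) \<cdot>\<^bsub>A\<^esub> FArr L (\<eta>' (FObj U a))) =
    \<epsilon> a \<cdot>\<^bsub>A\<^esub> (FArr L (FArr U (\<epsilon>' a)) \<cdot>\<^bsub>A\<^esub> FArr L (\<eta>' (FObj U a)))"
    using counit_nat[of "\<epsilon>' a"] by (intro L.target.comp_eq_extend) simp_all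
  also have "\<dots> = \<epsilon> a" by (simp add: R.triangle_U flip: L.ftor_comp)
  finally show ?thesis by (simp add: \<theta>_def)
qed

lemma theta_unit:
  assumes [simp]: "x \<in> Obj X" shows "FArr U (\<theta> x) \<cdot>\<^bsub>X\<^esub> \<eta> x = \<eta>' x"
proof -
  have "FArr U (FArr L (\<eta>' x)) \<cdot>\<^bsub>X\<^esub> \<eta> x = \<eta> (FObj U (FObj L' x)) \<cdot>\<^bsub>X\<^esub> \<eta>' x"
    using unit_nat[of "\<eta>' x"] by simp
  hence "FArr U (\<theta> x) \<cdot>\<^bsub>X\<^esub> \<eta> x = FArr U (\<epsilon> (FObj L' x)) \<cdot>\<^bsub>X\<^esub> (\<eta> (FObj U (FObj L' x)) \<cdot>\<^bsub>X\<^esub> \<eta>' x)"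
    by (simp add: \<theta>_def U.ftor_comp)
  also have "\<dots> = \<eta>' x"
    using L.source.comp_eq_extend1[OF triangle_U[of "FObj L' x"], of "\<eta>' x"] by simp
  finally show ?thesis .
qed

end

context two_adjn
begin

interpretation S: two_adjn X A L' U \<eta>' \<epsilon>' L \<eta> \<epsilon> by unfold_locales

text \<open>Exchanging the two adjunctions gives the comparison in the other direction, and
  transposing along the unit reduces the composite to an identity. A right inverse is the form in
  which it serves to cancel \<theta> on the right.\<close>

lemma theta_inverse:
  assumes [simp]: "x \<in> Obj X"
  obtains \<theta>' where "\<theta>' \<in> Arr A" "Dom A \<theta>' = FObj L' x" "Cod A \<theta>' = FObj L x" "\<theta> x \<cdot>\<^bsub>A\<^esub> \<theta>' = Ide A (FObj L' x)"
proof
  show "\<theta> x \<cdot>\<^bsub>A\<^esub> S.\<theta> x = Ide A (FObj L' x)"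
    by (rule R.transpose_inj[of x]) (simp_all add: U.ftor_comp S.theta_unit theta_unit)
qed simp_all

text \<open>Essential surjectivity is known for the left adjoint \<open>L\<close> hidden in
  \<open>monadic\<close>, while algebras are concrete for \<open>L'\<close>. An algebra of the
  second monad is turned into one of the first, found isomorphic to a comparison algebra, and the
  isomorphism is translated back.\<close>

lemma algebra_transfer:
  assumes eq: "is_equivalence A EM K" and alg: "R.algebra (x, h)"
  obtains a u where "a \<in> Obj A" "is_iso X u" "u \<in> Arr X" "Dom X u = FObj U a" "Cod X u = x"
    "u \<cdot>\<^bsub>X\<^esub> FArr U (\<epsilon>' a) = h \<cdot>\<^bsub>X\<^esub> FArr U (FArr L' u)"
proof -
  note al = R.algebraD[OF alg, simplified]
  note [simp] = al(1-4)
  \<comment> \<open>Precomposition with the image of \<theta> under \<open>U\<close> changes an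
    algebra structure for \<open>L'\<close> into one for \<open>L\<close>; the associativity law
    uses \<open>theta_counit\<close> and \<open>theta_nat\<close>.\<close>
  define k where "k = h \<cdot>\<^bsub>X\<^esub> FArr U (\<theta> x)"
  have k [simp]: "k \<in> Arr X" "Dom X k = FObj U (FObj L x)" "Cod X k = x" by (simp_all add: k_def)
  have "k \<cdot>\<^bsub>X\<^esub> \<eta> x = Ide X x" by (simp add: k_def theta_unit al(5))
  moreover have "k \<cdot>\<^bsub>X\<^esub> FArr U (\<epsilon> (FObj L x)) = k \<cdot>\<^bsub>X\<^esub> FArr U (FArr L k)"
  proof -
    let ?x = "FObj L x"
    have "\<theta> x \<cdot>\<^bsub>A\<^esub> \<epsilon> ?x = \<epsilon> (FObj L' x) \<cdot>\<^bsub>A\<^esub> FArr L (FArr U (\<theta> x))"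
      using counit_nat[of "\<theta> x"] by simp
    also have "\<dots> = \<epsilon>' (FObj L' x) \<cdot>\<^bsub>A\<^esub> (\<theta> (FObj U (FObj L' x)) \<cdot>\<^bsub>A\<^esub> FArr L (FArr U (\<theta> x)))"
      by (subst L.target.comp_eq_extend1[OF theta_counit]) simp_all
    also have "\<dots> = \<epsilon>' (FObj L' x) \<cdot>\<^bsub>A\<^esub> (FArr L' (FArr U (\<theta> x)) \<cdot>\<^bsub>A\<^esub> \<theta> (FObj U ?x))"
      using theta_nat[of "FArr U (\<theta> x)"] by simp
    finally have 1: "FArr U (\<theta> x) \<cdot>\<^bsub>X\<^esub> FArr U (\<epsilon> ?x) =
      FArr U (\<epsilon>' (FObj L' x)) \<cdot>\<^bsub>X\<^esub> (FArr U (FArr L' (FArr U (\<theta> x))) \<cdot>\<^bsub>X\<^esub> FArr U (\<theta> (FObj U ?x)))"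
      by (simp flip: U.ftor_comp)
    have "k \<cdot>\<^bsub>X\<^esub> FArr U (\<epsilon> ?x) =
      h \<cdot>\<^bsub>X\<^esub> (FArr U (\<epsilon>' (FObj L' x)) \<cdot>\<^bsub>X\<^esub> (FArr U (FArr L' (FArr U (\<theta> x))) \<cdot>\<^bsub>X\<^esub> FArr U (\<theta> (FObj U ?x))))"
      by (simp add: k_def 1)
    also have "\<dots> = h \<cdot>\<^bsub>X\<^esub> (FArr U (FArr L' h) \<cdot>\<^bsub>X\<^esub> (FArr U (FArr L' (FArr U (\<theta> x))) \<cdot>\<^bsub>X\<^esub> FArr U (\<theta> (FObj U ?x))))"
      by (rule L.source.comp_eq_extend[OF al(6)]) simp_all
    also have "FArr U (FArr L' h) \<cdot>\<^bsub>X\<^esub> (FArr U (FArr L' (FArr U (\<theta> x))) \<cdot>\<^bsub>X\<^esub> FArr U (\<theta> (FObj U ?x))) =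
      FArr U (FArr L' k \<cdot>\<^bsub>A\<^esub> \<theta> (FObj U ?x))"
      by (simp add: k_def U.ftor_comp R.L.ftor_comp)
    also have "FArr L' k \<cdot>\<^bsub>A\<^esub> \<theta> (FObj U ?x) = \<theta> x \<cdot>\<^bsub>A\<^esub> FArr L k" using theta_nat[of k] by simp
    also have "h \<cdot>\<^bsub>X\<^esub> FArr U (\<theta> x \<cdot>\<^bsub>A\<^esub> FArr L k) = k \<cdot>\<^bsub>X\<^esub> FArr U (FArr L k)"
      by (simp add: k_def U.ftor_comp)
    finally show ?thesis .
  qed
  ultimately have "algebra (x, k)" by (simp add: algebra_def)
  hence "(x, k) \<in> Obj EM" by (simp add: EM_simps)
  then obtain a i where a [simp]: "a \<in> Obj A" and i: "is_iso EM i" "i \<in> Arr EM" "Dom EM i = FObj K a" "Cod EM i = (x, k)"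
    by (rule equivalence_essentially_surjective[OF eq])
  have "i \<in> hom EM (FObj K a) (x, k)" using i by (simp only: hom_iff)
  then obtain u where iu: "i = (FObj K a, u, (x, k))" and u [simp]: "u \<in> Arr X" "Dom X u = FObj U a" "Cod X u = x"
    and uk: "u \<cdot>\<^bsub>X\<^esub> FArr U (\<epsilon> a) = k \<cdot>\<^bsub>X\<^esub> FArr U (FArr L u)"
    by (rule EM_homE) simp
  have "is_iso X u"
  proof -
    interpret EM: category EM by (rule category_EM)
    obtain j where j: "j \<in> Arr EM" "Dom EM j = Cod EM i" "Cod EM j = Dom EM i"
      "j \<cdot>\<^bsub>EM\<^esub> i = Ide EM (Dom EM i)" "i \<cdot>\<^bsub>EM\<^esub> j = Ide EM (Cod EM i)"
      using EM.isoE[OF i(1)] .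
    have "j \<in> hom EM (x, k) (FObj K a)" using i j by (simp only: hom_iff)
    then obtain v where jv: "j = ((x, k), v, FObj K a)" and v: "v \<in> Arr X" "Dom X v = x" "Cod X v = FObj U a"
      by (rule EM_homE) simp
    show ?thesis
      using j(4,5) v unfolding iu jv EM_simps by (intro L.source.isoI[of u v]) simp_all
  qed
  moreover have "u \<cdot>\<^bsub>X\<^esub> FArr U (\<epsilon>' a) = h \<cdot>\<^bsub>X\<^esub> FArr U (FArr L' u)"
  proof -
    \<comment> \<open>The desired equation holds after precomposition with the image of \<theta>,
      which is cancelled by means of this right inverse.\<close>
    obtain \<theta>' where t: "\<theta>' \<in> Arr A" "Dom A \<theta>' = FObj L' (FObj U a)" "Cod A \<theta>' = FObj L (FObj U a)"
      "\<theta> (FObj U a) \<cdot>\<^bsub>A\<^esub> \<theta>' = Ide A (FObj L' (FObj U a))"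
      by (rule theta_inverse[of "FObj U a"]) simp
    have "u \<cdot>\<^bsub>X\<^esub> FArr U (\<epsilon>' a \<cdot>\<^bsub>A\<^esub> \<theta> (FObj U a)) = h \<cdot>\<^bsub>X\<^esub> FArr U (\<theta> x \<cdot>\<^bsub>A\<^esub> FArr L u)"
      using uk by (simp add: theta_counit k_def U.ftor_comp)
    also have "\<theta> x \<cdot>\<^bsub>A\<^esub> FArr L u = FArr L' u \<cdot>\<^bsub>A\<^esub> \<theta> (FObj U a)" using theta_nat[of u] by simp
    finally have "(u \<cdot>\<^bsub>X\<^esub> FArr U (\<epsilon>' a)) \<cdot>\<^bsub>X\<^esub> FArr U (\<theta> (FObj U a)) = (h \<cdot>\<^bsub>X\<^esub> FArr U (FArr L' u)) \<cdot>\<^bsub>X\<^esub> FArr U (\<theta> (FObj U a))"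
      by (simp add: U.ftor_comp)
    hence "(u \<cdot>\<^bsub>X\<^esub> FArr U (\<epsilon>' a)) \<cdot>\<^bsub>X\<^esub> (FArr U (\<theta> (FObj U a)) \<cdot>\<^bsub>X\<^esub> FArr U \<theta>') =
      (h \<cdot>\<^bsub>X\<^esub> FArr U (FArr L' u)) \<cdot>\<^bsub>X\<^esub> (FArr U (\<theta> (FObj U a)) \<cdot>\<^bsub>X\<^esub> FArr U \<theta>')"
      by (rule L.source.comp_eq_extend) (simp_all add: t)
    moreover have "FArr U (\<theta> (FObj U a)) \<cdot>\<^bsub>X\<^esub> FArr U \<theta>' = Ide X (FObj U (FObj L' (FObj U a)))"
      using t by (simp flip: U.ftor_comp)
    ultimately show ?thesis by simp
  qed
  ultimately show ?thesis using that a u by blast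
qed

end

context adjn
begin

text \<open>The inverse of an algebra map that is invertible in the base category is again an
  algebra map.\<close>

lemma EM_isoI:
  assumes u: "(a, u, b) \<in> hom EM a b" and iso: "is_iso X u"
  shows "is_iso EM (a, u, b)"
proof -
  interpret EM: category EM by (rule category_EM)
  have al: "algebra a" "algebra b" and [simp]: "u \<in> Arr X" "Dom X u = fst a" "Cod X u = fst b"
    and ub: "u \<cdot>\<^bsub>X\<^esub> snd a = snd b \<cdot>\<^bsub>X\<^esub> FArr U (FArr L u)"
    using EM_homE[OF u] by blast+
  note [simp] = algebraD(1-4)[OF al(1)] algebraD(1-4)[OF al(2)]
  obtain v where v [simp]: "v \<in> Arr X" "Dom X v = fst b" "Cod X v = fst a"
    and vu: "v \<cdot>\<^bsub>X\<^esub> u = Ide X (fst a)" and uv: "u \<cdot>\<^bsub>X\<^esub> v = Ide X (fst b)"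
    using L.source.isoE[OF iso] by simp metis
  have "v \<cdot>\<^bsub>X\<^esub> snd b = v \<cdot>\<^bsub>X\<^esub> (snd b \<cdot>\<^bsub>X\<^esub> FArr U (FArr L (u \<cdot>\<^bsub>X\<^esub> v)))"
    by (simp add: uv)
  also have "\<dots> = v \<cdot>\<^bsub>X\<^esub> (u \<cdot>\<^bsub>X\<^esub> (snd a \<cdot>\<^bsub>X\<^esub> FArr U (FArr L v)))"
    by (simp add: L.ftor_comp U.ftor_comp L.source.comp_eq_extend[OF ub])
  also have "\<dots> = snd a \<cdot>\<^bsub>X\<^esub> FArr U (FArr L v)"
    by (subst L.source.comp_eq_extend1[OF vu]) simp_all
  finally have "(b, v, a) \<in> hom EM b a"
    by (intro EM_homI) (simp_all add: al)
  with u show ?thesis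
    by (intro EM.isoI[of _ "(b, v, a)"]) (simp_all only: hom_iff EM_simps(3-6) vu uv)
qed

text \<open>Such a \<open>U\<close> is the forgetful functor of algebras after an equivalence, and
  both reflect isomorphisms.\<close>

lemma reflects_iso:
  assumes eq: "is_equivalence A EM K" and f [simp]: "f \<in> Arr A" and iso: "is_iso X (FArr U f)"
  shows "is_iso A f"
proof (rule equivalence_reflects_iso[OF eq f])
  interpret K: cat_functor A EM K by (rule functor_K)
  have "FArr K f \<in> hom EM (FObj K (Dom A f)) (FObj K (Cod A f))"
    by (rule K.FArr_in_hom) (simp add: hom_iff)
  thus "is_iso EM (FArr K f)" unfolding K_simps by (intro EM_isoI iso)
qed

end

section \<open>Slices and the change of base adjunction\<close>

context category
begin

lemma slice_simps:
  "Obj (slice C B) = {f \<in> Arr C. Cod C f = B}"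
  "Arr (slice C B) = {(f, u, g). f \<in> Arr C \<and> Cod C f = B \<and> g \<in> Arr C \<and> Cod C g = B \<and>
     u \<in> hom C (Dom C f) (Dom C g) \<and> g \<cdot> u = f}"
  "Dom (slice C B) (f, u, g) = f" "Cod (slice C B) (f, u, g) = g"
  "Ide (slice C B) f = (f, Ide C (Dom C f), f)"
  "Comp (slice C B) (g', v, h) (f, u, g) = (f, v \<cdot> u, h)"
  by (auto simp: slice_def)

lemma slice_homI:
  assumes "f \<in> Arr C" "g \<in> Arr C" "Cod C f = B" "Cod C g = B" "u \<in> Arr C" "Dom C u = Dom C f" "Cod C u = Dom C g" "g \<cdot> u = f"
  shows "(f, u, g) \<in> hom (slice C B) f g"
  using assms unfolding hom_iff slice_simps by simp

lemma slice_homE: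
  assumes "w \<in> hom (slice C B) f g"
  obtains u where "w = (f, u, g)" "f \<in> Arr C" "g \<in> Arr C" "Cod C f = B" "Cod C g = B" "u \<in> Arr C"
    "Dom C u = Dom C f" "Cod C u = Dom C g" "g \<cdot> u = f"
proof -
  obtain a u b where w: "w = (a, u, b)" by (cases w) auto
  from assms have 1: "w \<in> Arr (slice C B)" "Dom (slice C B) w = f" "Cod (slice C B) w = g" by (simp_all only: hom_iff)
  have "w = (f, u, g)" using 1(2,3) by (simp only: w slice_simps)
  moreover from 1(1) have "f \<in> Arr C \<and> Cod C f = B \<and> g \<in> Arr C \<and> Cod C g = B \<and>
     u \<in> hom C (Dom C f) (Dom C g) \<and> g \<cdot> u = f"
    by (simp only: calculation slice_simps mem_Collect_eq prod.case)
  ultimately show ?thesis using that[of u] by (simp only: hom_iff)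
qed

lemma slice_arrE:
  assumes "w \<in> Arr (slice C B)"
  obtains f u g where "w = (f, u, g)" "f \<in> Arr C" "g \<in> Arr C" "Cod C f = B" "Cod C g = B" "u \<in> Arr C"
    "Dom C u = Dom C f" "Cod C u = Dom C g" "g \<cdot> u = f"
  using assms slice_homE[of w B "Dom (slice C B) w" "Cod (slice C B) w"] unfolding hom_iff by metis

lemma category_slice: "category (slice C B)"
proof
  fix f assume "f \<in> Arr (slice C B)"
  thus "Dom (slice C B) f \<in> Obj (slice C B)" "Cod (slice C B) f \<in> Obj (slice C B)"
    by (auto elim!: slice_arrE simp: slice_simps)
next
  fix a assume "a \<in> Obj (slice C B)"
  thus "Ide (slice C B) a \<in> hom (slice C B) a a"
    unfolding slice_simps by (intro slice_homI) simp_all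
next
  fix f a b g d assume "f \<in> hom (slice C B) a b" "g \<in> hom (slice C B) b d"
  then obtain u v where uv: "f = (a, u, b)" "g = (b, v, d)" "a \<in> Arr C" "b \<in> Arr C" "d \<in> Arr C"
    "Cod C a = B" "Cod C b = B" "Cod C d = B" "u \<in> Arr C" "Dom C u = Dom C a" "Cod C u = Dom C b" "b \<cdot> u = a"
    "v \<in> Arr C" "Dom C v = Dom C b" "Cod C v = Dom C d" "d \<cdot> v = b"
    by (elim slice_homE) blast
  thus "g \<cdot>\<^bsub>slice C B\<^esub> f \<in> hom (slice C B) a d"
    unfolding uv(1,2) slice_simps by (intro slice_homI) (simp_all add: comp_eq_extend1[OF uv(16)])
next
  fix f a b assume "f \<in> hom (slice C B) a b"
  then obtain u where "f = (a, u, b)" "u \<in> Arr C" "Dom C u = Dom C a" "Cod C u = Dom C b" by (rule slice_homE)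
  thus "f \<cdot>\<^bsub>slice C B\<^esub> Ide (slice C B) a = f" "Ide (slice C B) b \<cdot>\<^bsub>slice C B\<^esub> f = f"
    by (simp_all add: slice_simps)
next
  fix f a b g d h e assume "f \<in> hom (slice C B) a b" "g \<in> hom (slice C B) b d" "h \<in> hom (slice C B) d e"
  thus "(h \<cdot>\<^bsub>slice C B\<^esub> g) \<cdot>\<^bsub>slice C B\<^esub> f = h \<cdot>\<^bsub>slice C B\<^esub> (g \<cdot>\<^bsub>slice C B\<^esub> f)"
    by (elim slice_homE) (simp add: slice_simps)
qed

lemma slice_isoI:
  assumes u: "(f, u, g) \<in> hom (slice C B) f g" and iso: "is_iso C u"
  shows "is_iso (slice C B) (f, u, g)"
proof -
  interpret S: category "slice C B" by (rule category_slice)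
  have [simp]: "f \<in> Arr C" "g \<in> Arr C" "Cod C f = B" "Cod C g = B" "u \<in> Arr C"
    "Dom C u = Dom C f" "Cod C u = Dom C g" and gu: "g \<cdot> u = f"
    using slice_homE[OF u] by blast+
  obtain v where v [simp]: "v \<in> Arr C" "Dom C v = Dom C g" "Cod C v = Dom C f"
    and vu: "v \<cdot> u = Ide C (Dom C f)" and uv: "u \<cdot> v = Ide C (Dom C g)"
    using isoE[OF iso] by simp metis
  have "f \<cdot> v = g" by (subst comp_eq_extend1[OF gu, symmetric]) (simp_all add: uv)
  hence "(g, v, f) \<in> hom (slice C B) g f" by (intro slice_homI) simp_all
  with u show ?thesis
    by (intro S.isoI[of _ "(g, v, f)"]) (simp_all only: hom_iff slice_simps(3-6) vu uv)
qed

lemma slice_isoD: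
  assumes iso: "is_iso (slice C B) (f, u, g)" shows "is_iso C u"
proof -
  interpret S: category "slice C B" by (rule category_slice)
  obtain j where j: "(f, u, g) \<in> Arr (slice C B)" "j \<in> Arr (slice C B)" "Dom (slice C B) j = g" "Cod (slice C B) j = f"
    "j \<cdot>\<^bsub>slice C B\<^esub> (f, u, g) = Ide (slice C B) f" "(f, u, g) \<cdot>\<^bsub>slice C B\<^esub> j = Ide (slice C B) g"
    using S.isoE[OF iso] unfolding slice_simps(3,4) by blast
  have "j \<in> hom (slice C B) g f" using j by (simp only: hom_iff)
  then obtain v where v: "j = (g, v, f)" "v \<in> Arr C" "Dom C v = Dom C g" "Cod C v = Dom C f" by (rule slice_homE)
  have "u \<in> Arr C" "Dom C u = Dom C f" "Cod C u = Dom C g" using j(1) unfolding slice_simps by (simp_all add: hom_iff)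
  thus ?thesis using j(5,6) v by (intro isoI[of u v]) (simp_all add: slice_simps)
qed

lemma pb_iso:
  assumes pb: "is_pullback C p q f g" and w: "is_iso C w" "Cod C w = Dom C q"
  shows "is_pullback C (p \<cdot> w) (q \<cdot> w) f g"
proof -
  note [simp] = pbD(1-8)[OF pb] w(2)
  obtain v where [simp]: "w \<in> Arr C" "v \<in> Arr C" "Dom C v = Dom C q" "Cod C v = Dom C w"
    and vw: "v \<cdot> w = Ide C (Dom C w)" and wv: "w \<cdot> v = Ide C (Dom C q)"
    using isoE[OF w(1)] unfolding w(2) .
  have wvx: "w \<cdot> (v \<cdot> x) = x" if "x \<in> Arr C" "Cod C x = Dom C q" for x
    using that by (simp add: comp_eq_extend1[OF wv])
  have vwx: "v \<cdot> (w \<cdot> x) = x" if "x \<in> Arr C" "Cod C x = Dom C w" for x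
    using that by (simp add: comp_eq_extend1[OF vw])
  show ?thesis
  proof (rule pbI)
    fix x y assume "x \<in> Arr C" "y \<in> Arr C" "Dom C x = Dom C y" "Cod C x = Dom C f" "Cod C y = Dom C g" "f \<cdot> x = g \<cdot> y"
    thus "\<exists>u. u \<in> Arr C \<and> Dom C u = Dom C y \<and> Cod C u = Dom C (q \<cdot> w) \<and> (p \<cdot> w) \<cdot> u = x \<and> (q \<cdot> w) \<cdot> u = y"
      by (intro exI[of _ "v \<cdot> pair p q x y"]) (simp add: pair[OF pb] wvx)
  next
    fix u u' assume u: "u \<in> Arr C" "u' \<in> Arr C" "Dom C u = Dom C u'" "Cod C u = Dom C (q \<cdot> w)" "Cod C u' = Dom C (q \<cdot> w)"
      "(p \<cdot> w) \<cdot> u = (p \<cdot> w) \<cdot> u'" "(q \<cdot> w) \<cdot> u = (q \<cdot> w) \<cdot> u'"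
    have "w \<cdot> u = w \<cdot> u'" by (rule pb_ext[OF pb]) (use u in simp_all)
    hence "v \<cdot> (w \<cdot> u) = v \<cdot> (w \<cdot> u')" by simp
    thus "u = u'" using u by (simp add: vwx)
  qed (simp_all add: pb_comm[OF pb])
qed

end

locale change_of_base = regcat C for C :: "('o, 'm) cat" (structure) +
  fixes p :: 'm and c :: "'m \<Rightarrow> 'm \<times> 'm"
  assumes p_arr [simp]: "p \<in> Arr C" and choice: "pullback_choice C p c"
begin

abbreviation "\<pi> a \<equiv> fst (c a)"
abbreviation "\<rho> a \<equiv> snd (c a)"
abbreviation "tup a \<equiv> pair (\<pi> a) (\<rho> a)"
abbreviation "SB \<equiv> slice C (Cod C p)"
abbreviation "SE \<equiv> slice C (Dom C p)"
abbreviation "U \<equiv> pullback_ftor C c"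

definition "umap u a b = tup b (u \<cdot> \<pi> a) (\<rho> a)"
text \<open>The standard left adjoint of pullback along \<open>p\<close>: composition with
  \<open>p\<close>. Its unit sends an element \<open>x\<close> to the pair of \<open>x\<close> and
  \<open>\<xi> \<cdot> x\<close>, and its counit is the first projection.\<close>

definition "L = \<lparr>FObj = (\<lambda>\<xi>. p \<cdot> \<xi>), FArr = (\<lambda>(\<xi>, u, \<zeta>). (p \<cdot> \<xi>, u, p \<cdot> \<zeta>))\<rparr>"
definition "unit \<xi> = (\<xi>, tup (p \<cdot> \<xi>) (Ide C (Dom C \<xi>)) \<xi>, \<rho> (p \<cdot> \<xi>))"
definition "counit a = (p \<cdot> \<rho> a, \<pi> a, a)"

lemma pb:
  assumes "a \<in> Arr C" "Cod C a = Cod C p" shows "is_pullback C (\<pi> a) (\<rho> a) a p"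
  using choice assms by (simp add: pullback_choice_def)

lemma proj [simp]:
  assumes "a \<in> Arr C" "Cod C a = Cod C p"
  shows "\<pi> a \<in> Arr C" "\<rho> a \<in> Arr C" "Dom C (\<pi> a) = Dom C (\<rho> a)" "Cod C (\<pi> a) = Dom C a"
    "Cod C (\<rho> a) = Dom C p" 
  using pbD[OF pb[OF assms]] by auto

lemma proj_comm:
  assumes "a \<in> Arr C" "Cod C a = Cod C p" shows "a \<cdot> \<pi> a = p \<cdot> \<rho> a"
  using pbD[OF pb[OF assms]] by auto

lemma proj_comm':
  assumes "a \<in> Arr C" "Cod C a = Cod C p" "x \<in> Arr C" "Cod C x = Dom C (\<rho> a)"
  shows "a \<cdot> (\<pi> a \<cdot> x) = p \<cdot> (\<rho> a \<cdot> x)"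
  by (rule pb_comm[OF pb]) (simp_all add: assms)

lemma tup:
  assumes "a \<in> Arr C" "Cod C a = Cod C p" "x \<in> Arr C" "e \<in> Arr C" "Dom C x = Dom C e"
    "Cod C x = Dom C a" "Cod C e = Dom C p" "a \<cdot> x = p \<cdot> e"
  shows "tup a x e \<in> Arr C" "Dom C (tup a x e) = Dom C e" "Cod C (tup a x e) = Dom C (\<rho> a)"
    "\<pi> a \<cdot> tup a x e = x" "\<rho> a \<cdot> tup a x e = e"
  using pair[OF pb[OF assms(1,2)] assms(3-8)] assms by simp_all

lemma tup_comp:
  assumes "a \<in> Arr C" "Cod C a = Cod C p" "x \<in> Arr C" "e \<in> Arr C" "Dom C x = Dom C e"
    "Cod C x = Dom C a" "Cod C e = Dom C p" "a \<cdot> x = p \<cdot> e" "t \<in> Arr C" "Cod C t = Dom C e"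
  shows "\<pi> a \<cdot> (tup a x e \<cdot> t) = x \<cdot> t" "\<rho> a \<cdot> (tup a x e \<cdot> t) = e \<cdot> t"
  using tup[OF assms(1-8)] assms by (simp_all add: comp_eq_extend1)

lemma ext:
  assumes "a \<in> Arr C" "Cod C a = Cod C p" "u \<in> Arr C" "v \<in> Arr C" "Dom C u = Dom C v"
    "Cod C u = Dom C (\<rho> a)" "Cod C v = Dom C (\<rho> a)" "\<pi> a \<cdot> u = \<pi> a \<cdot> v" "\<rho> a \<cdot> u = \<rho> a \<cdot> v"
  shows "u = v"
  by (rule pb_ext[OF pb[OF assms(1,2)]]) (use assms in auto)

lemma umap:
  assumes "a \<in> Arr C" "Cod C a = Cod C p" "b \<in> Arr C" "Cod C b = Cod C p" "u \<in> Arr C" "Dom C u = Dom C a"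
    "Cod C u = Dom C b" "b \<cdot> u = a"
  shows "umap u a b \<in> Arr C" "Dom C (umap u a b) = Dom C (\<rho> a)" "Cod C (umap u a b) = Dom C (\<rho> b)"
    "\<pi> b \<cdot> umap u a b = u \<cdot> \<pi> a" "\<rho> b \<cdot> umap u a b = \<rho> a"
proof -
  have "b \<cdot> (u \<cdot> \<pi> a) = p \<cdot> \<rho> a" using assms by (simp add: comp_eq_extend1[OF assms(8)] proj_comm)
  note * = tup[OF assms(3,4) _ _ _ _ _ this]
  show "umap u a b \<in> Arr C" "Dom C (umap u a b) = Dom C (\<rho> a)" "Cod C (umap u a b) = Dom C (\<rho> b)"
    "\<pi> b \<cdot> umap u a b = u \<cdot> \<pi> a" "\<rho> b \<cdot> umap u a b = \<rho> a"
    using assms by (simp_all add: * umap_def)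
qed

lemma umap_comp:
  assumes "a \<in> Arr C" "Cod C a = Cod C p" "b \<in> Arr C" "Cod C b = Cod C p" "u \<in> Arr C" "Dom C u = Dom C a"
    "Cod C u = Dom C b" "b \<cdot> u = a" "t \<in> Arr C" "Cod C t = Dom C (\<rho> a)"
  shows "\<pi> b \<cdot> (umap u a b \<cdot> t) = u \<cdot> (\<pi> a \<cdot> t)" "\<rho> b \<cdot> (umap u a b \<cdot> t) = \<rho> a \<cdot> t"
  using umap[OF assms(1-8)] assms comp_eq_extend1[OF umap(5)[OF assms(1-8)], of t]
    comp_eq_extend[OF umap(4)[OF assms(1-8)], of t] by simp_all

lemma U_simps:
  "FObj U a = \<rho> a"
  "(a, u, b) \<in> Arr SB \<Longrightarrow> FArr U (a, u, b) = (\<rho> a, umap u a b, \<rho> b)"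
  by (auto simp: pullback_ftor_def pair_def umap_def slice_simps hom_iff)

lemma L_simps: "FObj L \<xi> = p \<cdot> \<xi>" "FArr L (\<xi>, u, \<zeta>) = (p \<cdot> \<xi>, u, p \<cdot> \<zeta>)"
  by (auto simp: L_def)

lemma functor_U: "cat_functor SB SE U"
proof (intro_locales)
  show "category SB" "category SE" by (rule category_slice)+
  show "cat_functor_axioms SB SE U"
  proof
    fix a assume a: "a \<in> Obj SB"
    thus "FObj U a \<in> Obj SE" by (simp add: U_simps slice_simps)
    have [simp]: "a \<in> Arr C" "Cod C a = Cod C p" using a by (auto simp: slice_simps)
    have "umap (Ide C (Dom C a)) a a = Ide C (Dom C (\<rho> a))"
      by (rule ext[of a]) (simp_all add: umap)
    thus "FArr U (Ide SB a) = Ide SE (FObj U a)"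
      using a by (simp add: slice_simps U_simps hom_iff)
  next
    fix f a b assume f: "f \<in> hom SB a b"
    then obtain u where u: "f = (a, u, b)" "a \<in> Arr C" "b \<in> Arr C" "Cod C a = Cod C p" "Cod C b = Cod C p" "u \<in> Arr C"
      "Dom C u = Dom C a" "Cod C u = Dom C b" "b \<cdot> u = a" by (rule slice_homE)
    have "(a, u, b) \<in> Arr SB" using f u(1) by (simp add: hom_iff)
    hence "FArr U f = (\<rho> a, umap u a b, \<rho> b)" by (simp add: u(1) U_simps)
    thus "FArr U f \<in> hom SE (FObj U a) (FObj U b)"
      unfolding U_simps(1) using u by (simp, intro slice_homI) (simp_all add: umap)
  next
    fix f a b g d assume f: "f \<in> hom SB a b" and g: "g \<in> hom SB b d"
    obtain u where u: "f = (a, u, b)" and [simp]: "a \<in> Arr C" "b \<in> Arr C" "Cod C a = Cod C p" "Cod C b = Cod C p" "u \<in> Arr C"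
      "Dom C u = Dom C a" "Cod C u = Dom C b" and bu: "b \<cdot> u = a" using f by (rule slice_homE)
    obtain v where v: "g = (b, v, d)" and [simp]: "d \<in> Arr C" "Cod C d = Cod C p" "v \<in> Arr C"
      "Dom C v = Dom C b" "Cod C v = Dom C d" and dv: "d \<cdot> v = b" using g by (rule slice_homE)
    have dvu: "d \<cdot> (v \<cdot> u) = a" by (simp add: comp_eq_extend1[OF dv] bu)
    have "umap (v \<cdot> u) a d = umap v b d \<cdot> umap u a b"
      by (rule ext[of d]) (simp_all add: umap umap_comp bu dv dvu)
    moreover have "(a, u, b) \<in> Arr SB" "(b, v, d) \<in> Arr SB" "(a, v \<cdot> u, d) \<in> Arr SB"
      using slice_homI[of a b _ u] slice_homI[of b d _ v] slice_homI[of a d _ "v \<cdot> u"] bu dv dvu by (simp_all add: hom_iff)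
    ultimately show "FArr U (g \<cdot>\<^bsub>SB\<^esub> f) = FArr U g \<cdot>\<^bsub>SE\<^esub> FArr U f"
      by (simp add: u v slice_simps(3-6) U_simps)
  qed
qed

lemma functor_L: "cat_functor SE SB L"
proof (intro_locales)
  show "category SB" "category SE" by (rule category_slice)+
  show "cat_functor_axioms SE SB L"
  proof
    fix a assume "a \<in> Obj SE"
    thus "FObj L a \<in> Obj SB" "FArr L (Ide SE a) = Ide SB (FObj L a)" by (simp_all add: L_simps slice_simps)
  next
    fix f a b assume f: "f \<in> hom SE a b"
    then obtain u where u: "f = (a, u, b)" "a \<in> Arr C" "b \<in> Arr C" "Cod C a = Dom C p" "Cod C b = Dom C p" "u \<in> Arr C"
      "Dom C u = Dom C a" "Cod C u = Dom C b" "b \<cdot> u = a" by (rule slice_homE)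
    thus "FArr L f \<in> hom SB (FObj L a) (FObj L b)"
      unfolding u(1) L_simps by (intro slice_homI) simp_all
  next
    fix f a b g d assume f: "f \<in> hom SE a b" and g: "g \<in> hom SE b d"
    thus "FArr L (g \<cdot>\<^bsub>SE\<^esub> f) = FArr L g \<cdot>\<^bsub>SB\<^esub> FArr L f"
      by (elim slice_homE) (simp add: slice_simps L_simps)
  qed
qed

lemma adjunction_LU: "adjunction SE SB L U unit counit"
proof -
  have unit_hom: "unit \<xi> \<in> hom SE \<xi> (\<rho> (p \<cdot> \<xi>))" if "\<xi> \<in> Obj SE" for \<xi>
    using that unfolding unit_def by (intro slice_homI) (simp_all add: slice_simps tup)
  have counit_hom: "counit a \<in> hom SB (p \<cdot> \<rho> a) a" if "a \<in> Obj SB" for a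
    using that unfolding counit_def by (intro slice_homI) (simp_all add: slice_simps proj_comm)
  show ?thesis unfolding adjunction_def
  proof (intro conjI ballI functor_L functor_U)
    show "nat_trans SE SE id_ftor (comp_ftor U L) unit" unfolding nat_trans_def
    proof (intro conjI ballI)
      fix \<xi> assume "\<xi> \<in> Obj SE"
      thus "unit \<xi> \<in> hom SE (FObj id_ftor \<xi>) (FObj (comp_ftor U L) \<xi>)"
        using unit_hom by (simp add: U_simps L_simps)
    next
      fix f assume "f \<in> Arr SE"
      then obtain a u b where u: "f = (a, u, b)" and [simp]: "a \<in> Arr C" "b \<in> Arr C" "Cod C a = Dom C p" "Cod C b = Dom C p" "u \<in> Arr C"
        "Dom C u = Dom C a" "Cod C u = Dom C b" and bu: "b \<cdot> u = a" by (rule slice_arrE)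
      have "(p \<cdot> a, u, p \<cdot> b) \<in> Arr SB"
        using slice_homI[of "p \<cdot> a" "p \<cdot> b" "Cod C p" u] by (simp add: hom_iff bu)
      moreover have "tup (p \<cdot> b) (Ide C (Dom C b)) b \<cdot> u = umap u (p \<cdot> a) (p \<cdot> b) \<cdot> tup (p \<cdot> a) (Ide C (Dom C a)) a"
        by (rule ext[of "p \<cdot> b"]) (simp_all add: tup tup_comp umap umap_comp bu)
      ultimately show "unit (Cod SE f) \<cdot>\<^bsub>SE\<^esub> FArr id_ftor f = FArr (comp_ftor U L) f \<cdot>\<^bsub>SE\<^esub> unit (Dom SE f)"
        by (simp add: u unit_def slice_simps(3-6) U_simps L_simps)
    qed
    show "nat_trans SB SB (comp_ftor L U) id_ftor counit" unfolding nat_trans_def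
    proof (intro conjI ballI)
      fix a assume "a \<in> Obj SB"
      thus "counit a \<in> hom SB (FObj (comp_ftor L U) a) (FObj id_ftor a)"
        using counit_hom by (simp add: U_simps L_simps)
    next
      fix f assume f: "f \<in> Arr SB"
      then obtain a u b where u: "f = (a, u, b)" and [simp]: "a \<in> Arr C" "b \<in> Arr C" "Cod C a = Cod C p" "Cod C b = Cod C p" "u \<in> Arr C"
        "Dom C u = Dom C a" "Cod C u = Dom C b" and bu: "b \<cdot> u = a" by (rule slice_arrE)
      show "counit (Cod SB f) \<cdot>\<^bsub>SB\<^esub> FArr (comp_ftor L U) f = FArr id_ftor f \<cdot>\<^bsub>SB\<^esub> counit (Dom SB f)"
        using f by (simp add: u counit_def slice_simps(3-6) U_simps L_simps umap bu)
    qed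
  next
    fix \<xi> assume "\<xi> \<in> Obj SE"
    thus "counit (FObj L \<xi>) \<cdot>\<^bsub>SB\<^esub> FArr L (unit \<xi>) = Ide SB (FObj L \<xi>)"
      by (simp add: counit_def unit_def L_simps slice_simps tup)
  next
    fix a assume a: "a \<in> Obj SB"
    hence [simp]: "a \<in> Arr C" "Cod C a = Cod C p" by (auto simp: slice_simps)
    have "(p \<cdot> \<rho> a, \<pi> a, a) \<in> Arr SB" using counit_hom[OF a] by (simp add: counit_def hom_iff)
    moreover have "umap (\<pi> a) (p \<cdot> \<rho> a) a \<cdot> tup (p \<cdot> \<rho> a) (Ide C (Dom C (\<rho> a))) (\<rho> a) = Ide C (Dom C (\<rho> a))"
      by (rule ext[of a]) (simp_all add: umap umap_comp tup proj_comm)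
    ultimately show "FArr U (counit a) \<cdot>\<^bsub>SE\<^esub> unit (FObj U a) = Ide SE (FObj U a)"
      by (simp add: counit_def unit_def slice_simps(3-6) U_simps)
  qed
qed

end

section \<open>Algebras for the change of base monad as descent data\<close>

context change_of_base
begin

interpretation adjn SE SB L U unit counit
  by unfold_locales (rule adjunction_LU)

text \<open>An algebra stripped to the arrow of \<open>C\<close> underlying its structure map. The
  domain of \<open>k\<close> classifies the pairs of \<open>x\<close> and \<open>e\<close> with
  \<open>p \<cdot> (\<xi> \<cdot> x) = p \<cdot> e\<close>, so \<open>k\<close> is a universal
  transport; the last two equations are the unit and associativity laws.\<close>

definition is_alg :: "'m \<Rightarrow> 'm \<Rightarrow> bool" where
  "is_alg \<xi> k \<longleftrightarrow> \<xi> \<in> Arr C \<and> Cod C \<xi> = Dom C p \<and> k \<in> Arr C \<and> Dom C k = Dom C (\<rho> (p \<cdot> \<xi>)) \<and> Cod C k = Dom C \<xi> \<and>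
     \<xi> \<cdot> k = \<rho> (p \<cdot> \<xi>) \<and> k \<cdot> tup (p \<cdot> \<xi>) (Ide C (Dom C \<xi>)) \<xi> = Ide C (Dom C \<xi>) \<and>
     k \<cdot> umap (\<pi> (p \<cdot> \<xi>)) (p \<cdot> \<rho> (p \<cdot> \<xi>)) (p \<cdot> \<xi>) = k \<cdot> umap k (p \<cdot> \<rho> (p \<cdot> \<xi>)) (p \<cdot> \<xi>)"

lemma algebra_iff:
  "algebra (\<xi>, h) \<longleftrightarrow> (\<exists>k. h = (\<rho> (p \<cdot> \<xi>), k, \<xi>) \<and> is_alg \<xi> k)"
proof -
  have *: "algebra (\<xi>, (\<rho> (p \<cdot> \<xi>), k, \<xi>)) \<longleftrightarrow> is_alg \<xi> k"
    if k: "(\<rho> (p \<cdot> \<xi>), k, \<xi>) \<in> hom SE (\<rho> (p \<cdot> \<xi>)) \<xi>" for k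
  proof -
    have [simp]: "\<xi> \<in> Arr C" "Cod C \<xi> = Dom C p" "k \<in> Arr C" "Dom C k = Dom C (\<rho> (p \<cdot> \<xi>))" "Cod C k = Dom C \<xi>"
      and xk: "\<xi> \<cdot> k = \<rho> (p \<cdot> \<xi>)"
      using slice_homE[OF k] by blast+
    have o: "\<xi> \<in> Obj SE" by (simp add: slice_simps)
    have "counit (p \<cdot> \<xi>) \<in> Arr SB" by (rule counit_typ) (simp add: slice_simps)
    hence 1: "FArr U (counit (p \<cdot> \<xi>)) = (\<rho> (p \<cdot> \<rho> (p \<cdot> \<xi>)), umap (\<pi> (p \<cdot> \<xi>)) (p \<cdot> \<rho> (p \<cdot> \<xi>)) (p \<cdot> \<xi>), \<rho> (p \<cdot> \<xi>))"
      unfolding counit_def by (rule U_simps)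
    have "FArr L (\<rho> (p \<cdot> \<xi>), k, \<xi>) \<in> Arr SB" using k L.ftor_simps(1) by (simp only: hom_iff)
    hence 2: "FArr U (FArr L (\<rho> (p \<cdot> \<xi>), k, \<xi>)) = (\<rho> (p \<cdot> \<rho> (p \<cdot> \<xi>)), umap k (p \<cdot> \<rho> (p \<cdot> \<xi>)) (p \<cdot> \<xi>), \<rho> (p \<cdot> \<xi>))"
      unfolding L_simps by (rule U_simps)
    have 3: "(\<rho> (p \<cdot> \<xi>), k, \<xi>) \<in> Arr SE" using k by (simp add: hom_iff)
    show ?thesis
      unfolding algebra_def prod.case L_simps(1) U_simps(1) 1 2 slice_simps(3-6) unit_def is_alg_def
      using 3 o xk by simp
  qed
  show ?thesis
  proof
    assume a: "algebra (\<xi>, h)"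
    hence "h \<in> hom SE (\<rho> (p \<cdot> \<xi>)) \<xi>"
      using algebraD[OF a] by (simp add: hom_iff L_simps U_simps)
    then obtain k where "h = (\<rho> (p \<cdot> \<xi>), k, \<xi>)" by (rule slice_homE)
    thus "\<exists>k. h = (\<rho> (p \<cdot> \<xi>), k, \<xi>) \<and> is_alg \<xi> k"
      using * a \<open>h \<in> _\<close> by blast
  next
    assume "\<exists>k. h = (\<rho> (p \<cdot> \<xi>), k, \<xi>) \<and> is_alg \<xi> k"
    then obtain k where k: "h = (\<rho> (p \<cdot> \<xi>), k, \<xi>)" "is_alg \<xi> k" by blast
    have "(\<rho> (p \<cdot> \<xi>), k, \<xi>) \<in> hom SE (\<rho> (p \<cdot> \<xi>)) \<xi>"
      using k(2) unfolding is_alg_def by (intro slice_homI) simp_all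
    thus "algebra (\<xi>, h)" using * k by blast
  qed
qed

text \<open>The action is evaluation of \<open>k\<close> on the pair of \<open>x\<close> and
  \<open>e\<close>; naturality is automatic, and each algebra law becomes the law of the same
  name.\<close>

lemma alg_descent_datum:
  assumes alg: "is_alg \<xi> k"
  shows "descent_datum p \<xi> (\<lambda>x e. k \<cdot> tup (p \<cdot> \<xi>) x e)"
proof -
  have [simp]: "\<xi> \<in> Arr C" "Cod C \<xi> = Dom C p" "k \<in> Arr C" "Dom C k = Dom C (\<rho> (p \<cdot> \<xi>))" "Cod C k = Dom C \<xi>"
    and xk: "\<xi> \<cdot> k = \<rho> (p \<cdot> \<xi>)" and un: "k \<cdot> tup (p \<cdot> \<xi>) (Ide C (Dom C \<xi>)) \<xi> = Ide C (Dom C \<xi>)"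
    and as: "k \<cdot> umap (\<pi> (p \<cdot> \<xi>)) (p \<cdot> \<rho> (p \<cdot> \<xi>)) (p \<cdot> \<xi>) = k \<cdot> umap k (p \<cdot> \<rho> (p \<cdot> \<xi>)) (p \<cdot> \<xi>)"
    using alg by (auto simp: is_alg_def)
  have cD: "x \<in> Arr C" "e \<in> Arr C" "Dom C x = Dom C e" "Cod C x = Dom C \<xi>" "Cod C e = Dom C p" "p \<cdot> (\<xi> \<cdot> x) = p \<cdot> e"
    if "compat p \<xi> x e" for x e using that by (auto simp: compat_def)
  have T: "tup (p \<cdot> \<xi>) x e \<in> Arr C" "Dom C (tup (p \<cdot> \<xi>) x e) = Dom C e" "Cod C (tup (p \<cdot> \<xi>) x e) = Dom C (\<rho> (p \<cdot> \<xi>))"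
    "\<pi> (p \<cdot> \<xi>) \<cdot> tup (p \<cdot> \<xi>) x e = x" "\<rho> (p \<cdot> \<xi>) \<cdot> tup (p \<cdot> \<xi>) x e = e"
    if "compat p \<xi> x e" for x e using cD[OF that] by (simp_all add: tup)
  show ?thesis
  proof (rule descent_datumI)
    fix x e assume c: "compat p \<xi> x e"
    show "k \<cdot> tup (p \<cdot> \<xi>) x e \<in> Arr C \<and> Dom C (k \<cdot> tup (p \<cdot> \<xi>) x e) = Dom C e \<and>
      Cod C (k \<cdot> tup (p \<cdot> \<xi>) x e) = Dom C \<xi> \<and> \<xi> \<cdot> (k \<cdot> tup (p \<cdot> \<xi>) x e) = e"
      using comp_eq_extend1[OF xk, of "tup (p \<cdot> \<xi>) x e"] by (simp add: T[OF c])
    fix t assume t: "t \<in> Arr C" "Cod C t = Dom C e"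
    have e: "p \<cdot> (\<xi> \<cdot> (x \<cdot> t)) = p \<cdot> (e \<cdot> t)"
    proof -
      have "p \<cdot> ((\<xi> \<cdot> x) \<cdot> t) = p \<cdot> (e \<cdot> t)" by (rule comp_eq_extend[OF cD(6)[OF c]]) (simp_all add: cD(1-5)[OF c] t)
      thus ?thesis by (simp add: cD(1-5)[OF c] t)
    qed
    have "tup (p \<cdot> \<xi>) (x \<cdot> t) (e \<cdot> t) = tup (p \<cdot> \<xi>) x e \<cdot> t"
      by (rule ext[of "p \<cdot> \<xi>"]) (simp_all add: tup tup_comp e cD[OF c] t)
    thus "k \<cdot> tup (p \<cdot> \<xi>) (x \<cdot> t) (e \<cdot> t) = (k \<cdot> tup (p \<cdot> \<xi>) x e) \<cdot> t"
      by (simp add: T[OF c] t)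
  next
    fix x assume x: "x \<in> Arr C" "Cod C x = Dom C \<xi>"
    have "tup (p \<cdot> \<xi>) x (\<xi> \<cdot> x) = tup (p \<cdot> \<xi>) (Ide C (Dom C \<xi>)) \<xi> \<cdot> x"
      by (rule ext[of "p \<cdot> \<xi>"]) (simp_all add: tup tup_comp x)
    thus "k \<cdot> tup (p \<cdot> \<xi>) x (\<xi> \<cdot> x) = x" by (simp add: comp_eq_extend1[OF un] x tup)
  next
    fix x e e' assume c: "compat p \<xi> x e" and c': "compat p \<xi> x e'"
    note cs [simp] = cD(1-5)[OF c] cD(2,5)[OF c'] 
    have [simp]: "Dom C e' = Dom C e" using cD(3)[OF c] cD(3)[OF c'] by simp
    have ee: "p \<cdot> e = p \<cdot> e'" using cD(6)[OF c] cD(6)[OF c'] by simp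
    have xke: "\<xi> \<cdot> (k \<cdot> tup (p \<cdot> \<xi>) x e) = e" by (simp add: comp_eq_extend1[OF xk] T[OF c])
    \<comment> \<open>The element of the iterated pullback with coordinates \<open>x\<close>,
      \<open>e\<close> and \<open>e'\<close>. The associativity law of \<open>k\<close>, evaluated
      at it, compares transport in two steps with direct transport.\<close>
    define y where "y = tup (p \<cdot> \<rho> (p \<cdot> \<xi>)) (tup (p \<cdot> \<xi>) x e) e'"
    have y: "y \<in> Arr C" "Dom C y = Dom C e" "Cod C y = Dom C (\<rho> (p \<cdot> \<rho> (p \<cdot> \<xi>)))"
      "\<pi> (p \<cdot> \<rho> (p \<cdot> \<xi>)) \<cdot> y = tup (p \<cdot> \<xi>) x e" "\<rho> (p \<cdot> \<rho> (p \<cdot> \<xi>)) \<cdot> y = e'"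
      unfolding y_def by (simp_all add: tup T[OF c] ee)
    have pp: "p \<cdot> (\<xi> \<cdot> \<pi> (p \<cdot> \<xi>)) = p \<cdot> \<rho> (p \<cdot> \<xi>)" using proj_comm[of "p \<cdot> \<xi>"] by simp
    have 1: "tup (p \<cdot> \<xi>) (k \<cdot> tup (p \<cdot> \<xi>) x e) e' = umap k (p \<cdot> \<rho> (p \<cdot> \<xi>)) (p \<cdot> \<xi>) \<cdot> y"
      by (rule ext[of "p \<cdot> \<xi>"]) (simp_all add: tup T[OF c] umap umap_comp y xk xke ee)
    have 2: "tup (p \<cdot> \<xi>) x e' = umap (\<pi> (p \<cdot> \<xi>)) (p \<cdot> \<rho> (p \<cdot> \<xi>)) (p \<cdot> \<xi>) \<cdot> y"
      by (rule ext[of "p \<cdot> \<xi>"]) (simp_all add: T[OF c] T[OF c'] umap umap_comp y pp)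
    show "k \<cdot> tup (p \<cdot> \<xi>) (k \<cdot> tup (p \<cdot> \<xi>) x e) e' = k \<cdot> tup (p \<cdot> \<xi>) x e'"
      unfolding 1 2 by (rule comp_eq_extend[OF as[symmetric]]) (simp_all add: umap y pp xk)
  qed simp_all
qed

text \<open>The Yoneda lemma in the other direction: \<open>k\<close> is the action on the universal
  compatible pair formed by the two projections, and naturality recovers \<open>act\<close> from
  it.\<close>

lemma descent_datum_alg:
  assumes dd: "descent_datum p \<xi> act"
  defines "k \<equiv> act (\<pi> (p \<cdot> \<xi>)) (\<rho> (p \<cdot> \<xi>))"
  shows "is_alg \<xi> k" "compat p \<xi> x e \<Longrightarrow> k \<cdot> tup (p \<cdot> \<xi>) x e = act x e"
proof -
  note act = descent_datumD[OF dd]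
  note [simp] = act(2,3)
  have pp: "p \<cdot> (\<xi> \<cdot> \<pi> (p \<cdot> \<xi>)) = p \<cdot> \<rho> (p \<cdot> \<xi>)" using proj_comm[of "p \<cdot> \<xi>"] by simp
  have pp': "p \<cdot> (\<xi> \<cdot> (\<pi> (p \<cdot> \<xi>) \<cdot> t)) = p \<cdot> (\<rho> (p \<cdot> \<xi>) \<cdot> t)" if "t \<in> Arr C" "Cod C t = Dom C (\<rho> (p \<cdot> \<xi>))" for t
    using proj_comm'[of "p \<cdot> \<xi>" t] that by simp
  have c: "compat p \<xi> (\<pi> (p \<cdot> \<xi>)) (\<rho> (p \<cdot> \<xi>))" by (simp add: compat_def pp)
  have k [simp]: "k \<in> Arr C" "Dom C k = Dom C (\<rho> (p \<cdot> \<xi>))" "Cod C k = Dom C \<xi>" and xk: "\<xi> \<cdot> k = \<rho> (p \<cdot> \<xi>)"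
    unfolding k_def by (simp_all add: act c)
  have kt: "k \<cdot> t = act (\<pi> (p \<cdot> \<xi>) \<cdot> t) (\<rho> (p \<cdot> \<xi>) \<cdot> t)" if "t \<in> Arr C" "Cod C t = Dom C (\<rho> (p \<cdot> \<xi>))" for t
    unfolding k_def by (rule act(8)[symmetric]) (simp_all add: c that)
  show *: "k \<cdot> tup (p \<cdot> \<xi>) x e = act x e" if "compat p \<xi> x e" for x e
    using that unfolding compat_def by (simp add: kt tup)
  let ?r = "p \<cdot> \<rho> (p \<cdot> \<xi>)"
  have "compat p \<xi> (\<pi> (p \<cdot> \<xi>) \<cdot> \<pi> ?r) (\<rho> (p \<cdot> \<xi>) \<cdot> \<pi> ?r)" by (simp add: compat_def pp')
  moreover have "compat p \<xi> (\<pi> (p \<cdot> \<xi>) \<cdot> \<pi> ?r) (\<rho> ?r)" using proj_comm[of ?r] by (simp add: compat_def pp')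
  ultimately have "act (k \<cdot> \<pi> ?r) (\<rho> ?r) = act (\<pi> (p \<cdot> \<xi>) \<cdot> \<pi> ?r) (\<rho> ?r)"
    using act(10) by (simp add: kt)
  hence "k \<cdot> umap (\<pi> (p \<cdot> \<xi>)) ?r (p \<cdot> \<xi>) = k \<cdot> umap k ?r (p \<cdot> \<xi>)"
    by (simp add: kt umap pp xk)
  moreover have "k \<cdot> tup (p \<cdot> \<xi>) (Ide C (Dom C \<xi>)) \<xi> = Ide C (Dom C \<xi>)"
    using act(9)[of "Ide C (Dom C \<xi>)"] by (simp add: kt tup)
  ultimately show "is_alg \<xi> k" by (simp add: is_alg_def xk)
qed

lemma monadic_effdesc:
  assumes "monadic SB SE U" shows "effdesc p"
proof -
  obtain L0 \<eta>0 \<epsilon>0 where adj0: "adjunction SE SB L0 U \<eta>0 \<epsilon>0"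
    and eq: "is_equivalence SB (em_cat SE (comp_ftor U L0) \<eta>0 (\<lambda>x. FArr U (\<epsilon>0 (FObj L0 x)))) (comparison_ftor SB U \<epsilon>0)"
    using assms unfolding monadic_def by blast
  interpret A: two_adjn SE SB L0 U \<eta>0 \<epsilon>0 L unit counit
    by unfold_locales (rule adj0)
  show ?thesis unfolding effdesc_def
  proof (intro conjI allI impI)
    \<comment> \<open>Regularity of \<open>p\<close> is tested on its image \<open>m\<close>, viewed
      as an arrow from \<open>m\<close> to the identity in the slice: its pullback along
      \<open>p\<close> turns out invertible, so \<open>m\<close> is invertible by reflection of
      isomorphisms.\<close>
    obtain e m where e: "regular_epi C e" "monic m" and [simp]: "e \<in> Arr C" "m \<in> Arr C" "Dom C m = Cod C e" and me: "m \<cdot> e = p"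
      using image_factorisation[OF p_arr] by metis
    have [simp]: "Cod C m = Cod C p" "Dom C e = Dom C p" using me by auto
    let ?B = "Cod C p" and ?one = "Ide C (Cod C p)"
    have hom: "(m, m, ?one) \<in> hom SB m ?one" by (rule slice_homI) simp_all
    hence arr: "(m, m, ?one) \<in> Arr SB" by (simp add: hom_iff)
    define w where "w = umap m m ?one"
    have w [simp]: "w \<in> Arr C" "Dom C w = Dom C (\<rho> m)" "Cod C w = Dom C (\<rho> ?one)" and pw: "\<pi> ?one \<cdot> w = m \<cdot> \<pi> m" and rw: "\<rho> ?one \<cdot> w = \<rho> m"
      unfolding w_def by (simp_all add: umap)
    \<comment> \<open>Since \<open>p\<close> factors through \<open>m\<close> by \<open>e\<close>,
      the pulled-back monomorphism has this section.\<close>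
    define v where "v = tup m (e \<cdot> \<rho> ?one) (\<rho> ?one)"
    have v [simp]: "v \<in> Arr C" "Dom C v = Dom C (\<rho> ?one)" "Cod C v = Dom C (\<rho> m)" and pv: "\<pi> m \<cdot> v = e \<cdot> \<rho> ?one" and rv: "\<rho> m \<cdot> v = \<rho> ?one"
      unfolding v_def by (simp_all add: tup comp_eq_extend1[OF me])
    have wv: "w \<cdot> v = Ide C (Dom C (\<rho> ?one))"
    proof (rule ext[of ?one])
      have "\<pi> ?one \<cdot> (w \<cdot> v) = m \<cdot> (\<pi> m \<cdot> v)" by (rule comp_eq_extend[OF pw]) simp_all
      also have "\<dots> = p \<cdot> \<rho> ?one" unfolding pv by (rule comp_eq_extend1[OF me]) simp_all
      also have "\<dots> = ?one \<cdot> \<pi> ?one" by (rule proj_comm[symmetric]) simp_all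
      finally show "\<pi> ?one \<cdot> (w \<cdot> v) = \<pi> ?one \<cdot> Ide C (Dom C (\<rho> ?one))" by simp
    qed (simp_all add: comp_eq_extend1[OF rw] rv)
    have vw: "v \<cdot> w = Ide C (Dom C (\<rho> m))"
    proof (rule ext[of m])
      have "\<pi> m \<cdot> (v \<cdot> w) = e \<cdot> \<rho> m" by (subst comp_eq_extend[OF pv]) (simp_all add: rw)
      also have "e \<cdot> \<rho> m = \<pi> m"
        by (rule monicD[OF e(2)]) (simp_all add: comp_eq_extend1[OF me] proj_comm)
      finally show "\<pi> m \<cdot> (v \<cdot> w) = \<pi> m \<cdot> Ide C (Dom C (\<rho> m))" by simp
    qed (simp_all add: comp_eq_extend1[OF rv] rw)
    have "is_iso C w" by (rule isoI[of _ v]) (simp_all add: wv vw)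
    moreover have Uw: "FArr U (m, m, ?one) = (\<rho> m, w, \<rho> ?one)" unfolding w_def using arr by (rule U_simps)
    moreover have "(\<rho> m, w, \<rho> ?one) \<in> hom SE (\<rho> m) (\<rho> ?one)" by (rule slice_homI) (simp_all add: rw)
    ultimately have "is_iso SE (FArr U (m, m, ?one))" using slice_isoI by simp
    hence "is_iso SB (m, m, ?one)" by (rule A.reflects_iso[OF eq arr])
    hence "is_iso C m" by (rule slice_isoD)
    thus "regular_epi C p" using iso_regular_epi[of m e] e me by simp
  next
    fix \<xi> act assume dd: "descent_datum p \<xi> act"
    have [simp]: "\<xi> \<in> Arr C" "Cod C \<xi> = Dom C p" using descent_datumD[OF dd] by auto
    define k where "k = act (\<pi> (p \<cdot> \<xi>)) (\<rho> (p \<cdot> \<xi>))"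
    have alg: "is_alg \<xi> k" and k_act: "\<And>x e. compat p \<xi> x e \<Longrightarrow> k \<cdot> tup (p \<cdot> \<xi>) x e = act x e"
      unfolding k_def using descent_datum_alg[OF dd] by auto
    have [simp]: "k \<in> Arr C" "Dom C k = Dom C (\<rho> (p \<cdot> \<xi>))" "Cod C k = Dom C \<xi>" using alg by (auto simp: is_alg_def)
    \<comment> \<open>The datum is an algebra for the monad of the standard adjoint;
      \<open>algebra_transfer\<close> produces an object \<open>a\<close> over the codomain of
      \<open>p\<close> whose pullback is isomorphic to it.\<close>
    have "algebra (\<xi>, (\<rho> (p \<cdot> \<xi>), k, \<xi>))" using alg by (simp add: algebra_iff)
    then obtain a u where a: "a \<in> Obj SB" and u: "is_iso SE u" "u \<in> Arr SE" "Dom SE u = FObj U a" "Cod SE u = \<xi>"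
      and ua: "u \<cdot>\<^bsub>SE\<^esub> FArr U (counit a) = (\<rho> (p \<cdot> \<xi>), k, \<xi>) \<cdot>\<^bsub>SE\<^esub> FArr U (FArr L u)"
      by (rule A.algebra_transfer[OF eq])
    have [simp]: "a \<in> Arr C" "Cod C a = Cod C p" using a by (auto simp: slice_simps)
    have uh: "u \<in> hom SE (\<rho> a) \<xi>" using u by (simp add: hom_iff U_simps)
    then obtain v where v: "u = (\<rho> a, v, \<xi>)" and [simp]: "v \<in> Arr C" "Dom C v = Dom C (\<rho> a)" "Cod C v = Dom C \<xi>"
      and xv: "\<xi> \<cdot> v = \<rho> a" by (rule slice_homE)
    have iso: "is_iso C v" using u(1) unfolding v by (rule slice_isoD)
    have "counit a \<in> Arr SB" using a by simp
    hence 1: "FArr U (counit a) = (\<rho> (p \<cdot> \<rho> a), umap (\<pi> a) (p \<cdot> \<rho> a) a, \<rho> a)"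
      unfolding counit_def by (rule U_simps)
    have "FArr L u \<in> Arr SB" using u by simp
    hence 2: "FArr U (FArr L u) = (\<rho> (p \<cdot> \<rho> a), umap v (p \<cdot> \<rho> a) (p \<cdot> \<xi>), \<rho> (p \<cdot> \<xi>))"
      unfolding v L_simps by (rule U_simps)
    have vk: "v \<cdot> umap (\<pi> a) (p \<cdot> \<rho> a) a = k \<cdot> umap v (p \<cdot> \<rho> a) (p \<cdot> \<xi>)"
      using ua unfolding 1 2 unfolding v slice_simps(6) by simp
    obtain w where w [simp]: "w \<in> Arr C" "Dom C w = Dom C \<xi>" "Cod C w = Dom C (\<rho> a)"
      and wv: "w \<cdot> v = Ide C (Dom C (\<rho> a))" and vw: "v \<cdot> w = Ide C (Dom C \<xi>)" and iw: "is_iso C w"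
      using isoE[OF iso] by simp metis
    \<comment> \<open>Transported along the isomorphism \<open>w\<close>, the chosen pullback of
      \<open>a\<close> gets \<xi> itself as second projection, and its first projection becomes the
      invariant map.\<close>
    have "is_pullback C (\<pi> a \<cdot> w) (\<rho> a \<cdot> w) a p" by (rule pb_iso[OF pb iw]) simp_all
    moreover have "\<rho> a \<cdot> w = \<xi>" by (subst comp_eq_extend1[OF xv, symmetric]) (simp_all add: vw)
    moreover have "(\<pi> a \<cdot> w) \<cdot> act x e = (\<pi> a \<cdot> w) \<cdot> x" if c: "compat p \<xi> x e" for x e
    proof -
      have [simp]: "x \<in> Arr C" "e \<in> Arr C" "Dom C x = Dom C e" "Cod C x = Dom C \<xi>" "Cod C e = Dom C p" and xe: "p \<cdot> (\<xi> \<cdot> x) = p \<cdot> e"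
        using c by (auto simp: compat_def)
      define y where "y = w \<cdot> x"
      have y [simp]: "y \<in> Arr C" "Dom C y = Dom C e" "Cod C y = Dom C (\<rho> a)" and vy: "v \<cdot> y = x"
        unfolding y_def by (simp_all add: comp_eq_extend1[OF vw])
      have ry: "\<rho> a \<cdot> y = \<xi> \<cdot> x" using comp_eq_extend1[OF xv, of y] by (simp add: vy)
      define z where "z = tup (p \<cdot> \<rho> a) y e"
      have z [simp]: "z \<in> Arr C" "Dom C z = Dom C e" "Cod C z = Dom C (\<rho> (p \<cdot> \<rho> a))" "\<pi> (p \<cdot> \<rho> a) \<cdot> z = y" "\<rho> (p \<cdot> \<rho> a) \<cdot> z = e"
        unfolding z_def by (simp_all add: tup ry xe)
      have "tup (p \<cdot> \<xi>) x e = umap v (p \<cdot> \<rho> a) (p \<cdot> \<xi>) \<cdot> z"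
        by (rule ext[of "p \<cdot> \<xi>"]) (simp_all add: tup umap umap_comp xv vy xe)
      hence "act x e = k \<cdot> (umap v (p \<cdot> \<rho> a) (p \<cdot> \<xi>) \<cdot> z)" using k_act[OF c] by simp
      also have "\<dots> = v \<cdot> (umap (\<pi> a) (p \<cdot> \<rho> a) a \<cdot> z)"
        by (rule comp_eq_extend[OF vk[symmetric]]) (simp_all add: umap xv proj_comm)
      finally have "w \<cdot> act x e = umap (\<pi> a) (p \<cdot> \<rho> a) a \<cdot> z"
        by (simp add: comp_eq_extend1[OF wv] umap proj_comm)
      thus ?thesis using descent_datumD(4-6)[OF dd c] by (simp add: umap_comp proj_comm flip: y_def)
    qed
    ultimately show "effective_datum p \<xi> act" unfolding effective_datum_def by metis
  qed
qed

text \<open>Here the standard left adjoint can be used. The projections \<open>\<pi> a\<close> are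
  pullbacks of \<open>p\<close>, hence regular epimorphisms: that makes the comparison functor
  faithful and lets algebra maps descend, while effectiveness of descent data gives essential
  surjectivity.\<close>

lemma effdesc_monadic:
  assumes p: "effdesc p" shows "monadic SB SE U"
proof -
  have rp: "regular_epi C p" using p by (simp add: effdesc_def)
  have r\<pi>: "regular_epi C (\<pi> a)" if "a \<in> Arr C" "Cod C a = Cod C p" for a
    using regular_epi_pb[OF pb_swap[OF pb[OF that]] rp] .
  have "is_equivalence SB EM K"
  proof (rule equivalenceI[OF functor_K])
    fix x y g assume x: "x \<in> Obj SB" and y: "y \<in> Obj SB" and g: "g \<in> Arr EM" "Dom EM g = FObj K x" "Cod EM g = FObj K y"
    have [simp]: "x \<in> Arr C" "Cod C x = Cod C p" "y \<in> Arr C" "Cod C y = Cod C p" using x y by (auto simp: slice_simps)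
    have "g \<in> hom EM (FObj K x) (FObj K y)" using g by (simp only: hom_iff)
    then obtain u where gu: "g = (FObj K x, u, FObj K y)" and u: "u \<in> Arr SE" "Dom SE u = \<rho> x" "Cod SE u = \<rho> y"
      and uc: "u \<cdot>\<^bsub>SE\<^esub> FArr U (counit x) = FArr U (counit y) \<cdot>\<^bsub>SE\<^esub> FArr U (FArr L u)"
      by (rule EM_homE) (simp add: U_simps)
    have "u \<in> hom SE (\<rho> x) (\<rho> y)" using u by (simp only: hom_iff)
    then obtain w where w: "u = (\<rho> x, w, \<rho> y)" and [simp]: "w \<in> Arr C" "Dom C w = Dom C (\<rho> x)" "Cod C w = Dom C (\<rho> y)" and rw: "\<rho> y \<cdot> w = \<rho> x"
      by (rule slice_homE)
    have rwt: "\<rho> y \<cdot> (w \<cdot> t) = \<rho> x \<cdot> t" if "t \<in> Arr C" "Cod C t = Dom C (\<rho> x)" for t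
      by (rule comp_eq_extend1[OF rw]) (simp_all add: that)
    have c: "FArr U (counit a) = (\<rho> (p \<cdot> \<rho> a), umap (\<pi> a) (p \<cdot> \<rho> a) a, \<rho> a)" if "a \<in> Obj SB" for a
      using counit_typ(1)[OF that] unfolding counit_def by (rule U_simps)
    have "FArr L u \<in> Arr SB" using u by simp
    hence 2: "FArr U (FArr L u) = (\<rho> (p \<cdot> \<rho> x), umap w (p \<cdot> \<rho> x) (p \<cdot> \<rho> y), \<rho> (p \<cdot> \<rho> y))"
      unfolding w L_simps by (rule U_simps)
    have wc: "w \<cdot> umap (\<pi> x) (p \<cdot> \<rho> x) x = umap (\<pi> y) (p \<cdot> \<rho> y) y \<cdot> umap w (p \<cdot> \<rho> x) (p \<cdot> \<rho> y)"
      using uc unfolding 2 c[OF x] c[OF y] unfolding w slice_simps(6) by simp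
    \<comment> \<open>Fullness: an algebra map \<open>w\<close> between pullbacks comes from an
      arrow below as soon as its first coordinate is constant on the fibres of
      \<open>\<pi> x\<close>.\<close>
    obtain f where f [simp]: "f \<in> Arr C" "Dom C f = Dom C x" "Cod C f = Dom C y" and f\<pi>: "f \<cdot> \<pi> x = \<pi> y \<cdot> w"
    proof (rule regular_epi_descend[OF r\<pi>[of x], of "\<pi> y \<cdot> w"])
      fix s t assume s [simp]: "s \<in> Arr C" "t \<in> Arr C" "Dom C s = Dom C t" "Cod C s = Dom C (\<pi> x)" "Cod C t = Dom C (\<pi> x)"
        and st: "\<pi> x \<cdot> s = \<pi> x \<cdot> t"
      have pst: "p \<cdot> (\<rho> x \<cdot> s) = p \<cdot> (\<rho> x \<cdot> t)" using st by (simp flip: proj_comm')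
      \<comment> \<open>If \<open>s\<close> and \<open>t\<close> have the same first coordinate,
        then \<open>t\<close> is the transport of \<open>s\<close> to the second coordinate of
        \<open>t\<close>. An algebra map commutes with transport, and transport preserves first
        coordinates.\<close>
      define z where "z = tup (p \<cdot> \<rho> x) s (\<rho> x \<cdot> t)"
      have z [simp]: "z \<in> Arr C" "Dom C z = Dom C t" "Cod C z = Dom C (\<rho> (p \<cdot> \<rho> x))" "\<pi> (p \<cdot> \<rho> x) \<cdot> z = s" "\<rho> (p \<cdot> \<rho> x) \<cdot> z = \<rho> x \<cdot> t"
        unfolding z_def by (simp_all add: tup pst)
      have "umap (\<pi> x) (p \<cdot> \<rho> x) x \<cdot> z = t"
        by (rule ext[of x]) (simp_all add: umap umap_comp proj_comm st)
      hence "w \<cdot> t = w \<cdot> (umap (\<pi> x) (p \<cdot> \<rho> x) x \<cdot> z)" by simp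
      also have "\<dots> = umap (\<pi> y) (p \<cdot> \<rho> y) y \<cdot> (umap w (p \<cdot> \<rho> x) (p \<cdot> \<rho> y) \<cdot> z)"
        by (rule comp_eq_extend[OF wc]) (simp_all add: umap proj_comm rw)
      finally have "\<pi> y \<cdot> (w \<cdot> t) = \<pi> y \<cdot> (w \<cdot> s)"
        by (simp add: umap umap_comp proj_comm rw)
      thus "(\<pi> y \<cdot> w) \<cdot> s = (\<pi> y \<cdot> w) \<cdot> t" by simp
    qed simp_all
    have yf: "y \<cdot> f = x"
      by (rule epicD[OF regular_epi_epic[OF r\<pi>[of x]]]) (simp_all add: f\<pi> proj_comm' proj_comm rw)
    have fh: "(x, f, y) \<in> hom SB x y" by (rule slice_homI) (simp_all add: yf)
    hence fa: "(x, f, y) \<in> Arr SB" by (simp add: hom_iff)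
    have "umap f x y = w"
      by (rule ext[of y]) (simp_all add: umap yf f\<pi> rw)
    hence "FArr U (x, f, y) = u" using U_simps(2)[OF fa] by (simp add: w)
    hence "FArr K (x, f, y) = g" unfolding gu by (simp add: slice_simps(3,4))
    thus "\<exists>f. f \<in> Arr SB \<and> Dom SB f = x \<and> Cod SB f = y \<and> FArr K f = g"
      using fa by (intro exI[of _ "(x, f, y)"]) (simp add: slice_simps(3,4))
  next
    fix f g assume f: "f \<in> Arr SB" and g: "g \<in> Arr SB" and d: "Dom SB f = Dom SB g" "Cod SB f = Cod SB g" and K: "FArr K f = FArr K g"
    obtain x u y where u: "f = (x, u, y)" and [simp]: "x \<in> Arr C" "y \<in> Arr C" "Cod C x = Cod C p" "Cod C y = Cod C p" "u \<in> Arr C"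
      "Dom C u = Dom C x" "Cod C u = Dom C y" and yu: "y \<cdot> u = x" using f by (rule slice_arrE)
    obtain v where v: "g = (x, v, y)" and [simp]: "v \<in> Arr C"
      "Dom C v = Dom C x" "Cod C v = Dom C y" and yv: "y \<cdot> v = x"
      using g d unfolding u slice_simps(3,4) by (elim slice_arrE) (simp add: slice_simps(3,4))
    have "umap u x y = umap v x y"
      using K U_simps(2)[OF f[unfolded u]] U_simps(2)[OF g[unfolded v]] by (simp add: u v)
    hence "\<pi> y \<cdot> umap u x y = \<pi> y \<cdot> umap v x y" by simp
    hence "u \<cdot> \<pi> x = v \<cdot> \<pi> x" by (simp add: umap yu yv)
    hence "u = v" by - (rule epicD[OF regular_epi_epic[OF r\<pi>[of x]]]; simp)
    thus "f = g" by (simp add: u v)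
  next
    fix b assume b: "b \<in> Obj EM"
    obtain \<xi> h where bh: "b = (\<xi>, h)" by (cases b)
    have alg_b: "algebra (\<xi>, h)" using b by (simp add: bh EM_simps)
    then obtain k where h: "h = (\<rho> (p \<cdot> \<xi>), k, \<xi>)" and alg: "is_alg \<xi> k" by (auto simp: algebra_iff)
    have [simp]: "\<xi> \<in> Arr C" "Cod C \<xi> = Dom C p" "k \<in> Arr C" "Dom C k = Dom C (\<rho> (p \<cdot> \<xi>))" "Cod C k = Dom C \<xi>"
      and xk: "\<xi> \<cdot> k = \<rho> (p \<cdot> \<xi>)" using alg by (auto simp: is_alg_def)
    obtain q z where qz: "is_pullback C q \<xi> z p" and inv: "\<And>x e. compat p \<xi> x e \<Longrightarrow> q \<cdot> (k \<cdot> tup (p \<cdot> \<xi>) x e) = q \<cdot> x"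
      using p alg_descent_datum[OF alg] unfolding effdesc_def effective_datum_def by blast
    have [simp]: "q \<in> Arr C" "z \<in> Arr C" "Dom C q = Dom C \<xi>" "Cod C q = Dom C z" "Cod C z = Cod C p" and zq: "z \<cdot> q = p \<cdot> \<xi>"
      using pbD[OF qz] by auto
    have z: "z \<in> Obj SB" by (simp add: slice_simps)
    define v where "v = pair q \<xi> (\<pi> z) (\<rho> z)"
    have v [simp]: "v \<in> Arr C" "Dom C v = Dom C (\<rho> z)" "Cod C v = Dom C \<xi>" and qv: "q \<cdot> v = \<pi> z" and xv: "\<xi> \<cdot> v = \<rho> z"
      unfolding v_def using proj_comm[of z] by (simp_all add: pair[OF qz])
    define w where "w = tup z q \<xi>"
    have w [simp]: "w \<in> Arr C" "Dom C w = Dom C \<xi>" "Cod C w = Dom C (\<rho> z)" and pw: "\<pi> z \<cdot> w = q" and rw: "\<rho> z \<cdot> w = \<xi>"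
      unfolding w_def by (simp_all add: tup zq)
    have "w \<cdot> v = Ide C (Dom C (\<rho> z))"
      by (rule ext[of z]) (simp_all add: comp_eq_extend1[OF pw] comp_eq_extend1[OF rw] qv xv)
    moreover have "v \<cdot> w = Ide C (Dom C \<xi>)"
      by (rule pb_ext[OF qz]) (simp_all add: comp_eq_extend1[OF qv] comp_eq_extend1[OF xv] pw rw)
    ultimately have iv: "is_iso C v" by (intro isoI[of v w]) simp_all
    have vh: "(\<rho> z, v, \<xi>) \<in> hom SE (\<rho> z) \<xi>" by (rule slice_homI) (simp_all add: xv)
    hence va: "(\<rho> z, v, \<xi>) \<in> Arr SE" by (simp add: hom_iff)
    have vi: "is_iso SE (\<rho> z, v, \<xi>)" by (rule slice_isoI[OF vh iv])
    let ?r = "p \<cdot> \<rho> z"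
    \<comment> \<open>The isomorphism \<open>v\<close> respects the structure maps: the coordinate
      along \<xi> agrees by typing alone, the other one by the invariance of \<open>q\<close> under
      the action.\<close>
    have vk: "v \<cdot> umap (\<pi> z) ?r z = k \<cdot> umap v ?r (p \<cdot> \<xi>)"
    proof (rule pb_ext[OF qz])
      have "\<xi> \<cdot> (v \<cdot> umap (\<pi> z) ?r z) = \<rho> ?r"
        by (simp add: comp_eq_extend1[OF xv] umap proj_comm)
      moreover have "\<xi> \<cdot> (k \<cdot> umap v ?r (p \<cdot> \<xi>)) = \<rho> ?r"
        by (simp add: comp_eq_extend1[OF xk] umap xv)
      ultimately show "\<xi> \<cdot> (v \<cdot> umap (\<pi> z) ?r z) = \<xi> \<cdot> (k \<cdot> umap v ?r (p \<cdot> \<xi>))" by simp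
      have "q \<cdot> (v \<cdot> umap (\<pi> z) ?r z) = \<pi> z \<cdot> \<pi> ?r"
        by (simp add: comp_eq_extend1[OF qv] umap proj_comm)
      moreover have "compat p \<xi> (v \<cdot> \<pi> ?r) (\<rho> ?r)"
        using proj_comm[of ?r] by (simp add: compat_def comp_eq_extend1[OF xv])
      from inv[OF this] have "q \<cdot> (k \<cdot> umap v ?r (p \<cdot> \<xi>)) = \<pi> z \<cdot> \<pi> ?r"
        by (simp add: umap_def comp_eq_extend1[OF qv])
      ultimately show "q \<cdot> (v \<cdot> umap (\<pi> z) ?r z) = q \<cdot> (k \<cdot> umap v ?r (p \<cdot> \<xi>))" by simp
    qed (simp_all add: umap xv proj_comm)
    have 1: "FArr U (counit z) = (\<rho> ?r, umap (\<pi> z) ?r z, \<rho> z)"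
      using counit_typ(1)[OF z] unfolding counit_def by (rule U_simps)
    have "FArr L (\<rho> z, v, \<xi>) \<in> Arr SB" using va by simp
    hence 2: "FArr U (FArr L (\<rho> z, v, \<xi>)) = (\<rho> ?r, umap v ?r (p \<cdot> \<xi>), \<rho> (p \<cdot> \<xi>))"
      unfolding L_simps by (rule U_simps)
    have eh: "(FObj K z, (\<rho> z, v, \<xi>), b) \<in> hom EM (FObj K z) b"
    proof (rule EM_homI)
      show "algebra (FObj K z)" unfolding K_simps by (rule algebra_counit[OF z])
      show "algebra b" using alg_b by (simp add: bh)
      show "(\<rho> z, v, \<xi>) \<cdot>\<^bsub>SE\<^esub> snd (FObj K z) = snd b \<cdot>\<^bsub>SE\<^esub> FArr U (FArr L (\<rho> z, v, \<xi>))"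
        unfolding 2 K_simps snd_conv 1 bh h slice_simps(6) by (simp add: vk)
    qed (simp_all add: va bh U_simps slice_simps(3,4))
    have "is_iso EM (FObj K z, (\<rho> z, v, \<xi>), b)" by (rule EM_isoI[OF eh vi])
    thus "\<exists>a i. a \<in> Obj SB \<and> is_iso EM i \<and> Dom EM i = FObj K a \<and> Cod EM i = b"
      using z by (intro exI[of _ z] exI[of _ "(FObj K z, (\<rho> z, v, \<xi>), b)"]) (simp only: EM_simps simp_thms)
  qed
  thus ?thesis unfolding monadic_def using adjunction_LU by blast
qed

end

text \<open>The bridge between the definition by monads and descent of generalised elements;
  monadicity is not unfolded after this point.\<close>

theorem (in regcat) effective_descent_iff:
  "effective_descent C p \<longleftrightarrow> effdesc p"
proof
  assume "effective_descent C p"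
  then obtain c where p: "p \<in> Arr C" and c: "pullback_choice C p c"
    and m: "monadic (slice C (Cod C p)) (slice C (Dom C p)) (pullback_ftor C c)"
    unfolding effective_descent_def by blast
  interpret change_of_base C p c by unfold_locales (rule p c)+
  show "effdesc p" by (rule monadic_effdesc[OF m])
next
  assume e: "effdesc p"
  hence p: "p \<in> Arr C" by (auto simp: effdesc_def regular_epi_arr)
  have "\<forall>f. \<exists>c. f \<in> Arr C \<and> Cod C f = Cod C p \<longrightarrow> is_pullback C (fst c) (snd c) f p"
    using pb_exists[OF _ p] by (metis fst_conv snd_conv)
  then obtain c where c: "pullback_choice C p c" unfolding pullback_choice_def by metis
  interpret change_of_base C p c by unfold_locales (rule p c)+
  show "effective_descent C p" unfolding effective_descent_def
    using p c effdesc_monadic[OF e] by blast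
qed

section \<open>Homological categories\<close>

lemma (in category) monic_cancel:
  assumes m: "monic (m \<cdot> n)" and [simp]: "m \<in> Arr C" "n \<in> Arr C" "Cod C n = Dom C m"
  shows "monic n"
  unfolding monic_def
proof (intro conjI ballI impI)
  fix u v assume u: "u \<in> Arr C" "v \<in> Arr C" "Dom C u = Dom C v" "Cod C u = Dom C n" "Cod C v = Dom C n" "n \<cdot> u = n \<cdot> v"
  show "u = v" by (rule monicD[OF m]) (use u in simp_all)
qed simp

lemma (in category) monic_comp:
  assumes m: "monic m" and n: "monic n" and [simp]: "Cod C n = Dom C m"
  shows "monic (m \<cdot> n)"
  unfolding monic_def
proof (intro conjI ballI impI)
  have [simp]: "m \<in> Arr C" "n \<in> Arr C" using m n by (auto simp: monic_def)
  show "m \<cdot> n \<in> Arr C" by simp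
  fix u v assume u: "u \<in> Arr C" "v \<in> Arr C" "Dom C u = Dom C v" "Cod C u = Dom C (m \<cdot> n)" "Cod C v = Dom C (m \<cdot> n)"
    "(m \<cdot> n) \<cdot> u = (m \<cdot> n) \<cdot> v"
  have "n \<cdot> u = n \<cdot> v" by (rule monicD[OF m]) (use u in simp_all)
  thus "u = v" using u by - (rule monicD[OF n]; simp)
qed

locale homcat = regcat C for C :: "('o, 'm) cat" (structure) +
  assumes homological: "homological C"
begin

definition Z :: 'o where "Z = (SOME Z. zero_obj C Z)"

lemma zero_obj_Z: "zero_obj C Z"
  using homological someI_ex unfolding Z_def homological_def pointed_protomodular_def pointed_def by metis

lemma Z_obj [simp]: "Z \<in> Obj C" using zero_obj_Z by (simp add: zero_obj_def)

definition to_Z :: "'o \<Rightarrow> 'm" where "to_Z A = (THE f. f \<in> hom C A Z)"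
definition from_Z :: "'o \<Rightarrow> 'm" where "from_Z A = (THE f. f \<in> hom C Z A)"
text \<open>A normal form for zero morphisms, through one fixed zero object, by which
  \<open>zero_mor\<close> becomes an equation usable for rewriting.\<close>

definition zero_arr :: "'o \<Rightarrow> 'o \<Rightarrow> 'm" where "zero_arr A B = from_Z B \<cdot> to_Z A"

lemma to_Z [simp]:
  assumes "A \<in> Obj C" shows "to_Z A \<in> Arr C" "Dom C (to_Z A) = A" "Cod C (to_Z A) = Z"
proof -
  have "\<exists>!f. f \<in> hom C A Z" using zero_obj_Z assms by (simp add: zero_obj_def)
  from theI'[OF this] show "to_Z A \<in> Arr C" "Dom C (to_Z A) = A" "Cod C (to_Z A) = Z"
    by (simp_all add: to_Z_def hom_iff)
qed

lemma from_Z [simp]: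
  assumes "A \<in> Obj C" shows "from_Z A \<in> Arr C" "Dom C (from_Z A) = Z" "Cod C (from_Z A) = A"
proof -
  have "\<exists>!f. f \<in> hom C Z A" using zero_obj_Z assms by (simp add: zero_obj_def)
  from theI'[OF this] show "from_Z A \<in> Arr C" "Dom C (from_Z A) = Z" "Cod C (from_Z A) = A"
    by (simp_all add: from_Z_def hom_iff)
qed

lemma to_Z_eq: "f \<in> Arr C \<Longrightarrow> Cod C f = Z \<Longrightarrow> f = to_Z (Dom C f)"
proof -
  assume f: "f \<in> Arr C" "Cod C f = Z"
  hence "\<exists>!g. g \<in> hom C (Dom C f) Z" using zero_obj_Z by (simp add: zero_obj_def)
  thus "f = to_Z (Dom C f)" using f to_Z[of "Dom C f"] by (auto simp: hom_iff)
qed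

lemma from_Z_eq: "f \<in> Arr C \<Longrightarrow> Dom C f = Z \<Longrightarrow> f = from_Z (Cod C f)"
proof -
  assume f: "f \<in> Arr C" "Dom C f = Z"
  hence "\<exists>!g. g \<in> hom C Z (Cod C f)" using zero_obj_Z by (simp add: zero_obj_def)
  thus "f = from_Z (Cod C f)" using f from_Z[of "Cod C f"] by (auto simp: hom_iff)
qed

lemma zero_arr [simp]:
  assumes "A \<in> Obj C" "B \<in> Obj C"
  shows "zero_arr A B \<in> Arr C" "Dom C (zero_arr A B) = A" "Cod C (zero_arr A B) = B"
  using assms by (simp_all add: zero_arr_def)

lemma zero_arr_comp [simp]:
  assumes "f \<in> Arr C"
  shows "Cod C f = B \<Longrightarrow> D \<in> Obj C \<Longrightarrow> zero_arr B D \<cdot> f = zero_arr (Dom C f) D"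
    "Dom C f = B \<Longrightarrow> A \<in> Obj C \<Longrightarrow> f \<cdot> zero_arr A B = zero_arr A (Cod C f)"
proof -
  assume *: "Cod C f = B" "D \<in> Obj C"
  hence B: "B \<in> Obj C" using assms by auto
  have "to_Z B \<cdot> f = to_Z (Dom C f)" using to_Z_eq[of "to_Z B \<cdot> f"] assms * B by simp
  thus "zero_arr B D \<cdot> f = zero_arr (Dom C f) D" using assms * B by (simp add: zero_arr_def)
next
  assume *: "Dom C f = B" "A \<in> Obj C"
  hence B: "B \<in> Obj C" using assms by auto
  have "f \<cdot> from_Z B = from_Z (Cod C f)" using from_Z_eq[of "f \<cdot> from_Z B"] assms * B by simp
  thus "f \<cdot> zero_arr A B = zero_arr A (Cod C f)" using assms * B by (simp add: zero_arr_def comp_eq_extend1)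
qed

lemma zero_mor_iff: "f \<in> Arr C \<Longrightarrow> zero_mor C f \<longleftrightarrow> f = zero_arr (Dom C f) (Cod C f)"
proof
  assume f: "f \<in> Arr C" and "zero_mor C f"
  then obtain Z' g h where z: "zero_obj C Z'" and g: "g \<in> hom C (Dom C f) Z'" and h: "h \<in> hom C Z' (Cod C f)" and fhg: "f = h \<cdot> g"
    unfolding zero_mor_def by blast
  note [simp] = g[unfolded hom_iff, THEN conjunct1] 
  have [simp]: "Dom C g = Dom C f" "Cod C g = Z'" "h \<in> Arr C" "Dom C h = Z'" "Cod C h = Cod C f" "Z' \<in> Obj C"
    using g h z by (auto simp: hom_iff zero_obj_def)
  \<comment> \<open>The zero object through which \<open>f\<close> factors need not be
    \<open>Z\<close>; by uniqueness its identity is already a zero arrow.\<close>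
  have "\<exists>!k. k \<in> hom C Z' Z'" using z by (simp add: zero_obj_def)
  hence i: "Ide C Z' = zero_arr Z' Z'" by (auto simp: hom_iff)
  have "f = h \<cdot> (Ide C Z' \<cdot> g)" using fhg by simp
  also have "\<dots> = zero_arr (Dom C f) (Cod C f)" unfolding i using f by simp
  finally show "f = zero_arr (Dom C f) (Cod C f)" .
next
  assume f: "f \<in> Arr C" and "f = zero_arr (Dom C f) (Cod C f)"
  thus "zero_mor C f" unfolding zero_mor_def using zero_obj_Z
    by (intro conjI exI[of _ Z] exI[of _ "to_Z (Dom C f)"] exI[of _ "from_Z (Cod C f)"]) (simp_all add: hom_iff zero_arr_def)
qed

lemma zero_mor_zero_arr [simp]: "A \<in> Obj C \<Longrightarrow> B \<in> Obj C \<Longrightarrow> zero_mor C (zero_arr A B)"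
  by (simp add: zero_mor_iff)

section \<open>Kernels and cokernels\<close>

lemma kernelD:
  assumes "is_kernel C k f"
  shows "k \<in> Arr C" "f \<in> Arr C" "Cod C k = Dom C f" "f \<cdot> k = zero_arr (Dom C k) (Cod C f)"
proof -
  show 1: "k \<in> Arr C" "f \<in> Arr C" "Cod C k = Dom C f" using assms by (auto simp: is_kernel_def)
  have "zero_mor C (f \<cdot> k)" using assms by (simp add: is_kernel_def)
  thus "f \<cdot> k = zero_arr (Dom C k) (Cod C f)" using 1 zero_mor_iff[of "f \<cdot> k"] by simp
qed

lemma kernel_factor:
  assumes k: "is_kernel C k f" and x: "x \<in> Arr C" "Cod C x = Dom C f" "f \<cdot> x = zero_arr (Dom C x) (Cod C f)"
  obtains u where "u \<in> Arr C" "Dom C u = Dom C x" "Cod C u = Dom C k" "k \<cdot> u = x"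
proof -
  have "zero_mor C (f \<cdot> x)" using x kernelD[OF k] by (simp add: zero_mor_iff)
  hence "\<exists>!u. u \<in> hom C (Dom C x) (Dom C k) \<and> k \<cdot> u = x" using k x unfolding is_kernel_def by blast
  thus ?thesis using that by (auto simp: hom_iff)
qed

lemma kernel_monic:
  assumes k: "is_kernel C k f" shows "monic k"
  unfolding monic_def
proof (intro conjI ballI impI)
  note [simp] = kernelD[OF k]
  show "k \<in> Arr C" by simp
  fix u v assume u: "u \<in> Arr C" "v \<in> Arr C" "Dom C u = Dom C v" "Cod C u = Dom C k" "Cod C v = Dom C k" "k \<cdot> u = k \<cdot> v"
  have "f \<cdot> (k \<cdot> v) = zero_arr (Dom C v) (Cod C f)" using u by (simp add: comp_eq_extend1[OF kernelD(4)[OF k]])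
  hence zm: "zero_mor C (f \<cdot> (k \<cdot> v))" using u by (simp add: zero_mor_iff)
  have uni: "\<exists>!w. w \<in> hom C (Dom C x) (Dom C k) \<and> k \<cdot> w = x"
    if "x \<in> Arr C" "Cod C x = Dom C f" "zero_mor C (f \<cdot> x)" for x
    using k that unfolding is_kernel_def by blast
  have "\<exists>!w. w \<in> hom C (Dom C (k \<cdot> v)) (Dom C k) \<and> k \<cdot> w = k \<cdot> v"
    by (rule uni) (use u zm in simp_all)
  thus "u = v" using u by (auto simp: hom_iff)
qed

lemma kernelI:
  assumes "k \<in> Arr C" "f \<in> Arr C" "Cod C k = Dom C f" "f \<cdot> k = zero_arr (Dom C k) (Cod C f)" and m: "monic k"
    and ex: "\<And>x. \<lbrakk>x \<in> Arr C; Cod C x = Dom C f; f \<cdot> x = zero_arr (Dom C x) (Cod C f)\<rbrakk> \<Longrightarrow>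
      \<exists>u. u \<in> Arr C \<and> Dom C u = Dom C x \<and> Cod C u = Dom C k \<and> k \<cdot> u = x"
  shows "is_kernel C k f"
  unfolding is_kernel_def
proof (intro conjI ballI impI)
  show "zero_mor C (f \<cdot> k)" using assms(1-4) by (simp add: zero_mor_iff)
  fix x assume x: "x \<in> Arr C" "Cod C x = Dom C f \<and> zero_mor C (f \<cdot> x)"
  hence "f \<cdot> x = zero_arr (Dom C x) (Cod C f)" using zero_mor_iff[of "f \<cdot> x"] assms(2) by simp
  then obtain u where u: "u \<in> Arr C" "Dom C u = Dom C x" "Cod C u = Dom C k" "k \<cdot> u = x" using ex[of x] x by auto
  show "\<exists>!u. u \<in> hom C (Dom C x) (Dom C k) \<and> k \<cdot> u = x"
    using u monicD[OF m] by (intro ex1I[of _ u]) (auto simp: hom_iff)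
qed (use assms in auto)

lemma cokernelD:
  assumes "is_cokernel C q f"
  shows "q \<in> Arr C" "f \<in> Arr C" "Dom C q = Cod C f" "q \<cdot> f = zero_arr (Dom C f) (Cod C q)"
proof -
  show 1: "q \<in> Arr C" "f \<in> Arr C" "Dom C q = Cod C f" using assms by (auto simp: is_cokernel_def)
  have "zero_mor C (q \<cdot> f)" using assms by (simp add: is_cokernel_def)
  thus "q \<cdot> f = zero_arr (Dom C f) (Cod C q)" using 1 zero_mor_iff[of "q \<cdot> f"] by simp
qed

lemma cokernel_factor:
  assumes q: "is_cokernel C q f" and x: "x \<in> Arr C" "Dom C x = Cod C f" "x \<cdot> f = zero_arr (Dom C f) (Cod C x)"
  obtains u where "u \<in> Arr C" "Dom C u = Cod C q" "Cod C u = Cod C x" "u \<cdot> q = x"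
proof -
  have "zero_mor C (x \<cdot> f)" using x cokernelD[OF q] by (simp add: zero_mor_iff)
  hence "\<exists>!u. u \<in> hom C (Cod C q) (Cod C x) \<and> u \<cdot> q = x" using q x unfolding is_cokernel_def by blast
  thus ?thesis using that by (auto simp: hom_iff)
qed

lemma cokernel_regular_epi:
  assumes q: "is_cokernel C q f" shows "regular_epi C q"
proof -
  note [simp] = cokernelD(1-3)[OF q]
  have "is_coequalizer C q f (zero_arr (Dom C f) (Cod C f))"
    unfolding is_coequalizer_def
  proof (intro conjI ballI impI)
    fix x assume x: "x \<in> Arr C" "Dom C x = Cod C f \<and> x \<cdot> f = x \<cdot> zero_arr (Dom C f) (Cod C f)"
    hence "zero_mor C (x \<cdot> f)" by simp
    thus "\<exists>!w. w \<in> hom C (Cod C q) (Cod C x) \<and> w \<cdot> q = x" using q x unfolding is_cokernel_def by blast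
  qed (simp_all add: hom_iff cokernelD(4)[OF q])
  thus ?thesis unfolding regular_epi_def by blast
qed

lemma kernel_exists:
  assumes [simp]: "f \<in> Arr C" obtains k where "is_kernel C k f"
proof -
  obtain k z where pb: "is_pullback C k z f (from_Z (Cod C f))" using pb_exists[of f "from_Z (Cod C f)"] by auto
  have [simp]: "k \<in> Arr C" "z \<in> Arr C" "Dom C k = Dom C z" "Cod C k = Dom C f" "Cod C z = Z" using pbD[OF pb] by auto
  have zz: "u = v" if "u \<in> Arr C" "v \<in> Arr C" "Cod C u = Z" "Cod C v = Z" "Dom C u = Dom C v" for u v
    using to_Z_eq[of u] to_Z_eq[of v] that by simp
  have "is_kernel C k f"
  proof (rule kernelI)
    show "f \<cdot> k = zero_arr (Dom C k) (Cod C f)" using pbD(9)[OF pb] to_Z_eq[of z] by (simp add: zero_arr_def)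
    show "monic k" unfolding monic_def
    proof (intro conjI ballI impI)
      fix u v assume u: "u \<in> Arr C" "v \<in> Arr C" "Dom C u = Dom C v" "Cod C u = Dom C k" "Cod C v = Dom C k" "k \<cdot> u = k \<cdot> v"
      show "u = v" by (rule pb_ext[OF pb]) (use u in \<open>simp_all add: zz\<close>)
    qed simp
    fix x assume x: "x \<in> Arr C" "Cod C x = Dom C f" "f \<cdot> x = zero_arr (Dom C x) (Cod C f)"
    have 1: "f \<cdot> x = from_Z (Cod C f) \<cdot> to_Z (Dom C x)" using x by (simp add: zero_arr_def)
    show "\<exists>u. u \<in> Arr C \<and> Dom C u = Dom C x \<and> Cod C u = Dom C k \<and> k \<cdot> u = x"
      using pair[OF pb _ _ _ _ _ 1] x by (intro exI[of _ "pair k z x (to_Z (Dom C x))"]) simp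
  qed simp_all
  thus ?thesis by (rule that)
qed

lemma kernel_unique:
  assumes k: "is_kernel C k f" and k': "is_kernel C k' f"
  obtains i where "is_iso C i" "i \<in> Arr C" "Dom C i = Dom C k" "Cod C i = Dom C k'" "k' \<cdot> i = k"
proof -
  note [simp] = kernelD[OF k] kernelD[OF k']
  obtain i where i: "i \<in> Arr C" "Dom C i = Dom C k" "Cod C i = Dom C k'" "k' \<cdot> i = k"
    by (rule kernel_factor[OF k', of k]) simp_all
  obtain j where j: "j \<in> Arr C" "Dom C j = Dom C k'" "Cod C j = Dom C k" "k \<cdot> j = k'"
    by (rule kernel_factor[OF k, of k']) simp_all
  have "j \<cdot> i = Ide C (Dom C k)"
    by (rule monicD[OF kernel_monic[OF k]]) (use i j in \<open>simp_all add: comp_eq_extend1[OF j(4)]\<close>)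
  moreover have "i \<cdot> j = Ide C (Dom C k')"
    by (rule monicD[OF kernel_monic[OF k']]) (use i j in \<open>simp_all add: comp_eq_extend1[OF i(4)]\<close>)
  ultimately have "is_iso C i" using i j by (intro isoI[of i j]) simp_all
  thus ?thesis using that i by blast
qed

lemma kernel_obj_in_kernel:
  assumes S: "replete C S" and f: "kernel_obj_in C f S" and k: "is_kernel C k f"
  shows "Dom C k \<in> S"
proof -
  obtain k' where k': "is_kernel C k' f" "Dom C k' \<in> S" using f by (auto simp: kernel_obj_in_def)
  obtain i where "is_iso C i" "Dom C i = Dom C k'" "Cod C i = Dom C k" by (rule kernel_unique[OF k'(1) k])
  thus ?thesis using S k'(2) unfolding replete_def by metis
qed

lemma kernel_of_pullback:
  assumes pb: "is_pullback C p q f g" and k: "is_kernel C k q"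
  shows "is_kernel C (p \<cdot> k) f"
proof -
  note [simp] = pbD(1-8)[OF pb] kernelD[OF k]
  show ?thesis
  proof (rule kernelI)
    show "f \<cdot> (p \<cdot> k) = zero_arr (Dom C (p \<cdot> k)) (Cod C f)" by (simp add: pb_comm[OF pb])
    show "monic (p \<cdot> k)" unfolding monic_def
    proof (intro conjI ballI impI)
      fix u v assume u: "u \<in> Arr C" "v \<in> Arr C" "Dom C u = Dom C v" "Cod C u = Dom C (p \<cdot> k)" "Cod C v = Dom C (p \<cdot> k)"
        "(p \<cdot> k) \<cdot> u = (p \<cdot> k) \<cdot> v"
      have "k \<cdot> u = k \<cdot> v"
        by (rule pb_ext[OF pb]) (use u in \<open>simp_all add: comp_eq_extend1[OF kernelD(4)[OF k]]\<close>)
      thus "u = v" using u by - (rule monicD[OF kernel_monic[OF k]]; simp)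
    qed simp
    fix x assume x: "x \<in> Arr C" "Cod C x = Dom C f" "f \<cdot> x = zero_arr (Dom C x) (Cod C f)"
    have 1: "f \<cdot> x = g \<cdot> zero_arr (Dom C x) (Dom C g)" using x by simp
    define y where "y = pair p q x (zero_arr (Dom C x) (Dom C g))"
    have y: "y \<in> Arr C" "Dom C y = Dom C x" "Cod C y = Dom C q" "p \<cdot> y = x" "q \<cdot> y = zero_arr (Dom C x) (Dom C g)"
      unfolding y_def using x pair[OF pb _ _ _ _ _ 1] by simp_all
    obtain u where "u \<in> Arr C" "Dom C u = Dom C y" "Cod C u = Dom C k" "k \<cdot> u = y"
      by (rule kernel_factor[OF k, of y]) (use y in simp_all)
    thus "\<exists>u. u \<in> Arr C \<and> Dom C u = Dom C x \<and> Cod C u = Dom C (p \<cdot> k) \<and> (p \<cdot> k) \<cdot> u = x"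
      using y by (intro exI[of _ u]) simp
  qed simp_all
qed

text \<open>Complements \<open>kernel_of_pullback\<close>: the kernel of \<open>f\<close>, paired
  with zero, is a kernel of the pulled-back arrow, and both of its coordinates are known.\<close>

lemma kernel_lift_pair:
  assumes pb: "is_pullback C p q f g" and k: "is_kernel C k f"
  defines "\<kappa> \<equiv> pair p q k (zero_arr (Dom C k) (Dom C g))"
  shows "is_kernel C \<kappa> q" "\<kappa> \<in> Arr C" "Dom C \<kappa> = Dom C k" "Cod C \<kappa> = Dom C q" "p \<cdot> \<kappa> = k"
    "q \<cdot> \<kappa> = zero_arr (Dom C k) (Dom C g)"
proof -
  note [simp] = pbD(1-8)[OF pb] kernelD[OF k]
  have 1: "f \<cdot> k = g \<cdot> zero_arr (Dom C k) (Dom C g)" by simp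
  show \<kappa>: "\<kappa> \<in> Arr C" "Dom C \<kappa> = Dom C k" "Cod C \<kappa> = Dom C q" "p \<cdot> \<kappa> = k" "q \<cdot> \<kappa> = zero_arr (Dom C k) (Dom C g)"
    unfolding \<kappa>_def using pair[OF pb _ _ _ _ _ 1] by simp_all
  show "is_kernel C \<kappa> q"
  proof (rule kernelI)
    show "monic \<kappa>" by (rule monic_cancel[of p]) (simp_all add: \<kappa> kernel_monic[OF k])
    fix x assume x: "x \<in> Arr C" "Cod C x = Dom C q" "q \<cdot> x = zero_arr (Dom C x) (Cod C q)"
    have fpx: "f \<cdot> (p \<cdot> x) = zero_arr (Dom C x) (Cod C g)" using x by (simp add: pb_comm[OF pb])
    obtain u where u: "u \<in> Arr C" "Dom C u = Dom C (p \<cdot> x)" "Cod C u = Dom C k" "k \<cdot> u = p \<cdot> x"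
      by (rule kernel_factor[OF k, of "p \<cdot> x"]) (use x fpx in simp_all)
    have "\<kappa> \<cdot> u = x"
      by (rule pb_ext[OF pb]) (use u x \<kappa> in \<open>simp_all add: comp_eq_extend1[OF \<kappa>(4)] comp_eq_extend1[OF \<kappa>(5)]\<close>)
    thus "\<exists>u. u \<in> Arr C \<and> Dom C u = Dom C x \<and> Cod C u = Dom C \<kappa> \<and> \<kappa> \<cdot> u = x"
      using u x \<kappa> by (intro exI[of _ u]) simp
  qed (simp_all add: \<kappa>)
qed

text \<open>Finite limits are given as a terminal object and pullbacks, so the product of the
  codomain with itself is formed as a pullback over \<open>Z\<close>, and the equaliser is the
  pullback of the pair of \<open>u\<close> and \<open>v\<close> along the diagonal.\<close>

lemma equalizer_exists:
  assumes [simp]: "u \<in> Arr C" "v \<in> Arr C" "Dom C u = Dom C v" "Cod C u = Cod C v"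
  obtains j where "j \<in> Arr C" "Cod C j = Dom C v" "u \<cdot> j = v \<cdot> j" "monic j"
    "\<And>x. \<lbrakk>x \<in> Arr C; Cod C x = Dom C v; u \<cdot> x = v \<cdot> x\<rbrakk> \<Longrightarrow> \<exists>w. w \<in> Arr C \<and> Dom C w = Dom C x \<and> Cod C w = Dom C j \<and> j \<cdot> w = x"
proof -
  let ?X = "Cod C v" and ?A = "Dom C v"
  obtain p q where P: "is_pullback C p q (to_Z ?X) (to_Z ?X)" using pb_exists[of "to_Z ?X" "to_Z ?X"] by auto
  have [simp]: "p \<in> Arr C" "q \<in> Arr C" "Dom C p = Dom C q" "Cod C p = ?X" "Cod C q = ?X" using pbD[OF P] by auto
  have zz: "to_Z ?X \<cdot> a = to_Z (Dom C a)" if "a \<in> Arr C" "Cod C a = ?X" for a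
    using that to_Z_eq[of "to_Z ?X \<cdot> a"] by simp
  define uv where "uv = pair p q u v"
  define d where "d = pair p q (Ide C ?X) (Ide C ?X)"
  have [simp]: "uv \<in> Arr C" "Dom C uv = ?A" "Cod C uv = Dom C q" and uv: "p \<cdot> uv = u" "q \<cdot> uv = v"
    unfolding uv_def by (simp_all add: pair[OF P] zz)
  have [simp]: "d \<in> Arr C" "Dom C d = ?X" "Cod C d = Dom C q" and d: "p \<cdot> d = Ide C ?X" "q \<cdot> d = Ide C ?X"
    unfolding d_def by (simp_all add: pair[OF P] zz)
  obtain j x0 where Q: "is_pullback C j x0 uv d" using pb_exists[of uv d] by auto
  have [simp]: "j \<in> Arr C" "x0 \<in> Arr C" "Dom C j = Dom C x0" "Cod C j = ?A" "Cod C x0 = ?X" and jx: "uv \<cdot> j = d \<cdot> x0"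
    using pbD[OF Q] by auto
  have 1: "u \<cdot> j = x0"
  proof -
    have "u \<cdot> j = p \<cdot> (uv \<cdot> j)" by (rule comp_eq_extend1[OF uv(1), symmetric]) simp_all
    also have "\<dots> = x0" by (simp add: jx comp_eq_extend1[OF d(1)])
    finally show ?thesis .
  qed
  have 2: "v \<cdot> j = x0"
  proof -
    have "v \<cdot> j = q \<cdot> (uv \<cdot> j)" by (rule comp_eq_extend1[OF uv(2), symmetric]) simp_all
    also have "\<dots> = x0" by (simp add: jx comp_eq_extend1[OF d(2)])
    finally show ?thesis .
  qed
  show ?thesis
  proof (rule that[of j])
    show "monic j" unfolding monic_def
    proof (intro conjI ballI impI)
      fix a b assume a: "a \<in> Arr C" "b \<in> Arr C" "Dom C a = Dom C b" "Cod C a = Dom C j" "Cod C b = Dom C j" "j \<cdot> a = j \<cdot> b"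
      have "x0 \<cdot> a = u \<cdot> (j \<cdot> a)" using a(1-5) by (simp add: comp_eq_extend1[OF 1])
      also have "\<dots> = u \<cdot> (j \<cdot> b)" by (simp only: a(6))
      also have "\<dots> = x0 \<cdot> b" using a(1-5) by (simp add: comp_eq_extend1[OF 1])
      finally have "x0 \<cdot> a = x0 \<cdot> b" .
      thus "a = b" using a by - (rule pb_ext[OF Q]; simp)
    qed simp
    fix x assume x: "x \<in> Arr C" "Cod C x = ?A" "u \<cdot> x = v \<cdot> x"
    have "uv \<cdot> x = d \<cdot> (u \<cdot> x)"
      by (rule pb_ext[OF P]) (use x in \<open>simp_all add: comp_eq_extend1[OF uv(1)] comp_eq_extend1[OF uv(2)] comp_eq_extend1[OF d(1)] comp_eq_extend1[OF d(2)]\<close>)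
    from pair[OF Q _ _ _ _ _ this] x show "\<exists>w. w \<in> Arr C \<and> Dom C w = Dom C x \<and> Cod C w = Dom C j \<and> j \<cdot> w = x"
      by (intro exI[of _ "pair j x0 x (u \<cdot> x)"]) simp
  qed (simp_all add: 1 2)
qed

section \<open>Consequences of the split short five lemma\<close>

lemma split_five:
  assumes "split_short_exact C k f s" "split_short_exact C k' f' s'"
    "a \<in> Arr C" "Dom C a = Dom C k" "Cod C a = Dom C k'" "b \<in> Arr C" "Dom C b = Dom C f" "Cod C b = Dom C f'"
    "c \<in> Arr C" "Dom C c = Cod C f" "Cod C c = Cod C f'"
    "b \<cdot> k = k' \<cdot> a" "f' \<cdot> b = c \<cdot> f" "b \<cdot> s = s' \<cdot> c" "is_iso C a" "is_iso C c"
  shows "is_iso C b"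
proof -
  have "split_short_five C" using homological by (simp add: homological_def pointed_protomodular_def)
  from this[unfolded split_short_five_def, rule_format, of k f s k' f' s' a b c]
  show ?thesis using assms by (simp add: hom_iff)
qed

text \<open>The equaliser of \<open>u\<close> and \<open>v\<close> contains the kernel and the section, so it is everything by the
  split short five lemma.\<close>

lemma split_jointly_epic:
  assumes k: "is_kernel C k f" and s [simp]: "s \<in> Arr C" "Dom C s = Cod C f" "Cod C s = Dom C f"
    and fs: "f \<cdot> s = Ide C (Cod C f)"
    and u [simp]: "u \<in> Arr C" "v \<in> Arr C" "Dom C u = Dom C f" "Dom C v = Dom C f" "Cod C u = Cod C v"
    and eq: "u \<cdot> k = v \<cdot> k" "u \<cdot> s = v \<cdot> s"
  shows "u = v"
proof -
  note [simp] = kernelD(1-3)[OF k]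
  obtain j where j [simp]: "j \<in> Arr C" "Cod C j = Dom C f" and uvj: "u \<cdot> j = v \<cdot> j" and mj: "monic j"
    and jf: "\<And>x. \<lbrakk>x \<in> Arr C; Cod C x = Dom C f; u \<cdot> x = v \<cdot> x\<rbrakk> \<Longrightarrow> \<exists>w. w \<in> Arr C \<and> Dom C w = Dom C x \<and> Cod C w = Dom C j \<and> j \<cdot> w = x"
    using equalizer_exists[of u v] by (metis u)
  obtain k' where [simp]: "k' \<in> Arr C" "Dom C k' = Dom C k" "Cod C k' = Dom C j" and k': "j \<cdot> k' = k" using jf[of k] eq by auto
  obtain s' where [simp]: "s' \<in> Arr C" "Dom C s' = Cod C f" "Cod C s' = Dom C j" and s': "j \<cdot> s' = s" using jf[of s] eq by auto
  have "is_kernel C k' (f \<cdot> j)"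
  proof (rule kernelI)
    show "(f \<cdot> j) \<cdot> k' = zero_arr (Dom C k') (Cod C (f \<cdot> j))" by (simp add: k' kernelD(4)[OF k])
    show "monic k'" by (rule monic_cancel[of j]) (simp_all add: k' kernel_monic[OF k])
    fix x assume x: "x \<in> Arr C" "Cod C x = Dom C (f \<cdot> j)" "(f \<cdot> j) \<cdot> x = zero_arr (Dom C x) (Cod C (f \<cdot> j))"
    obtain w where w: "w \<in> Arr C" "Dom C w = Dom C (j \<cdot> x)" "Cod C w = Dom C k" "k \<cdot> w = j \<cdot> x"
      by (rule kernel_factor[OF k, of "j \<cdot> x"]) (use x in simp_all)
    have "k' \<cdot> w = x"
      by (rule monicD[OF mj]) (use w x in \<open>simp_all add: comp_eq_extend1[OF k']\<close>)
    thus "\<exists>u. u \<in> Arr C \<and> Dom C u = Dom C x \<and> Cod C u = Dom C k' \<and> k' \<cdot> u = x"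
      using w x by (intro exI[of _ w]) simp
  qed simp_all
  hence 1: "split_short_exact C k' (f \<cdot> j) s'"
    by (simp add: split_short_exact_def hom_iff s' fs)
  have 2: "split_short_exact C k f s" by (simp add: split_short_exact_def hom_iff k fs)
  have "is_iso C j"
    by (rule split_five[OF 1 2, of "Ide C (Dom C k)" j "Ide C (Cod C f)"]) (simp_all add: k' s')
  then obtain i where i: "i \<in> Arr C" "Dom C i = Dom C f" "Cod C i = Dom C j" "j \<cdot> i = Ide C (Dom C f)"
    by (rule isoE) simp
  have "u \<cdot> (j \<cdot> i) = v \<cdot> (j \<cdot> i)" by (rule comp_eq_extend[OF uvj]) (simp_all add: i)
  thus ?thesis by (simp add: i)
qed

text \<open>A regular epimorphism is determined by its kernel pair, and in a protomodular category
  the kernel pair is controlled by the kernel together with the diagonal.\<close>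

lemma regular_epi_cokernel:
  assumes f: "regular_epi C f" and k: "is_kernel C k f"
  shows "is_cokernel C f k"
proof -
  note [simp] = kernelD[OF k]
  obtain p q where pb: "is_pullback C p q f f" using pb_exists[of f f] by auto
  have [simp]: "p \<in> Arr C" "q \<in> Arr C" "Dom C p = Dom C q" "Cod C p = Dom C f" "Cod C q = Dom C f" using pbD[OF pb] by auto
  note \<kappa> = kernel_lift_pair[OF pb k]
  define s where "s = pair p q (Ide C (Dom C f)) (Ide C (Dom C f))"
  have s [simp]: "s \<in> Arr C" "Dom C s = Dom C f" "Cod C s = Dom C q" and ps: "p \<cdot> s = Ide C (Dom C f)" and qs: "q \<cdot> s = Ide C (Dom C f)"
    unfolding s_def by (simp_all add: pair[OF pb])
  have ex: "\<exists>w. w \<in> Arr C \<and> Dom C w = Cod C f \<and> Cod C w = Cod C x \<and> w \<cdot> f = x"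
    if x [simp]: "x \<in> Arr C" "Dom C x = Dom C f" and xk: "x \<cdot> k = zero_arr (Dom C k) (Cod C x)" for x
  proof -
    \<comment> \<open>The projection \<open>q\<close> is split by the diagonal \<open>s\<close>. The
      two composites agree on the diagonal, and both vanish on its kernel because \<open>x\<close>
      kills \<open>k\<close>.\<close>
    have xpq: "x \<cdot> p = x \<cdot> q"
      by (rule split_jointly_epic[OF \<kappa>(1), of s]) (simp_all add: \<kappa> ps qs xk)
    obtain l where "l \<in> Arr C" "Dom C l = Cod C f" "Cod C l = Cod C x" "l \<cdot> f = x"
    proof (rule regular_epi_descend[OF f, of x])
      fix a b assume ab: "a \<in> Arr C" "b \<in> Arr C" "Dom C a = Dom C b" "Cod C a = Dom C f" "Cod C b = Dom C f" "f \<cdot> a = f \<cdot> b"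
      note t = pair[OF pb ab]
      have "x \<cdot> (p \<cdot> pair p q a b) = x \<cdot> (q \<cdot> pair p q a b)"
        by (rule comp_eq_extend[OF xpq]) (simp_all add: t)
      thus "x \<cdot> a = x \<cdot> b" by (simp only: t)
    qed simp_all
    thus ?thesis by blast
  qed
  show ?thesis unfolding is_cokernel_def
  proof (intro conjI ballI impI)
    fix x assume x: "x \<in> Arr C" "Dom C x = Cod C k \<and> zero_mor C (x \<cdot> k)"
    hence xk: "x \<cdot> k = zero_arr (Dom C k) (Cod C x)" using zero_mor_iff[of "x \<cdot> k"] by simp
    obtain w where w: "w \<in> Arr C" "Dom C w = Cod C f" "Cod C w = Cod C x" "w \<cdot> f = x"
      using ex[OF x(1) _ xk] x(2) by auto
    show "\<exists>!w. w \<in> hom C (Cod C f) (Cod C x) \<and> w \<cdot> f = x"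
    proof (rule ex1I[of _ w])
      fix v assume "v \<in> hom C (Cod C f) (Cod C x) \<and> v \<cdot> f = x"
      thus "v = w" using w by - (rule epicD[OF regular_epi_epic[OF f]]; simp add: hom_iff)
    qed (simp add: hom_iff w)
  qed simp_all
qed

lemma normal_epi_iff: "normal_epi C f \<longleftrightarrow> regular_epi C f"
proof
  assume "regular_epi C f"
  thus "normal_epi C f" unfolding normal_epi_def by (metis kernel_exists regular_epi_cokernel regular_epi_arr)
qed (auto simp: normal_epi_def intro: cokernel_regular_epi)

text \<open>Pulling back along \<open>m \<cdot> n\<close> reduces this to the split short five lemma.\<close>

lemma short_five:
  assumes r: "regular_epi C (m \<cdot> n)" and [simp]: "m \<in> Arr C" "n \<in> Arr C" "Cod C n = Dom C m"
    and w: "is_kernel C w (m \<cdot> n)" and nw: "is_kernel C (n \<cdot> w) m"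
  shows "is_iso C n"
proof -
  have [simp]: "w \<in> Arr C" "Cod C w = Dom C n" using kernelD[OF w] by auto
  obtain a b where P: "is_pullback C a b m (m \<cdot> n)" using pb_exists[of m "m \<cdot> n"] by auto
  have [simp]: "a \<in> Arr C" "b \<in> Arr C" "Dom C a = Dom C b" "Cod C a = Dom C m" "Cod C b = Dom C n" using pbD[OF P] by auto
  obtain c d where R: "is_pullback C c d (m \<cdot> n) (m \<cdot> n)" using pb_exists[of "m \<cdot> n" "m \<cdot> n"] by auto
  have [simp]: "c \<in> Arr C" "d \<in> Arr C" "Dom C c = Dom C d" "Cod C c = Dom C n" "Cod C d = Dom C n" using pbD[OF R] by auto
  have Rc: "m \<cdot> (n \<cdot> (c \<cdot> x)) = m \<cdot> (n \<cdot> (d \<cdot> x))" if "x \<in> Arr C" "Cod C x = Dom C d" for x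
    using pb_comm[OF R that] that by simp
  have Rc': "m \<cdot> (n \<cdot> c) = m \<cdot> (n \<cdot> d)" using pbD(9)[OF R] by simp
  note kd = kernel_lift_pair[OF R w] and kb = kernel_lift_pair[OF P nw]
  let ?kd = "pair c d w (zero_arr (Dom C w) (Dom C (m \<cdot> n)))" and ?kb = "pair a b (n \<cdot> w) (zero_arr (Dom C (n \<cdot> w)) (Dom C (m \<cdot> n)))"
  \<comment> \<open>The pullback of \<open>n\<close> along \<open>m \<cdot> n\<close>: it goes from
    the kernel pair of \<open>m \<cdot> n\<close>, split by the diagonal, to the pullback of
    \<open>m\<close>, split by the graph of \<open>n\<close>. On kernels it is an identity.\<close>
  define \<phi> where "\<phi> = pair a b (n \<cdot> c) d"
  have \<phi> [simp]: "\<phi> \<in> Arr C" "Dom C \<phi> = Dom C d" "Cod C \<phi> = Dom C b" and a\<phi>: "a \<cdot> \<phi> = n \<cdot> c" and b\<phi>: "b \<cdot> \<phi> = d"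
    unfolding \<phi>_def by (simp_all add: pair[OF P] Rc')
  define sd where "sd = pair c d (Ide C (Dom C n)) (Ide C (Dom C n))"
  have sd [simp]: "sd \<in> Arr C" "Dom C sd = Dom C n" "Cod C sd = Dom C d" and csd: "c \<cdot> sd = Ide C (Dom C n)" and dsd: "d \<cdot> sd = Ide C (Dom C n)"
    unfolding sd_def by (simp_all add: pair[OF R])
  define sb where "sb = pair a b n (Ide C (Dom C n))"
  have sb [simp]: "sb \<in> Arr C" "Dom C sb = Dom C n" "Cod C sb = Dom C b" and asb: "a \<cdot> sb = n" and bsb: "b \<cdot> sb = Ide C (Dom C n)"
    unfolding sb_def by (simp_all add: pair[OF P])
  have \<phi>s: "\<phi> \<cdot> sd = sb"
    by (rule pb_ext[OF P]) (simp_all add: comp_eq_extend[OF a\<phi>] comp_eq_extend1[OF b\<phi>] csd dsd asb bsb)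
  have \<phi>k: "\<phi> \<cdot> ?kd = ?kb"
    by (rule pb_ext[OF P]) (use kd kb in \<open>simp_all add: comp_eq_extend[OF a\<phi>] comp_eq_extend1[OF b\<phi>]\<close>)
  have 1: "split_short_exact C ?kd d sd" using kd(1) by (simp add: split_short_exact_def hom_iff dsd)
  have 2: "split_short_exact C ?kb b sb" using kb(1) by (simp add: split_short_exact_def hom_iff bsb)
  have "is_iso C \<phi>"
    by (rule split_five[OF 1 2, of "Ide C (Dom C w)" \<phi> "Ide C (Dom C n)"])
      (use kd kb \<phi>k in \<open>simp_all add: \<phi>s b\<phi>\<close>)
  then obtain \<psi> where \<psi> [simp]: "\<psi> \<in> Arr C" "Dom C \<psi> = Dom C b" "Cod C \<psi> = Dom C d"
    and \<psi>\<phi>: "\<psi> \<cdot> \<phi> = Ide C (Dom C d)" and \<phi>\<psi>: "\<phi> \<cdot> \<psi> = Ide C (Dom C b)" by (rule isoE) simp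
  have nc\<psi>: "n \<cdot> (c \<cdot> (\<psi> \<cdot> x)) = a \<cdot> x" if "x \<in> Arr C" "Cod C x = Dom C b" for x
  proof -
    have "n \<cdot> (c \<cdot> (\<psi> \<cdot> x)) = a \<cdot> (\<phi> \<cdot> (\<psi> \<cdot> x))" by (rule comp_eq_extend[OF a\<phi>[symmetric]]) (simp_all add: that)
    thus ?thesis using that by (simp add: comp_eq_extend1[OF \<phi>\<psi>])
  qed
  have ra: "regular_epi C a" by (rule regular_epi_pb[OF pb_swap[OF P] r])
  \<comment> \<open>Invertibility must be brought down from the pullback to \<open>n\<close>. As
    \<open>a\<close> is a regular epimorphism, the inverse \<psi> followed by \<open>c\<close>
    descends to a candidate inverse \<open>j\<close>.\<close>
  obtain j where j [simp]: "j \<in> Arr C" "Dom C j = Dom C m" "Cod C j = Dom C n" and ja: "j \<cdot> a = c \<cdot> \<psi>"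
  proof (rule regular_epi_descend[OF ra, of "c \<cdot> \<psi>"])
    fix s t assume s [simp]: "s \<in> Arr C" "t \<in> Arr C" "Dom C s = Dom C t" "Cod C s = Dom C a" "Cod C t = Dom C a"
      and st: "a \<cdot> s = a \<cdot> t"
    let ?s = "c \<cdot> (\<psi> \<cdot> s)" and ?t = "d \<cdot> (\<psi> \<cdot> t)"
    have n: "n \<cdot> ?s = n \<cdot> (c \<cdot> (\<psi> \<cdot> t))" by (simp add: nc\<psi> st)
    have mn: "m \<cdot> (n \<cdot> ?s) = m \<cdot> (n \<cdot> ?t)" by (simp add: n Rc)
    \<comment> \<open>An element of the kernel pair with the same image under \<phi> as
      \<open>\<psi> \<cdot> t\<close>, hence equal to it; comparing first coordinates gives
      constancy on the fibres of \<open>a\<close>.\<close>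
    define x where "x = pair c d ?s ?t"
    have x [simp]: "x \<in> Arr C" "Dom C x = Dom C t" "Cod C x = Dom C d" and cx: "c \<cdot> x = ?s" and dx: "d \<cdot> x = ?t"
      unfolding x_def by (simp_all add: pair[OF R] mn)
    have "\<phi> \<cdot> x = \<phi> \<cdot> (\<psi> \<cdot> t)"
      by (rule pb_ext[OF P]) (simp_all add: comp_eq_extend[OF a\<phi>] comp_eq_extend1[OF b\<phi>] cx dx n)
    hence "\<psi> \<cdot> (\<phi> \<cdot> x) = \<psi> \<cdot> (\<phi> \<cdot> (\<psi> \<cdot> t))" by simp
    hence "x = \<psi> \<cdot> t" by (simp add: comp_eq_extend1[OF \<psi>\<phi>])
    thus "(c \<cdot> \<psi>) \<cdot> s = (c \<cdot> \<psi>) \<cdot> t" using cx by simp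
  qed simp_all
  have "n \<cdot> j = Ide C (Dom C m)"
  proof (rule epicD[OF regular_epi_epic[OF ra]])
    show "(n \<cdot> j) \<cdot> a = Ide C (Dom C m) \<cdot> a" using nc\<psi>[of "Ide C (Dom C b)"] by (simp add: ja)
  qed simp_all
  moreover have "j \<cdot> n = Ide C (Dom C n)"
  proof -
    have "j \<cdot> n = j \<cdot> (a \<cdot> sb)" by (simp add: asb)
    also have "\<dots> = c \<cdot> (\<psi> \<cdot> (\<phi> \<cdot> sd))" unfolding \<phi>s by (rule comp_eq_extend[OF ja]) simp_all
    also have "\<dots> = Ide C (Dom C n)" by (simp add: comp_eq_extend1[OF \<psi>\<phi>] csd)
    finally show ?thesis .
  qed
  ultimately show ?thesis by (intro isoI[of n j]) simp_all
qed

text \<open>Through this square every pullback-stable property of \<open>e\<close> passes to the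
  induced map of kernels \<open>b\<close>, where objects are torsion or torsion-free.\<close>

lemma kernel_pullback:
  assumes k: "is_kernel C k (m \<cdot> e)" and km: "is_kernel C km m" and [simp]: "m \<in> Arr C" "e \<in> Arr C" "Cod C e = Dom C m"
    and b [simp]: "b \<in> Arr C" "Dom C b = Dom C k" "Cod C b = Dom C km" and eq: "km \<cdot> b = e \<cdot> k"
  shows "is_pullback C k b e km"
proof -
  have [simp]: "k \<in> Arr C" "Cod C k = Dom C e" using kernelD[OF k] by auto
  note [simp] = kernelD[OF km]
  show ?thesis
  proof (rule pbI)
    fix x y assume x: "x \<in> Arr C" "y \<in> Arr C" "Dom C x = Dom C y" "Cod C x = Dom C e" "Cod C y = Dom C km" "e \<cdot> x = km \<cdot> y"
    have mex: "m \<cdot> (e \<cdot> x) = zero_arr (Dom C x) (Cod C m)" using x by (simp add: comp_eq_extend1[OF kernelD(4)[OF km]])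
    obtain u where u: "u \<in> Arr C" "Dom C u = Dom C x" "Cod C u = Dom C k" "k \<cdot> u = x"
      by (rule kernel_factor[OF k, of x]) (use x(1-5) mex in simp_all)
    have "km \<cdot> (b \<cdot> u) = km \<cdot> y" using u x by (simp add: comp_eq_extend[OF eq])
    hence "b \<cdot> u = y" using u x by - (rule monicD[OF kernel_monic[OF km]]; simp)
    thus "\<exists>u. u \<in> Arr C \<and> Dom C u = Dom C y \<and> Cod C u = Dom C b \<and> k \<cdot> u = x \<and> b \<cdot> u = y"
      using u x by (intro exI[of _ u]) simp
  next
    fix u v assume "u \<in> Arr C" "v \<in> Arr C" "Dom C u = Dom C v" "Cod C u = Dom C b" "Cod C v = Dom C b" "k \<cdot> u = k \<cdot> v"
    thus "u = v" by - (rule monicD[OF kernel_monic[OF k]]; simp)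
  qed (simp_all add: eq)
qed

end

section \<open>Torsion theories\<close>

lemma full_subcat_simps [simp]:
  "Obj (full_subcat C S) = S"
  "f \<in> Arr (full_subcat C S) \<longleftrightarrow> f \<in> Arr C \<and> Dom C f \<in> S \<and> Cod C f \<in> S"
  "Dom (full_subcat C S) = Dom C" "Cod (full_subcat C S) = Cod C" "Ide (full_subcat C S) = Ide C"
  "Comp (full_subcat C S) = Comp C"
  by (auto simp: full_subcat_def)

lemma (in category) is_iso_full_subcat:
  "is_iso (full_subcat C S) f \<longleftrightarrow> is_iso C f \<and> Dom C f \<in> S \<and> Cod C f \<in> S"
  by (auto simp: is_iso_def hom_iff)

lemma (in category) category_full_subcat:
  assumes "S \<subseteq> Obj C" shows "category (full_subcat C S)"
  by unfold_locales (use assms in \<open>auto simp: hom_iff\<close>)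

text \<open>Universal arrows chosen object by object assemble to an adjunction: every equation
  follows by comparing arrows after precomposition with the unit.\<close>

lemma reflectiveI:
  assumes C: "category C" and S: "S \<subseteq> Obj C"
    and univ: "\<And>x. x \<in> Obj C \<Longrightarrow> \<exists>r u. r \<in> S \<and> u \<in> hom C x r \<and>
      (\<forall>y\<in>S. \<forall>f\<in>hom C x y. \<exists>!g. g \<in> hom C r y \<and> g \<cdot>\<^bsub>C\<^esub> u = f)"
  shows "reflective C S"
proof -
  interpret C: category C by (rule C)
  obtain R u where Ru: "\<And>x. x \<in> Obj C \<Longrightarrow> R x \<in> S \<and> u x \<in> hom C x (R x) \<and>
      (\<forall>y\<in>S. \<forall>f\<in>hom C x y. \<exists>!g. g \<in> hom C (R x) y \<and> g \<cdot>\<^bsub>C\<^esub> u x = f)"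
    using univ by metis
  have R: "R x \<in> S" "R x \<in> Obj C" and u: "u x \<in> Arr C" "Dom C (u x) = x" "Cod C (u x) = R x" if "x \<in> Obj C" for x
    using Ru[OF that] S by (auto simp: hom_iff)
  define ex where "ex = (\<lambda>x f. THE g. g \<in> hom C (R x) (Cod C f) \<and> g \<cdot>\<^bsub>C\<^esub> u x = f)"
  have ex: "ex x f \<in> Arr C" "Dom C (ex x f) = R x" "Cod C (ex x f) = Cod C f" "ex x f \<cdot>\<^bsub>C\<^esub> u x = f"
    if "x \<in> Obj C" "f \<in> Arr C" "Dom C f = x" "Cod C f \<in> S" for x f
  proof -
    have "\<exists>!g. g \<in> hom C (R x) (Cod C f) \<and> g \<cdot>\<^bsub>C\<^esub> u x = f" using Ru[OF that(1)] that by (simp add: hom_iff)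
    from theI'[OF this] show "ex x f \<in> Arr C" "Dom C (ex x f) = R x" "Cod C (ex x f) = Cod C f" "ex x f \<cdot>\<^bsub>C\<^esub> u x = f"
      unfolding ex_def by (auto simp: hom_iff)
  qed
  have eq: "g = h" if "x \<in> Obj C" "g \<in> Arr C" "h \<in> Arr C" "Dom C g = R x" "Dom C h = R x" "Cod C g = Cod C h" "Cod C g \<in> S"
    "g \<cdot>\<^bsub>C\<^esub> u x = h \<cdot>\<^bsub>C\<^esub> u x" for x g h
  proof -
    have "\<exists>!k. k \<in> hom C (R x) (Cod C g) \<and> k \<cdot>\<^bsub>C\<^esub> u x = g \<cdot>\<^bsub>C\<^esub> u x"
      using Ru[OF that(1)] u[OF that(1)] that by (auto simp: hom_iff)
    thus ?thesis using that by (auto simp: hom_iff)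
  qed
  define L where "L = \<lparr>FObj = R, FArr = (\<lambda>f. ex (Dom C f) (u (Cod C f) \<cdot>\<^bsub>C\<^esub> f))\<rparr>"
  define \<epsilon> where "\<epsilon> = (\<lambda>a. ex a (Ide C a))"
  have L_obj [simp]: "FObj L x = R x" for x by (simp add: L_def)
  have L: "FArr L f \<in> Arr C" "Dom C (FArr L f) = R (Dom C f)" "Cod C (FArr L f) = R (Cod C f)"
    "FArr L f \<cdot>\<^bsub>C\<^esub> u (Dom C f) = u (Cod C f) \<cdot>\<^bsub>C\<^esub> f" if "f \<in> Arr C" for f
    unfolding L_def using that by (simp_all add: ex u R)
  have Lf: "FArr L f \<cdot>\<^bsub>C\<^esub> (u x \<cdot>\<^bsub>C\<^esub> t) = u (Cod C f) \<cdot>\<^bsub>C\<^esub> (f \<cdot>\<^bsub>C\<^esub> t)"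
    if "f \<in> Arr C" "Dom C f = x" "t \<in> Arr C" "Cod C t = x" for f x t
    by (rule C.comp_eq_extend) (use L[OF that(1)] that u C.dom_cod_obj[OF that(1)] in simp_all)
  have \<epsilon>: "\<epsilon> a \<in> Arr C" "Dom C (\<epsilon> a) = R a" "Cod C (\<epsilon> a) = a" "\<epsilon> a \<cdot>\<^bsub>C\<^esub> u a = Ide C a" if "a \<in> S" for a
    unfolding \<epsilon>_def using that S by (auto simp: ex)
  have \<epsilon>t: "\<epsilon> a \<cdot>\<^bsub>C\<^esub> (u a \<cdot>\<^bsub>C\<^esub> t) = t" if "a \<in> S" "t \<in> Arr C" "Cod C t = a" for a t
    using \<epsilon>[OF that(1)] u[of a] that S by (subst C.comp_eq_extend1[of "\<epsilon> a" "u a"]) auto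
  let ?D = "full_subcat C S"
  have cD: "category ?D" by (rule C.category_full_subcat[OF S])
  have "cat_functor C ?D L"
  proof (intro_locales)
    show "category ?D" by (rule cD)
    show "cat_functor_axioms C ?D L"
    proof
      fix x assume x: "x \<in> Obj C"
      thus "FObj L x \<in> Obj ?D" using R by simp
      show "FArr L (Ide C x) = Ide ?D (FObj L x)"
        by (rule eq[of x]) (use x L[OF C.ide_arr(1)[OF x]] R[OF x] u[OF x] in simp_all)
    next
      fix f x y assume "f \<in> hom C x y"
      thus "FArr L f \<in> hom ?D (FObj L x) (FObj L y)"
        using L[of f] R(1) C.dom_cod_obj[of f] by (auto simp: hom_iff)
    next
      fix f x y g z assume "f \<in> hom C x y" "g \<in> hom C y z"
      hence f: "f \<in> Arr C" "Dom C f = x" "Cod C f = y" "g \<in> Arr C" "Dom C g = y" "Cod C g = z" by (auto simp: hom_iff)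
      have o: "x \<in> Obj C" "y \<in> Obj C" "z \<in> Obj C" using f C.dom_cod_obj[of f] C.dom_cod_obj[of g] by auto
      have gf: "g \<cdot>\<^bsub>C\<^esub> f \<in> Arr C" "Dom C (g \<cdot>\<^bsub>C\<^esub> f) = x" "Cod C (g \<cdot>\<^bsub>C\<^esub> f) = z" using f by simp_all
      note Lgf = L[OF gf(1), unfolded gf]
      show "FArr L (g \<cdot>\<^bsub>C\<^esub> f) = FArr L g \<cdot>\<^bsub>?D\<^esub> FArr L f"
      proof (rule eq[of x])
        show "FArr L (g \<cdot>\<^bsub>C\<^esub> f) \<cdot>\<^bsub>C\<^esub> u x = (FArr L g \<cdot>\<^bsub>?D\<^esub> FArr L f) \<cdot>\<^bsub>C\<^esub> u x"
          using f o u L[OF f(1), unfolded f] L[OF f(4), unfolded f] Lgf by (simp add: Lf)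
      qed (use o R f L[OF f(1), unfolded f] L[OF f(4), unfolded f] Lgf in simp_all)
    qed
  qed
  moreover have "cat_functor ?D C id_ftor"
  proof (intro_locales)
    show "category ?D" by (rule cD)
    show "cat_functor_axioms ?D C id_ftor" by unfold_locales (use S in \<open>auto simp: hom_iff\<close>)
  qed
  moreover have "nat_trans C C id_ftor (comp_ftor id_ftor L) u"
    unfolding nat_trans_def by (simp add: u L hom_iff)
  moreover have "nat_trans ?D ?D (comp_ftor L id_ftor) id_ftor \<epsilon>"
    unfolding nat_trans_def
  proof (intro conjI ballI)
    fix a assume "a \<in> Obj ?D"
    thus "\<epsilon> a \<in> hom ?D (FObj (comp_ftor L id_ftor) a) (FObj id_ftor a)"
      using \<epsilon>[of a] R[of a] S by (auto simp: hom_iff)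
  next
    fix f assume "f \<in> Arr ?D"
    hence f: "f \<in> Arr C" "Dom C f \<in> S" "Cod C f \<in> S" by auto
    have o: "Dom C f \<in> Obj C" "Cod C f \<in> Obj C" using f by auto
    show "\<epsilon> (Cod ?D f) \<cdot>\<^bsub>?D\<^esub> FArr (comp_ftor L id_ftor) f = FArr id_ftor f \<cdot>\<^bsub>?D\<^esub> \<epsilon> (Dom ?D f)"
      by (rule eq[of "Dom C f"]) (use f o \<epsilon>[OF f(2)] \<epsilon>[OF f(3)] L[OF f(1)] u[OF o(1)] in \<open>simp_all add: \<epsilon>t\<close>)
  qed
  moreover have "\<epsilon> (FObj L x) \<cdot>\<^bsub>?D\<^esub> FArr L (u x) = Ide ?D (FObj L x)" if x: "x \<in> Obj C" for x
  proof -
    note R = R[OF x] and u = u[OF x]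
    show ?thesis
      by (rule eq[of x]) (use x R u \<epsilon>[OF R(1)] L[OF u(1), unfolded u] in \<open>simp_all add: \<epsilon>t\<close>)
  qed
  ultimately have "adjunction C ?D L id_ftor u \<epsilon>"
    unfolding adjunction_def by (simp add: \<epsilon>)
  thus ?thesis unfolding reflective_def reflector_def using S by blast
qed

lemma (in category) category_arrow_cat: "category (arrow_cat C)"
proof
  fix f assume "f \<in> Arr (arrow_cat C)"
  thus "Dom (arrow_cat C) f \<in> Obj (arrow_cat C)" "Cod (arrow_cat C) f \<in> Obj (arrow_cat C)"
    by (auto simp: arrow_cat_def)
next
  fix a assume "a \<in> Obj (arrow_cat C)"
  thus "Ide (arrow_cat C) a \<in> hom (arrow_cat C) a a" by (simp add: arrow_cat_def hom_iff)
next
  fix f a b g d assume "f \<in> hom (arrow_cat C) a b" "g \<in> hom (arrow_cat C) b d"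
  then obtain u v u' v' where f: "f = (a, (u, v), b)" and g: "g = (b, (u', v'), d)" and *: "a \<in> Arr C" "b \<in> Arr C" "d \<in> Arr C"
    "u \<in> Arr C" "Dom C u = Dom C a" "Cod C u = Dom C b" "v \<in> Arr C" "Dom C v = Cod C a" "Cod C v = Cod C b"
    "u' \<in> Arr C" "Dom C u' = Dom C b" "Cod C u' = Dom C d" "v' \<in> Arr C" "Dom C v' = Cod C b" "Cod C v' = Cod C d"
    and 1: "b \<cdot> u = v \<cdot> a" and 2: "d \<cdot> u' = v' \<cdot> b"
    by (auto simp: arrow_cat_def hom_iff)
  have "d \<cdot> (u' \<cdot> u) = v' \<cdot> (v \<cdot> a)" unfolding 1[symmetric] by (rule comp_eq_extend[OF 2]) (simp_all add: *)
  thus "g \<cdot>\<^bsub>arrow_cat C\<^esub> f \<in> hom (arrow_cat C) a d"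
    unfolding f g by (simp add: arrow_cat_def hom_iff *)
next
  fix f a b assume "f \<in> hom (arrow_cat C) a b"
  thus "f \<cdot>\<^bsub>arrow_cat C\<^esub> Ide (arrow_cat C) a = f" "Ide (arrow_cat C) b \<cdot>\<^bsub>arrow_cat C\<^esub> f = f"
    by (auto simp: arrow_cat_def hom_iff)
next
  fix f a b g d h e assume "f \<in> hom (arrow_cat C) a b" "g \<in> hom (arrow_cat C) b d" "h \<in> hom (arrow_cat C) d e"
  thus "(h \<cdot>\<^bsub>arrow_cat C\<^esub> g) \<cdot>\<^bsub>arrow_cat C\<^esub> f = h \<cdot>\<^bsub>arrow_cat C\<^esub> (g \<cdot>\<^bsub>arrow_cat C\<^esub> f)"
    by (auto simp: arrow_cat_def hom_iff)
qed

section \<open>Torsion theories satisfying (P) and (N)\<close>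

locale torsion = homcat C for C :: "('o, 'm) cat" (structure) +
  fixes \<T> \<F> :: "'o set" and F :: "('o, 'm, 'o, 'm) ftor" and \<eta> t :: "'o \<Rightarrow> 'm"
  assumes torsion_theory: "torsion_theory C \<T> \<F>"
    and torsion_reflector: "torsion_reflector C \<T> \<F> F \<eta> t"
    and protoadditive: "protoadditive C (full_subcat C \<F>) F"
    and N: "\<And>f k. f \<in> Arr C \<Longrightarrow> is_kernel C k f \<Longrightarrow> normal_mono C (k \<cdot> t (Dom C k))"
begin

abbreviation "Sub \<equiv> full_subcat C \<F>"

lemma F_obj: "X \<in> \<F> \<Longrightarrow> X \<in> Obj C" and T_obj: "X \<in> \<T> \<Longrightarrow> X \<in> Obj C"
  and F_replete: "replete C \<F>" and T_replete: "replete C \<T>"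
  using torsion_theory by (auto simp: torsion_theory_def)

lemma T_to_F:
  assumes "f \<in> Arr C" "Dom C f \<in> \<T>" "Cod C f \<in> \<F>" shows "f = zero_arr (Dom C f) (Cod C f)"
proof -
  have "f \<in> hom C (Dom C f) (Cod C f)" using assms by (simp add: hom_iff)
  hence "zero_mor C f" using torsion_theory assms(2,3) unfolding torsion_theory_def by blast
  thus ?thesis using assms(1) by (simp add: zero_mor_iff)
qed

text \<open>A reflector comes with a unit, but its counit is only known to exist. The adjunction is
  therefore opened inside single proofs, which export facts about the unit alone.\<close>

lemma counit_exists: "\<exists>\<epsilon>. adjn C Sub F id_ftor \<eta> \<epsilon>"
  using torsion_reflector unfolding torsion_reflector_def reflector_def adjn_def by blast

lemma functor_F: "cat_functor C Sub F"
  using protoadditive by (simp add: protoadditive_def)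

lemma F_simps [simp]:
  "A \<in> Obj C \<Longrightarrow> FObj F A \<in> \<F>" "A \<in> Obj C \<Longrightarrow> FObj F A \<in> Obj C"
  "f \<in> Arr C \<Longrightarrow> FArr F f \<in> Arr C" "f \<in> Arr C \<Longrightarrow> Dom C (FArr F f) = FObj F (Dom C f)"
  "f \<in> Arr C \<Longrightarrow> Cod C (FArr F f) = FObj F (Cod C f)"
proof -
  interpret F: cat_functor C Sub F by (rule functor_F)
  show "A \<in> Obj C \<Longrightarrow> FObj F A \<in> \<F>" using F.ftor_obj by simp
  thus "A \<in> Obj C \<Longrightarrow> FObj F A \<in> Obj C" using F_obj by blast
  show "f \<in> Arr C \<Longrightarrow> FArr F f \<in> Arr C" "f \<in> Arr C \<Longrightarrow> Dom C (FArr F f) = FObj F (Dom C f)"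
    "f \<in> Arr C \<Longrightarrow> Cod C (FArr F f) = FObj F (Cod C f)"
    using F.ftor_simps by simp_all
qed

lemma unit_simps [simp]:
  assumes "A \<in> Obj C" shows "\<eta> A \<in> Arr C" "Dom C (\<eta> A) = A" "Cod C (\<eta> A) = FObj F A"
proof -
  obtain \<epsilon> where "adjn C Sub F id_ftor \<eta> \<epsilon>" using counit_exists by blast
  then interpret adjn C Sub F id_ftor \<eta> \<epsilon> .
  show "\<eta> A \<in> Arr C" "Dom C (\<eta> A) = A" "Cod C (\<eta> A) = FObj F A" using unit_typ[OF assms] by simp_all
qed

lemma unit_natural:
  assumes "f \<in> Arr C" shows "\<eta> (Cod C f) \<cdot> f = FArr F f \<cdot> \<eta> (Dom C f)"
proof -
  obtain \<epsilon> where "adjn C Sub F id_ftor \<eta> \<epsilon>" using counit_exists by blast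
  then interpret adjn C Sub F id_ftor \<eta> \<epsilon> .
  show ?thesis using unit_nat[OF assms] by simp
qed

lemma reflect:
  assumes f: "f \<in> Arr C" "Cod C f \<in> \<F>"
  obtains g where "g \<in> Arr C" "Dom C g = FObj F (Dom C f)" "Cod C g = Cod C f" "g \<cdot> \<eta> (Dom C f) = f"
proof -
  obtain \<epsilon> where "adjn C Sub F id_ftor \<eta> \<epsilon>" using counit_exists by blast
  then interpret adjn C Sub F id_ftor \<eta> \<epsilon> .
  let ?B = "Cod C f"
  have o: "?B \<in> Obj C" using f by simp
  have e: "\<epsilon> ?B \<in> Arr C" "Dom C (\<epsilon> ?B) = FObj F ?B" "Cod C (\<epsilon> ?B) = ?B" using counit_typ[of ?B] f by simp_all
  have tr: "\<epsilon> ?B \<cdot> \<eta> ?B = Ide C ?B" using triangle_U[of ?B] f by simp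
  have "(\<epsilon> ?B \<cdot> FArr F f) \<cdot> \<eta> (Dom C f) = \<epsilon> ?B \<cdot> (\<eta> ?B \<cdot> f)"
    using e f by (simp add: unit_natural)
  also have "\<dots> = f" using e f o by (simp add: comp_eq_extend1[OF tr])
  finally show ?thesis using e f by (intro that[of "\<epsilon> ?B \<cdot> FArr F f"]) simp_all
qed

lemma reflect_unique:
  assumes "A \<in> Obj C" "g \<in> Arr C" "h \<in> Arr C" "Dom C g = FObj F A" "Dom C h = FObj F A" "Cod C g = Cod C h" "Cod C g \<in> \<F>"
    "g \<cdot> \<eta> A = h \<cdot> \<eta> A"
  shows "g = h"
proof -
  obtain \<epsilon> where "adjn C Sub F id_ftor \<eta> \<epsilon>" using counit_exists by blast
  then interpret adjn C Sub F id_ftor \<eta> \<epsilon> .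
  show ?thesis by (rule transpose_inj[of A]) (use assms in simp_all)
qed

lemma torsion_part:
  assumes "A \<in> Obj C"
  shows "is_kernel C (t A) (\<eta> A)" "is_cokernel C (\<eta> A) (t A)" "Dom C (t A) \<in> \<T>"
    "t A \<in> Arr C" "Cod C (t A) = A"
proof -
  show 1: "is_kernel C (t A) (\<eta> A)" "is_cokernel C (\<eta> A) (t A)" "Dom C (t A) \<in> \<T>"
    using torsion_reflector assms unfolding torsion_reflector_def short_exact_def by auto
  show "t A \<in> Arr C" "Cod C (t A) = A" using kernelD[OF 1(1)] assms by auto
qed

section \<open>Closure properties of torsion and torsion-free objects\<close>

lemma unit_iso_F:
  assumes A: "A \<in> \<F>" shows "is_iso C (\<eta> A)"
proof -
  have o [simp]: "A \<in> Obj C" using A F_obj by blast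
  obtain g where g: "g \<in> Arr C" "Dom C g = FObj F A" "Cod C g = A" "g \<cdot> \<eta> A = Ide C A"
    using reflect[of "Ide C A"] A by auto
  have "\<eta> A \<cdot> g = Ide C (FObj F A)"
    by (rule reflect_unique[of A]) (use g in simp_all)
  thus ?thesis using g by (intro isoI[of _ g]) simp_all
qed

text \<open>The unit is a cokernel of \<open>t A\<close>; if \<open>t A\<close> vanishes, the
  identity factors through that cokernel, so the unit is invertible.\<close>

lemma in_F_if_torsion_part_zero:
  assumes o [simp]: "A \<in> Obj C" and z: "t A = zero_arr (Dom C (t A)) A" shows "A \<in> \<F>"
proof -
  note tp = torsion_part[OF o]
  have 1: "Ide C A \<cdot> t A = zero_arr (Dom C (t A)) (Cod C (Ide C A))" using z tp by simp
  obtain w where w: "w \<in> Arr C" "Dom C w = Cod C (\<eta> A)" "Cod C w = Cod C (Ide C A)" "w \<cdot> \<eta> A = Ide C A"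
    by (rule cokernel_factor[OF tp(2), of "Ide C A"]) (use 1 tp in simp_all)
  have "\<eta> A \<cdot> w = Ide C (FObj F A)"
    by (rule epicD[OF regular_epi_epic[OF cokernel_regular_epi[OF tp(2)]]]) (use w in simp_all)
  hence "is_iso C w" using w by (intro isoI[of w "\<eta> A"]) simp_all
  moreover have "Dom C w \<in> \<F>" "Cod C w = A" using w by simp_all
  ultimately show ?thesis using F_replete unfolding replete_def by blast
qed

text \<open>The torsion part of the middle object is killed by \<open>x\<close>, so it factors
  through the kernel; being an arrow from a torsion to a torsion-free object, the factor is
  zero.\<close>

lemma F_extension:
  assumes x [simp]: "x \<in> Arr C" and cod: "Cod C x \<in> \<F>" and k: "is_kernel C k x" and dom: "Dom C k \<in> \<F>"
  shows "Dom C x \<in> \<F>"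
proof (rule in_F_if_torsion_part_zero)
  let ?A = "Dom C x"
  note tp = torsion_part[of ?A, simplified]
  have ob [simp]: "Dom C (t ?A) \<in> Obj C" using tp by simp
  note [simp] = tp(4,5) kernelD[OF k]
  have "x \<cdot> t ?A = zero_arr (Dom C (x \<cdot> t ?A)) (Cod C (x \<cdot> t ?A))" by (rule T_to_F) (use tp cod in simp_all)
  hence xt: "x \<cdot> t ?A = zero_arr (Dom C (t ?A)) (Cod C x)" by simp
  obtain u where u: "u \<in> Arr C" "Dom C u = Dom C (t ?A)" "Cod C u = Dom C k" "k \<cdot> u = t ?A"
    by (rule kernel_factor[OF k, of "t ?A"]) (simp_all add: xt)
  have "u = zero_arr (Dom C u) (Cod C u)" by (rule T_to_F) (use u tp dom in simp_all)
  hence "u = zero_arr (Dom C (t ?A)) (Dom C k)" using u by simp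
  hence "k \<cdot> zero_arr (Dom C (t ?A)) (Dom C k) = t ?A" using u(4) by simp
  thus "t ?A = zero_arr (Dom C (t ?A)) ?A" by simp
qed simp

text \<open>The composite of \<open>x\<close> with the torsion part runs from torsion to
  torsion-free, hence is zero, and \<open>x\<close> can be cancelled.\<close>

lemma F_sub:
  assumes m: "monic x" and cod: "Cod C x \<in> \<F>" shows "Dom C x \<in> \<F>"
proof (rule in_F_if_torsion_part_zero)
  have [simp]: "x \<in> Arr C" using m by (simp add: monic_def)
  let ?A = "Dom C x"
  note tp = torsion_part[of ?A, simplified]
  have ob [simp]: "Dom C (t ?A) \<in> Obj C" using tp by simp
  note [simp] = tp(4,5)
  have "x \<cdot> t ?A = zero_arr (Dom C (x \<cdot> t ?A)) (Cod C (x \<cdot> t ?A))" by (rule T_to_F) (use tp cod in simp_all)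
  hence xt: "x \<cdot> t ?A = zero_arr (Dom C (t ?A)) (Cod C x)" by simp
  show "t ?A = zero_arr (Dom C (t ?A)) ?A"
    by (rule monicD[OF m]) (simp_all add: xt)
qed (use m in \<open>simp add: monic_def\<close>)

text \<open>If the unit vanishes, the identity factors through its kernel \<open>t A\<close>, which
  is then a split monomorphism and so an isomorphism from a torsion object.\<close>

lemma in_T_if_unit_zero:
  assumes o [simp]: "A \<in> Obj C" and z: "\<eta> A = zero_arr A (FObj F A)" shows "A \<in> \<T>"
proof -
  note tp = torsion_part[OF o]
  have 1: "\<eta> A \<cdot> Ide C A = zero_arr A (FObj F A)" using z by simp
  obtain u where u: "u \<in> Arr C" "Dom C u = Dom C (Ide C A)" "Cod C u = Dom C (t A)" "t A \<cdot> u = Ide C A"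
    by (rule kernel_factor[OF tp(1), of "Ide C A"]) (use 1 in simp_all)
  have "is_iso C (t A)" by (rule monic_split_iso[OF kernel_monic[OF tp(1)], of u]) (use u tp in simp_all)
  thus ?thesis using T_replete tp unfolding replete_def by metis
qed

lemma Z_in_F: "Z \<in> \<F>"
proof (rule in_F_if_torsion_part_zero)
  note tp = torsion_part[of Z, simplified]
  have "Dom C (t Z) \<in> Obj C" using tp by simp
  hence "zero_arr (Dom C (t Z)) Z = to_Z (Dom C (t Z))" using to_Z_eq[of "zero_arr (Dom C (t Z)) Z"] by simp
  thus "t Z = zero_arr (Dom C (t Z)) Z" using to_Z_eq[of "t Z"] tp by simp
qed simp

section \<open>Kernels in the torsion-free subcategory\<close>

lemma zero_mor_Sub:
  assumes f: "f \<in> Arr C" "Dom C f \<in> \<F>" "Cod C f \<in> \<F>"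
  shows "zero_mor Sub f \<longleftrightarrow> f = zero_arr (Dom C f) (Cod C f)"
proof
  assume "zero_mor Sub f"
  then obtain Y g h where z: "zero_obj Sub Y" and g: "g \<in> hom Sub (Dom C f) Y" and h: "h \<in> hom Sub Y (Cod C f)" and fhg: "f = h \<cdot> g"
    unfolding zero_mor_def by auto
  have Y: "Y \<in> \<F>" using z by (simp add: zero_obj_def)
  hence [simp]: "Y \<in> Obj C" by (rule F_obj)
  have [simp]: "g \<in> Arr C" "Dom C g = Dom C f" "Cod C g = Y" "h \<in> Arr C" "Dom C h = Y" "Cod C h = Cod C f"
    using g h by (auto simp: hom_iff)
  have "\<exists>!k. k \<in> hom Sub Y Y" using z by (simp add: zero_obj_def)
  moreover have "Ide C Y \<in> hom Sub Y Y" "zero_arr Y Y \<in> hom Sub Y Y" using Y by (auto simp: hom_iff)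
  ultimately have i: "Ide C Y = zero_arr Y Y" by blast
  have "f = h \<cdot> (Ide C Y \<cdot> g)" using fhg by simp
  also have "\<dots> = zero_arr (Dom C f) (Cod C f)" unfolding i using f by simp
  finally show "f = zero_arr (Dom C f) (Cod C f)" .
next
  assume z: "f = zero_arr (Dom C f) (Cod C f)"
  have "zero_obj Sub Z"
    unfolding zero_obj_def
  proof (intro conjI ballI)
    fix A assume A: "A \<in> Obj Sub"
    hence o: "A \<in> Obj C" using F_obj by simp
    show "\<exists>!f. f \<in> hom Sub A Z"
      using A o Z_in_F to_Z_eq by (intro ex1I[of _ "to_Z A"]) (auto simp: hom_iff)
    show "\<exists>!f. f \<in> hom Sub Z A"
      using A o Z_in_F from_Z_eq by (intro ex1I[of _ "from_Z A"]) (auto simp: hom_iff)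
  qed (use Z_in_F in simp)
  thus "zero_mor Sub f"
    unfolding zero_mor_def using f z Z_in_F
    by (intro conjI exI[of _ Z] exI[of _ "to_Z (Dom C f)"] exI[of _ "from_Z (Cod C f)"]) (simp_all add: hom_iff zero_arr_def)
qed

text \<open>Protoadditivity yields kernels within the subcategory only. As it is reflective, arrows
  from any object into torsion-free ones factor uniquely through the unit, so testing against
  torsion-free objects is enough.\<close>

lemma kernel_Sub:
  assumes k: "is_kernel Sub k f" shows "is_kernel C k f"
proof -
  have [simp]: "k \<in> Arr C" "f \<in> Arr C" "Cod C k = Dom C f" and inF: "Dom C k \<in> \<F>" "Dom C f \<in> \<F>" "Cod C f \<in> \<F>"
    and z: "zero_mor Sub (f \<cdot> k)"
    using k unfolding is_kernel_def by auto
  have uni: "\<exists>!u. u \<in> hom C (Dom C x) (Dom C k) \<and> k \<cdot> u = x"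
    if x: "x \<in> Arr C" "Cod C x = Dom C f" "Dom C x \<in> \<F>" "f \<cdot> x = zero_arr (Dom C x) (Cod C f)" for x
  proof -
    have "zero_mor Sub (f \<cdot> x)" using x inF by (subst zero_mor_Sub) simp_all
    moreover have "x \<in> Arr Sub" using x inF by simp
    ultimately have "\<exists>!u. u \<in> hom Sub (Dom C x) (Dom C k) \<and> k \<cdot> u = x"
      using k x(2) unfolding is_kernel_def by simp
    moreover have "u \<in> hom Sub (Dom C x) (Dom C k) \<longleftrightarrow> u \<in> hom C (Dom C x) (Dom C k)" for u
      using x(3) inF by (auto simp: hom_iff)
    ultimately show ?thesis by simp
  qed
  have fk: "f \<cdot> k = zero_arr (Dom C k) (Cod C f)" using z inF by (simp add: zero_mor_Sub)
  have cancel: "u = v" if u: "u \<in> Arr C" "v \<in> Arr C" "Dom C u = Dom C v" "Cod C u = Dom C k" "Cod C v = Dom C k" "k \<cdot> u = k \<cdot> v"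
    and d: "Dom C v \<in> \<F>" for u v
  proof -
    have o: "Dom C v \<in> Obj C" using u by simp
    have "\<exists>!w. w \<in> hom C (Dom C (k \<cdot> v)) (Dom C k) \<and> k \<cdot> w = k \<cdot> v"
      by (rule uni) (use u d in \<open>simp_all add: comp_eq_extend1[OF fk]\<close>)
    thus ?thesis using u by (auto simp: hom_iff)
  qed
  show ?thesis
  proof (rule kernelI)
    show "monic k" unfolding monic_def
    proof (intro conjI ballI impI)
      fix u v assume u: "u \<in> Arr C" "v \<in> Arr C" "Dom C u = Dom C v" "Cod C u = Dom C k" "Cod C v = Dom C k" "k \<cdot> u = k \<cdot> v"
      have o [simp]: "Dom C v \<in> Obj C" using u by simp
      obtain u' where u': "u' \<in> Arr C" "Dom C u' = FObj F (Dom C u)" "Cod C u' = Cod C u" "u' \<cdot> \<eta> (Dom C u) = u"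
        by (rule reflect[of u]) (use u inF in simp_all)
      obtain v' where v': "v' \<in> Arr C" "Dom C v' = FObj F (Dom C v)" "Cod C v' = Cod C v" "v' \<cdot> \<eta> (Dom C v) = v"
        by (rule reflect[of v]) (use u inF in simp_all)
      have kuv: "k \<cdot> u' = k \<cdot> v'"
        by (rule reflect_unique[of "Dom C v"]) (use u u' v' inF in simp_all)
      have "u' = v'" by (rule cancel) (use u(1-5) u'(1-3) v'(1-3) kuv in simp_all)
      thus "u = v" using u'(4) v'(4) u(3) by metis
    qed simp
    fix x assume x: "x \<in> Arr C" "Cod C x = Dom C f" "f \<cdot> x = zero_arr (Dom C x) (Cod C f)"
    have o [simp]: "Dom C x \<in> Obj C" using x by simp
    obtain x' where x': "x' \<in> Arr C" "Dom C x' = FObj F (Dom C x)" "Cod C x' = Cod C x" "x' \<cdot> \<eta> (Dom C x) = x"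
      by (rule reflect[of x]) (use x inF in simp_all)
    have "f \<cdot> x' = zero_arr (FObj F (Dom C x)) (Cod C f)"
      by (rule reflect_unique[of "Dom C x"]) (use x x' inF in simp_all)
    hence "\<exists>!u. u \<in> hom C (Dom C x') (Dom C k) \<and> k \<cdot> u = x'"
      by (intro uni) (use x x' in simp_all)
    then obtain u where u: "u \<in> Arr C" "Dom C u = Dom C x'" "Cod C u = Dom C k" "k \<cdot> u = x'" by (auto simp: hom_iff)
    show "\<exists>u. u \<in> Arr C \<and> Dom C u = Dom C x \<and> Cod C u = Dom C k \<and> k \<cdot> u = x"
      using u x' by (intro exI[of _ "u \<cdot> \<eta> (Dom C x)"]) (simp add: comp_eq_extend1[OF u(4)])
  qed (simp_all add: fk)
qed

section \<open>Inverted morphisms, normal extensions and the factorisation\<close>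

lemma inverted_iff: "f \<in> inverted C Sub F \<longleftrightarrow> f \<in> Arr C \<and> is_iso C (FArr F f)"
  by (auto simp: inverted_def is_iso_full_subcat)

lemma E_bar_iff: "e \<in> E_bar C \<T> \<longleftrightarrow> regular_epi C e \<and> kernel_obj_in C e \<T>"
  by (simp add: E_bar_def normal_epi_iff)

text \<open>The unit at the domain kills the torsion kernel, so it factors through \<open>e\<close>,
  the cokernel of that kernel; reflecting the factor gives the inverse of
  \<open>FArr F e\<close>.\<close>

lemma torsion_kernel_inverted:
  assumes e: "regular_epi C e" and k: "is_kernel C k e" and T: "Dom C k \<in> \<T>"
  shows "is_iso C (FArr F e)"
proof -
  note [simp] = kernelD[OF k]
  let ?A = "Dom C e" and ?I = "Cod C e"
  have "\<eta> ?A \<cdot> k = zero_arr (Dom C (\<eta> ?A \<cdot> k)) (Cod C (\<eta> ?A \<cdot> k))" by (rule T_to_F) (use T in simp_all)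
  hence 1: "\<eta> ?A \<cdot> k = zero_arr (Dom C k) (Cod C (\<eta> ?A))" by simp
  obtain w where w: "w \<in> Arr C" "Dom C w = Cod C e" "Cod C w = Cod C (\<eta> ?A)" "w \<cdot> e = \<eta> ?A"
    by (rule cokernel_factor[OF regular_epi_cokernel[OF e k], of "\<eta> ?A"]) (use 1 in simp_all)
  obtain v where v: "v \<in> Arr C" "Dom C v = FObj F (Dom C w)" "Cod C v = Cod C w" "v \<cdot> \<eta> (Dom C w) = w"
    by (rule reflect[of w]) (use w in simp_all)
  have nat: "\<eta> ?I \<cdot> e = FArr F e \<cdot> \<eta> ?A" using unit_natural[of e] by simp
  have vFe: "v \<cdot> FArr F e = Ide C (FObj F ?A)"
  proof (rule reflect_unique[of ?A])
    have "v \<cdot> (\<eta> ?I \<cdot> e) = w \<cdot> e" by (rule comp_eq_extend1) (use v w in simp_all)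
    thus "(v \<cdot> FArr F e) \<cdot> \<eta> ?A = Ide C (FObj F ?A) \<cdot> \<eta> ?A" using v(1-3) w by (simp add: nat)
  qed (use v w in simp_all)
  have "FArr F e \<cdot> v = Ide C (FObj F ?I)"
  proof (rule reflect_unique[of ?I])
    have "(FArr F e \<cdot> w) \<cdot> e = \<eta> ?I \<cdot> e" using w by (simp add: nat)
    hence "FArr F e \<cdot> w = \<eta> ?I" using w by - (rule epicD[OF regular_epi_epic[OF e]]; simp)
    thus "(FArr F e \<cdot> v) \<cdot> \<eta> ?I = Ide C (FObj F ?I) \<cdot> \<eta> ?I" using v w by simp
  qed (use v w in simp_all)
  thus ?thesis using v w vFe by (intro isoI[of _ v]) simp_all
qed

text \<open>Regular epimorphisms are stable under pullback, and pulling back leaves the kernel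
  object unchanged up to isomorphism.\<close>

lemma E_bar_stably:
  assumes e: "e \<in> E_bar C \<T>" shows "e \<in> stably C (inverted C Sub F)"
  unfolding stably_def
proof (intro CollectI conjI allI impI)
  have re: "regular_epi C e" and ke: "kernel_obj_in C e \<T>" using e by (auto simp: E_bar_iff)
  show "e \<in> Arr C" by (rule regular_epi_arr[OF re])
  fix g p q assume pb: "is_pullback C p q e g"
  have q: "q \<in> Arr C" using pbD[OF pb] by simp
  obtain k where k: "is_kernel C k q" using kernel_exists[OF q] .
  have "Dom C (p \<cdot> k) \<in> \<T>" by (rule kernel_obj_in_kernel[OF T_replete ke kernel_of_pullback[OF pb k]])
  moreover have "Dom C (p \<cdot> k) = Dom C k" using pbD[OF pb] kernelD[OF k] by simp
  ultimately have "is_iso C (FArr F q)"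
    by (intro torsion_kernel_inverted[OF regular_epi_pb[OF pb re] k]) simp
  thus "q \<in> inverted C Sub F" using q by (simp add: inverted_iff)
qed

text \<open>A kernel pair projection \<open>q\<close> has the same kernel object as \<open>f\<close>
  and is split. From left to right the kernel embeds into a reflected object; from right to left
  protoadditivity and the split short five lemma show the naturality square of \<open>q\<close> to
  be a pullback.\<close>

lemma normal_extension_iff:
  assumes f: "effective_descent C f"
  shows "normal_extension C F \<eta> f \<longleftrightarrow> kernel_obj_in C f \<F>"
proof
  assume "normal_extension C F \<eta> f"
  then obtain p q where pb: "is_pullback C p q f f" and tr: "is_pullback C q (\<eta> (Dom C q)) (\<eta> (Cod C q)) (FArr F q)"
    unfolding normal_extension_def trivial_extension_def by blast
  have [simp]: "p \<in> Arr C" "q \<in> Arr C" "Dom C p = Dom C q" using pbD[OF pb] by auto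
  obtain k where k: "is_kernel C k q" using kernel_exists[of q] by auto
  note [simp] = kernelD(1,3)[OF k]
  \<comment> \<open>Because the naturality square is a pullback, this composite is a kernel of
    \<open>FArr F q\<close>. It embeds the kernel of \<open>q\<close> in a torsion-free
    object.\<close>
  have "monic (\<eta> (Dom C q) \<cdot> k)" by (rule kernel_monic[OF kernel_of_pullback[OF pb_swap[OF tr] k]])
  from F_sub[OF this] have "Dom C k \<in> \<F>" by simp
  moreover have "is_kernel C (p \<cdot> k) f" by (rule kernel_of_pullback[OF pb k])
  ultimately show "kernel_obj_in C f \<F>" unfolding kernel_obj_in_def by (intro exI[of _ "p \<cdot> k"]) simp
next
  assume kF: "kernel_obj_in C f \<F>"
  have [simp]: "f \<in> Arr C" using f by (simp add: effective_descent_def)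
  interpret F: cat_functor C Sub F by (rule functor_F)
  obtain p q where pb: "is_pullback C p q f f" using pb_exists[of f f] by auto
  have [simp]: "p \<in> Arr C" "q \<in> Arr C" "Dom C p = Dom C q" "Cod C p = Dom C f" "Cod C q = Dom C f" using pbD[OF pb] by auto
  let ?R = "Dom C q" and ?A = "Dom C f"
  obtain k where k: "is_kernel C k q" using kernel_exists[of q] by auto
  let ?K = "Dom C k"
  note [simp] = kernelD[OF k]
  have KF: "?K \<in> \<F>"
    using kernel_obj_in_kernel[OF F_replete kF kernel_of_pullback[OF pb k]] by simp
  \<comment> \<open>The diagonal splits \<open>q\<close>, which brings the sequence within reach of
    protoadditivity.\<close>
  define s where "s = pair p q (Ide C ?A) (Ide C ?A)"
  have s [simp]: "s \<in> Arr C" "Dom C s = ?A" "Cod C s = ?R" and qs: "q \<cdot> s = Ide C ?A"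
    unfolding s_def by (simp_all add: pair[OF pb])
  have sse: "split_short_exact C k q s" using k qs by (simp add: split_short_exact_def hom_iff)
  hence Fsse: "split_short_exact Sub (FArr F k) (FArr F q) (FArr F s)"
    using protoadditive unfolding protoadditive_def by blast
  have Fk: "is_kernel C (FArr F k) (FArr F q)" using Fsse unfolding split_short_exact_def by (intro kernel_Sub) blast
  have Fqs: "FArr F q \<cdot> FArr F s = Ide C (FObj F ?A)" using Fsse unfolding split_short_exact_def by simp
  have Fqk: "FArr F q \<cdot> FArr F k = zero_arr (FObj F ?K) (FObj F ?A)" using kernelD(4)[OF Fk] by simp
  obtain a b where P: "is_pullback C a b (\<eta> ?A) (FArr F q)" using pb_exists[of "\<eta> ?A" "FArr F q"] by auto
  have [simp]: "a \<in> Arr C" "b \<in> Arr C" "Dom C a = Dom C b" "Cod C a = ?A" "Cod C b = FObj F ?R" using pbD[OF P] by auto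
  have natq: "\<eta> ?A \<cdot> q = FArr F q \<cdot> \<eta> ?R" using unit_natural[of q] by simp
  have natk: "\<eta> ?R \<cdot> k = FArr F k \<cdot> \<eta> ?K" using unit_natural[of k] by simp
  \<comment> \<open>Comparison of the naturality square with a genuine pullback of
    \<open>FArr F q\<close> along the unit; the square is a pullback once \<phi> is
    invertible.\<close>
  define \<phi> where "\<phi> = pair a b q (\<eta> ?R)"
  have \<phi> [simp]: "\<phi> \<in> Arr C" "Dom C \<phi> = ?R" "Cod C \<phi> = Dom C b" and a\<phi>: "a \<cdot> \<phi> = q" and b\<phi>: "b \<cdot> \<phi> = \<eta> ?R"
    unfolding \<phi>_def by (simp_all add: pair[OF P] natq)
  have a1: "a \<cdot> (\<phi> \<cdot> s) = Ide C ?A" by (simp add: comp_eq_extend1[OF a\<phi>] qs)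
  obtain i where i: "i \<in> Arr C" "Dom C i = FObj F ?K" "Cod C i = ?K" "\<eta> ?K \<cdot> i = Ide C (FObj F ?K)" "i \<cdot> \<eta> ?K = Ide C ?K"
    by (rule isoE[OF unit_iso_F[OF KF]]) simp
  \<comment> \<open>The kernel of \<open>a\<close> is that of \<open>FArr F q\<close>, namely the
    reflection of the kernel of \<open>q\<close>. That kernel is torsion-free, so its unit, with
    inverse \<open>i\<close>, identifies the two.\<close>
  have ak: "is_kernel C (\<phi> \<cdot> k) a"
  proof (rule kernelI)
    show "a \<cdot> (\<phi> \<cdot> k) = zero_arr (Dom C (\<phi> \<cdot> k)) (Cod C a)" by (simp add: comp_eq_extend1[OF a\<phi>])
    have "monic (\<eta> ?K)" unfolding monic_def
    proof (intro conjI ballI impI)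
      fix u v assume u: "u \<in> Arr C" "v \<in> Arr C" "Dom C u = Dom C v" "Cod C u = Dom C (\<eta> ?K)" "Cod C v = Dom C (\<eta> ?K)" "\<eta> ?K \<cdot> u = \<eta> ?K \<cdot> v"
      have "i \<cdot> (\<eta> ?K \<cdot> u) = i \<cdot> (\<eta> ?K \<cdot> v)" by (simp only: u(6))
      thus "u = v" using u(1-5) i by (simp add: comp_eq_extend1[OF i(5)])
    qed simp
    hence "monic (FArr F k \<cdot> \<eta> ?K)" using kernel_monic[OF Fk] by (intro monic_comp) simp_all
    moreover have "b \<cdot> (\<phi> \<cdot> k) = FArr F k \<cdot> \<eta> ?K" by (simp add: comp_eq_extend1[OF b\<phi>] natk)
    ultimately show "monic (\<phi> \<cdot> k)" by - (rule monic_cancel[of b]; simp)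
    fix x assume x: "x \<in> Arr C" "Cod C x = Dom C a" "a \<cdot> x = zero_arr (Dom C x) (Cod C a)"
    have Fqb: "FArr F q \<cdot> (b \<cdot> x) = zero_arr (Dom C x) (FObj F ?A)" using x by (simp add: pb_comm[OF P, symmetric])
    obtain u where u: "u \<in> Arr C" "Dom C u = Dom C (b \<cdot> x)" "Cod C u = Dom C (FArr F k)" "FArr F k \<cdot> u = b \<cdot> x"
      by (rule kernel_factor[OF Fk, of "b \<cdot> x"]) (use x Fqb in simp_all)
    have "(\<phi> \<cdot> k) \<cdot> (i \<cdot> u) = x"
    proof (rule pb_ext[OF P])
      show "a \<cdot> ((\<phi> \<cdot> k) \<cdot> (i \<cdot> u)) = a \<cdot> x" using u i x by (simp add: comp_eq_extend1[OF a\<phi>] comp_eq_extend1[OF kernelD(4)[OF k]])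
      have "\<eta> ?R \<cdot> (k \<cdot> (i \<cdot> u)) = FArr F k \<cdot> (\<eta> ?K \<cdot> (i \<cdot> u))" by (rule comp_eq_extend[OF natk]) (use i u in simp_all)
      also have "\<eta> ?K \<cdot> (i \<cdot> u) = u" using i u x by (simp add: comp_eq_extend1[OF i(4)])
      finally show "b \<cdot> ((\<phi> \<cdot> k) \<cdot> (i \<cdot> u)) = b \<cdot> x" using u i x by (simp add: comp_eq_extend1[OF b\<phi>])
    qed (use u i x in simp_all)
    thus "\<exists>u. u \<in> Arr C \<and> Dom C u = Dom C x \<and> Cod C u = Dom C (\<phi> \<cdot> k) \<and> (\<phi> \<cdot> k) \<cdot> u = x"
      using u i x by (intro exI[of _ "i \<cdot> u"]) simp
  qed simp_all
  have sse': "split_short_exact C (\<phi> \<cdot> k) a (\<phi> \<cdot> s)" using ak a1 by (simp add: split_short_exact_def hom_iff)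
  have "is_iso C \<phi>"
    by (rule split_five[OF sse sse', of "Ide C ?K" \<phi> "Ide C ?A"]) (simp_all add: a\<phi>)
  hence "is_pullback C (a \<cdot> \<phi>) (b \<cdot> \<phi>) (\<eta> ?A) (FArr F q)" by (rule pb_iso[OF P]) simp
  hence "trivial_extension C F \<eta> q" by (simp add: trivial_extension_def a\<phi> b\<phi>)
  thus "normal_extension C F \<eta> f" using f pb unfolding normal_extension_def by blast
qed

lemma NExt_iff: "f \<in> NExt C F \<eta> \<longleftrightarrow> effdesc f \<and> kernel_obj_in C f \<F>"
  using normal_extension_iff effective_descent_iff unfolding NExt_def normal_extension_def by auto

text \<open>On the kernel of \<open>e\<close> the arrow \<open>a\<close> lands in the kernel of
  \<open>g\<close>; from torsion to torsion-free it is zero, so \<open>a\<close> factors through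
  \<open>e\<close>, the cokernel of its kernel.\<close>

lemma orthogonal:
  assumes e: "e \<in> E_bar C \<T>" and g: "kernel_obj_in C g \<F>"
    and [simp]: "g \<in> Arr C" "a \<in> Arr C" "c \<in> Arr C" "Dom C a = Dom C e" "Cod C a = Dom C g" "Dom C c = Cod C e" "Cod C c = Cod C g"
    and eq: "g \<cdot> a = c \<cdot> e"
  obtains d where "d \<in> Arr C" "Dom C d = Cod C e" "Cod C d = Dom C g" "d \<cdot> e = a" "g \<cdot> d = c"
proof -
  have re: "regular_epi C e" using e by (simp add: E_bar_iff)
  obtain k where k: "is_kernel C k e" "Dom C k \<in> \<T>" using e by (auto simp: E_bar_iff kernel_obj_in_def)
  obtain kg where kg: "is_kernel C kg g" "Dom C kg \<in> \<F>" using g by (auto simp: kernel_obj_in_def)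
  note [simp] = kernelD[OF k(1)] kernelD[OF kg(1)]
  have gak: "g \<cdot> (a \<cdot> k) = zero_arr (Dom C k) (Cod C g)" by (simp add: comp_eq_extend[OF eq])
  obtain u where u: "u \<in> Arr C" "Dom C u = Dom C (a \<cdot> k)" "Cod C u = Dom C kg" "kg \<cdot> u = a \<cdot> k"
    by (rule kernel_factor[OF kg(1), of "a \<cdot> k"]) (simp_all add: gak)
  have "u = zero_arr (Dom C u) (Cod C u)" by (rule T_to_F) (use u k kg in simp_all)
  hence uz: "u = zero_arr (Dom C k) (Dom C kg)" using u by simp
  have ak: "a \<cdot> k = zero_arr (Dom C k) (Cod C a)" unfolding u(4)[symmetric] uz by simp
  obtain d where d: "d \<in> Arr C" "Dom C d = Cod C e" "Cod C d = Cod C a" "d \<cdot> e = a"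
    by (rule cokernel_factor[OF regular_epi_cokernel[OF re k(1)], of a]) (simp_all add: ak)
  have "(g \<cdot> d) \<cdot> e = c \<cdot> e" using d eq by simp
  hence "g \<cdot> d = c" using d by - (rule epicD[OF regular_epi_epic[OF re]]; simp)
  thus ?thesis using that d by simp
qed

text \<open>Dividing out the torsion part of the kernel leaves a kernel isomorphic to the reflection
  of the original one.\<close>

lemma factorisation_exists:
  assumes f [simp]: "f \<in> Arr C"
  obtains m e where "factors_as C (E_bar C \<T>) (M_bar C \<F>) f m e"
proof -
  obtain k where k: "is_kernel C k f" using kernel_exists[OF f] .
  note [simp] = kernelD[OF k]
  let ?K = "Dom C k"
  have K: "?K \<in> Obj C" by simp
  note tp = torsion_part[OF K]
  note [simp] = tp(4,5)
  define n where "n = k \<cdot> t ?K"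
  \<comment> \<open>The only use of (N): the torsion part of the kernel of \<open>f\<close>,
    included in the domain of \<open>f\<close>, is a kernel of some \<open>g\<close>.\<close>
  obtain g where g: "is_kernel C n g" using N[OF f k] unfolding normal_mono_def n_def by blast
  have [simp]: "n \<in> Arr C" "Dom C n = Dom C (t ?K)" "Cod C n = Dom C f" by (simp_all add: n_def)
  have [simp]: "g \<in> Arr C" "Dom C g = Dom C f" using kernelD[OF g] by auto
  \<comment> \<open>The quotient is the regular image of \<open>g\<close>. Since \<open>m'\<close>
    is monic, \<open>n\<close> is still the kernel of \<open>e\<close>, and \<open>e\<close> is
    therefore its cokernel.\<close>
  obtain e m' where re: "regular_epi C e" and mm: "monic m'" and [simp]: "e \<in> Arr C" "m' \<in> Arr C" "Dom C m' = Cod C e" and g': "m' \<cdot> e = g"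
    using image_factorisation[of g] by (metis \<open>g \<in> Arr C\<close>)
  have [simp]: "Dom C e = Dom C f" "Cod C m' = Cod C g" using g' arr_comp(2,3)[of m' e] by auto
  have ge: "g \<cdot> x = m' \<cdot> (e \<cdot> x)" if "x \<in> Arr C" "Cod C x = Dom C f" for x
    by (rule comp_eq_extend1[OF g', symmetric]) (use that in simp_all)
  have ne: "is_kernel C n e"
  proof (rule kernelI)
    show "e \<cdot> n = zero_arr (Dom C n) (Cod C e)"
      by (rule monicD[OF mm]) (use kernelD(4)[OF g] in \<open>simp_all flip: ge\<close>)
    show "monic n" by (rule kernel_monic[OF g])
    fix x assume x: "x \<in> Arr C" "Cod C x = Dom C e" "e \<cdot> x = zero_arr (Dom C x) (Cod C e)"
    have gx: "g \<cdot> x = zero_arr (Dom C x) (Cod C g)" using x by (simp add: ge)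
    obtain u where "u \<in> Arr C" "Dom C u = Dom C x" "Cod C u = Dom C n" "n \<cdot> u = x"
      by (rule kernel_factor[OF g, of x]) (use x gx in simp_all)
    thus "\<exists>u. u \<in> Arr C \<and> Dom C u = Dom C x \<and> Cod C u = Dom C n \<and> n \<cdot> u = x" by blast
  qed simp_all
  have fn: "f \<cdot> n = zero_arr (Dom C n) (Cod C f)" by (simp add: n_def comp_eq_extend1[OF kernelD(4)[OF k]])
  obtain m where m [simp]: "m \<in> Arr C" "Dom C m = Cod C e" "Cod C m = Cod C f" and me: "m \<cdot> e = f"
    by (rule cokernel_factor[OF regular_epi_cokernel[OF re ne], of f]) (use fn in simp_all)
  obtain km where km: "is_kernel C km m" using kernel_exists[of m] by auto
  note [simp] = kernelD[OF km]
  have mek: "m \<cdot> (e \<cdot> k) = zero_arr ?K (Cod C m)" by (simp add: comp_eq_extend1[OF me])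
  obtain b where b [simp]: "b \<in> Arr C" "Dom C b = Dom C (e \<cdot> k)" "Cod C b = Dom C km" and kb: "km \<cdot> b = e \<cdot> k"
    by (rule kernel_factor[OF km, of "e \<cdot> k"]) (use mek in simp_all)
  have pb: "is_pullback C k b e km" by (rule kernel_pullback[OF _ km]) (use k kb me in simp_all)
  have rb: "regular_epi C b" by (rule regular_epi_pb[OF pb re])
  have enx: "e \<cdot> (k \<cdot> x) = km \<cdot> (b \<cdot> x)" if "x \<in> Arr C" "Cod C x = ?K" for x
    by (rule comp_eq_extend[OF kb[symmetric]]) (use that in simp_all)
  \<comment> \<open>An element of the kernel of \<open>f\<close> is killed by \<open>b\<close>
    exactly when it is killed by \<open>e\<close>, that is, when it lies in
    \<open>n\<close>.\<close>
  have tb: "is_kernel C (t ?K) b"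
  proof (rule kernelI)
    show "b \<cdot> t ?K = zero_arr (Dom C (t ?K)) (Cod C b)"
      by (rule monicD[OF kernel_monic[OF km]]) (use kernelD(4)[OF ne] in \<open>simp_all add: n_def flip: enx\<close>)
    show "monic (t ?K)" by (rule kernel_monic[OF tp(1)])
    fix x assume x: "x \<in> Arr C" "Cod C x = Dom C b" "b \<cdot> x = zero_arr (Dom C x) (Cod C b)"
    have ekx: "e \<cdot> (k \<cdot> x) = zero_arr (Dom C x) (Cod C e)" using x by (simp add: enx)
    obtain u where u: "u \<in> Arr C" "Dom C u = Dom C (k \<cdot> x)" "Cod C u = Dom C n" "n \<cdot> u = k \<cdot> x"
      by (rule kernel_factor[OF ne, of "k \<cdot> x"]) (use x ekx in simp_all)
    have "k \<cdot> (t ?K \<cdot> u) = k \<cdot> x" using u x unfolding n_def by simp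
    hence "t ?K \<cdot> u = x" using u x by - (rule monicD[OF kernel_monic[OF k]]; simp)
    thus "\<exists>u. u \<in> Arr C \<and> Dom C u = Dom C x \<and> Cod C u = Dom C (t ?K) \<and> t ?K \<cdot> u = x"
      using u x by (intro exI[of _ u]) simp
  qed simp_all
  \<comment> \<open>Both \<open>b\<close> and the unit at the kernel of \<open>f\<close> are
    cokernels of the same torsion part, so the kernel of \<open>m\<close> is isomorphic to a
    torsion-free object.\<close>
  note cb = regular_epi_cokernel[OF rb tb] and c\<eta> = tp(2)
  obtain w where w: "w \<in> Arr C" "Dom C w = Cod C b" "Cod C w = Cod C (\<eta> ?K)" "w \<cdot> b = \<eta> ?K"
    by (rule cokernel_factor[OF cb, of "\<eta> ?K"]) (use cokernelD(4)[OF c\<eta>] in simp_all)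
  obtain v where v: "v \<in> Arr C" "Dom C v = Cod C (\<eta> ?K)" "Cod C v = Cod C b" "v \<cdot> \<eta> ?K = b"
    by (rule cokernel_factor[OF c\<eta>, of b]) (use cokernelD(4)[OF cb] in simp_all)
  have "w \<cdot> v = Ide C (FObj F ?K)"
  proof (rule epicD[OF regular_epi_epic[OF cokernel_regular_epi[OF c\<eta>]]])
    show "(w \<cdot> v) \<cdot> \<eta> ?K = Ide C (FObj F ?K) \<cdot> \<eta> ?K" using w v by simp
  qed (use w v in simp_all)
  moreover have "v \<cdot> w = Ide C (Cod C b)"
  proof (rule epicD[OF regular_epi_epic[OF rb]])
    show "(v \<cdot> w) \<cdot> b = Ide C (Cod C b) \<cdot> b" using w v by simp
  qed (use w v in simp_all)
  ultimately have "is_iso C v" using w v by (intro isoI[of v w]) simp_all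
  moreover have "Dom C v \<in> \<F>" using v by simp
  ultimately have "Cod C v \<in> \<F>" using F_replete unfolding replete_def by blast
  hence "Dom C km \<in> \<F>" using v by simp
  hence "m \<in> M_bar C \<F>" using km unfolding M_bar_def kernel_obj_in_def by auto
  moreover have "e \<in> E_bar C \<T>" using re ne tp(3) unfolding E_bar_iff kernel_obj_in_def by auto
  ultimately show ?thesis using that me unfolding factors_as_def by fastforce
qed

lemma E_bar_M_bar_imp_stably_NExt:
  assumes f: "effdesc f" and fa: "factors_as C (E_bar C \<T>) (M_bar C \<F>) f m e"
  shows "factors_as C (stably C (inverted C Sub F)) (NExt C F \<eta>) f m e"
proof -
  have *: "e \<in> Arr C" "m \<in> Arr C" "Cod C e = Dom C m" "f = m \<cdot> e" "e \<in> E_bar C \<T>" "kernel_obj_in C m \<F>"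
    using fa by (auto simp: factors_as_def M_bar_def)
  have "effdesc m" by (rule effdesc_cancel[of m e]) (use f * in \<open>simp_all add: E_bar_iff\<close>)
  thus ?thesis using * E_bar_stably by (simp add: factors_as_def NExt_iff)
qed

text \<open>Presents the arrow from the kernel to zero as a pullback of \<open>f\<close>, so that
  stability under pullback can be applied to it.\<close>

lemma kernel_zero_pullback:
  assumes k: "is_kernel C k f"
  shows "is_pullback C k (to_Z (Dom C k)) f (from_Z (Cod C f))"
proof -
  note [simp] = kernelD[OF k]
  show ?thesis
  proof (rule pbI)
    fix x y assume x: "x \<in> Arr C" "y \<in> Arr C" "Dom C x = Dom C y" "Cod C x = Dom C f" "Cod C y = Dom C (from_Z (Cod C f))"
      "f \<cdot> x = from_Z (Cod C f) \<cdot> y"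
    have y: "y = to_Z (Dom C y)" using x by (intro to_Z_eq) simp_all
    have "f \<cdot> x = zero_arr (Dom C x) (Cod C f)" unfolding x(6) zero_arr_def x(3) y[symmetric] ..
    then obtain u where u: "u \<in> Arr C" "Dom C u = Dom C x" "Cod C u = Dom C k" "k \<cdot> u = x"
      using kernel_factor[OF k x(1,4)] by blast
    have "to_Z (Dom C k) \<cdot> u = to_Z (Dom C y)" using to_Z_eq[of "to_Z (Dom C k) \<cdot> u"] u x(3) by simp
    thus "\<exists>u. u \<in> Arr C \<and> Dom C u = Dom C y \<and> Cod C u = Dom C (to_Z (Dom C k)) \<and> k \<cdot> u = x \<and> to_Z (Dom C k) \<cdot> u = y"
      using u x(3) y by (intro exI[of _ u]) simp
  next
    fix u v assume "u \<in> Arr C" "v \<in> Arr C" "Dom C u = Dom C v" "Cod C u = Dom C (to_Z (Dom C k))" "Cod C v = Dom C (to_Z (Dom C k))" "k \<cdot> u = k \<cdot> v"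
    thus "u = v" by - (rule monicD[OF kernel_monic[OF k]]; simp)
  qed (simp_all add: zero_arr_def)
qed

lemma stably_NExt_imp_E_bar_M_bar:
  assumes f: "effdesc f" and fa: "factors_as C (stably C (inverted C Sub F)) (NExt C F \<eta>) f m e"
  shows "factors_as C (E_bar C \<T>) (M_bar C \<F>) f m e"
proof -
  have [simp]: "e \<in> Arr C" "m \<in> Arr C" "Cod C e = Dom C m" and fme: "f = m \<cdot> e" and es: "e \<in> stably C (inverted C Sub F)"
    and mk: "kernel_obj_in C m \<F>"
    using fa by (auto simp: factors_as_def NExt_iff)
  have stab: "is_iso C (FArr F q)" if "is_pullback C p q e g" for p q g
    using es that unfolding stably_def by (auto simp: inverted_iff)
  have rf: "regular_epi C (m \<cdot> e)" using f by (simp add: effdesc_def fme)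
  obtain k where k: "is_kernel C k e" using kernel_exists[of e] by auto
  note [simp] = kernelD[OF k]
  \<comment> \<open>The arrow from the kernel of \<open>e\<close> to zero is a pullback of
    \<open>e\<close>, hence inverted by \<open>F\<close>. The reflection of the kernel is then that
    of zero, and the unit vanishes.\<close>
  have kT: "Dom C k \<in> \<T>"
  proof (rule in_T_if_unit_zero)
    let ?K = "Dom C k" and ?z = "to_Z (Dom C k)"
    obtain i where i: "i \<in> Arr C" "Dom C i = FObj F Z" "Cod C i = FObj F ?K" "i \<cdot> FArr F ?z = Ide C (FObj F ?K)"
      using isoE[OF stab[OF kernel_zero_pullback[OF k]]] by simp metis
    have "\<eta> Z = zero_arr Z (FObj F Z)" using from_Z_eq[of "\<eta> Z"] from_Z_eq[of "zero_arr Z (FObj F Z)"] by simp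
    hence "FArr F ?z \<cdot> \<eta> ?K = zero_arr ?K (FObj F Z)" using unit_natural[of ?z] by simp
    hence "i \<cdot> (FArr F ?z \<cdot> \<eta> ?K) = zero_arr ?K (FObj F ?K)" using i by simp
    thus "\<eta> ?K = zero_arr ?K (FObj F ?K)" using i by (simp add: comp_eq_extend1[OF i(4)])
  qed simp
  obtain kf where kf: "is_kernel C kf (m \<cdot> e)" using kernel_exists[of "m \<cdot> e"] by auto
  obtain km where km: "is_kernel C km m" using kernel_exists[of m] by auto
  have [simp]: "kf \<in> Arr C" "Cod C kf = Dom C e" using kernelD[OF kf] by auto
  note [simp] = kernelD[OF km]
  have KmF: "Dom C km \<in> \<F>" by (rule kernel_obj_in_kernel[OF F_replete mk km])
  have mekf: "m \<cdot> (e \<cdot> kf) = zero_arr (Dom C kf) (Cod C m)" using kernelD(4)[OF kf] by simp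
  obtain b where b [simp]: "b \<in> Arr C" "Dom C b = Dom C (e \<cdot> kf)" "Cod C b = Dom C km" and kb: "km \<cdot> b = e \<cdot> kf"
    by (rule kernel_factor[OF km, of "e \<cdot> kf"]) (use mekf in simp_all)
  have pb: "is_pullback C kf b e km" by (rule kernel_pullback[OF kf km]) (use kb in simp_all)
  let ?Kf = "Dom C kf" and ?Km = "Dom C km"
  text \<open>As \<open>K[m]\<close> is torsion-free and \<open>F\<close> inverts \<open>b\<close>, this map is, up to isomorphism, the unit at \<open>K[f]\<close>.\<close>
  have rb: "regular_epi C b"
  proof -
    obtain i where i: "is_iso C i" "i \<in> Arr C" "Dom C i = FObj F ?Km" "Cod C i = ?Km" "i \<cdot> \<eta> ?Km = Ide C ?Km"
      using isoE[OF unit_iso_F[OF KmF]] by simp metis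
    have "is_iso C (i \<cdot> FArr F b)" by (rule iso_comp) (use stab[OF pb] i in simp_all)
    moreover have "regular_epi C (\<eta> ?Kf)" by (rule cokernel_regular_epi[OF torsion_part(2)]) simp
    ultimately have "regular_epi C ((i \<cdot> FArr F b) \<cdot> \<eta> ?Kf)" using i by (intro iso_regular_epi) simp_all
    moreover have "(i \<cdot> FArr F b) \<cdot> \<eta> ?Kf = i \<cdot> (\<eta> ?Km \<cdot> b)" using i unit_natural[of b] by simp
    moreover have "i \<cdot> (\<eta> ?Km \<cdot> b) = b" using i by (simp add: comp_eq_extend1[OF i(5)])
    ultimately show ?thesis by simp
  qed
  \<comment> \<open>It remains to see that the monic part \<open>n\<close> of \<open>e\<close> is
    invertible. The short five lemma will compare \<open>m \<cdot> n\<close> with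
    \<open>m\<close>.\<close>
  obtain e' n where re': "regular_epi C e'" and mn: "monic n" and [simp]: "e' \<in> Arr C" "n \<in> Arr C" "Dom C n = Cod C e'" and ne: "n \<cdot> e' = e"
    using image_factorisation[of e] by (metis \<open>e \<in> Arr C\<close>)
  have [simp]: "Dom C e' = Dom C e" "Cod C n = Dom C m" using ne arr_comp(2,3)[of n e'] by auto
  \<comment> \<open>Because \<open>b\<close> is a regular epimorphism, the whole kernel of
    \<open>m\<close> lies in the image of \<open>e\<close>; hence \<open>m\<close> and
    \<open>m \<cdot> n\<close> have the same kernel object.\<close>
  obtain w where w [simp]: "w \<in> Arr C" "Dom C w = Cod C b" "Cod C w = Dom C n" and wb: "w \<cdot> b = e' \<cdot> kf" and nw: "n \<cdot> w = km"
    by (rule regular_epi_lift[OF rb mn, of "e' \<cdot> kf" km]) (use kb in \<open>simp_all add: comp_eq_extend1[OF ne]\<close>)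
  have "is_kernel C w (m \<cdot> n)"
  proof (rule kernelI)
    show "(m \<cdot> n) \<cdot> w = zero_arr (Dom C w) (Cod C (m \<cdot> n))" by (simp add: nw)
    show "monic w" by (rule monic_cancel[of n]) (use nw kernel_monic[OF km] in simp_all)
    fix x assume x: "x \<in> Arr C" "Cod C x = Dom C (m \<cdot> n)" "(m \<cdot> n) \<cdot> x = zero_arr (Dom C x) (Cod C (m \<cdot> n))"
    obtain y where y: "y \<in> Arr C" "Dom C y = Dom C (n \<cdot> x)" "Cod C y = Dom C km" "km \<cdot> y = n \<cdot> x"
      by (rule kernel_factor[OF km, of "n \<cdot> x"]) (use x in simp_all)
    have "w \<cdot> y = x"
      by (rule monicD[OF mn]) (use x y in \<open>simp_all add: comp_eq_extend1[OF nw]\<close>)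
    thus "\<exists>u. u \<in> Arr C \<and> Dom C u = Dom C x \<and> Cod C u = Dom C w \<and> w \<cdot> u = x"
      using x y by (intro exI[of _ y]) simp
  qed simp_all
  moreover have "regular_epi C (m \<cdot> n)"
    by (rule regular_epi_cancel[of "m \<cdot> n" e']) (use rf ne in simp_all)
  ultimately have "is_iso C n" using km nw by (intro short_five[of m n w]) simp_all
  hence "regular_epi C e" using iso_regular_epi[of n e'] re' ne by simp
  hence "e \<in> E_bar C \<T>" using k kT unfolding E_bar_iff kernel_obj_in_def by blast
  thus ?thesis using mk fme by (simp add: factors_as_def M_bar_def)
qed

text \<open>Orthogonality in both directions gives arrows that are mutually inverse, since
  \<open>e\<close> and \<open>e'\<close> are epic.\<close>

lemma factorisation_unique:
  assumes 1: "factors_as C (E_bar C \<T>) (M_bar C \<F>) f m e" and 2: "factors_as C (E_bar C \<T>) (M_bar C \<F>) f m' e'"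
  shows "iso_factorisations C m e m' e'"
proof -
  have [simp]: "e \<in> Arr C" "m \<in> Arr C" "Cod C e = Dom C m" and fme: "f = m \<cdot> e" and e: "e \<in> E_bar C \<T>" and m: "kernel_obj_in C m \<F>"
    using 1 by (auto simp: factors_as_def M_bar_def)
  have [simp]: "e' \<in> Arr C" "m' \<in> Arr C" "Cod C e' = Dom C m'" and fme': "f = m' \<cdot> e'" and e': "e' \<in> E_bar C \<T>" and m': "kernel_obj_in C m' \<F>"
    using 2 by (auto simp: factors_as_def M_bar_def)
  have eq: "m' \<cdot> e' = m \<cdot> e" using fme fme' by simp
  have [simp]: "Dom C e' = Dom C e" "Cod C m' = Cod C m"
    using arg_cong[OF eq, of "Dom C"] arg_cong[OF eq, of "Cod C"] by simp_all
  obtain d where d: "d \<in> Arr C" "Dom C d = Cod C e" "Cod C d = Dom C m'" "d \<cdot> e = e'" "m' \<cdot> d = m"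
    by (rule orthogonal[OF e m', of e' m]) (use eq in simp_all)
  obtain d' where d': "d' \<in> Arr C" "Dom C d' = Cod C e'" "Cod C d' = Dom C m" "d' \<cdot> e' = e" "m \<cdot> d' = m'"
    by (rule orthogonal[OF e' m, of e m']) (use eq in simp_all)
  have "d' \<cdot> d = Ide C (Dom C m)"
    by (rule epicD[OF regular_epi_epic[of e]]) (use e d d' in \<open>simp_all add: E_bar_iff\<close>)
  moreover have "d \<cdot> d' = Ide C (Dom C m')"
    by (rule epicD[OF regular_epi_epic[of e']]) (use e' d d' in \<open>simp_all add: E_bar_iff\<close>)
  ultimately have "is_iso C d" using d d' by (intro isoI[of d d']) simp_all
  thus ?thesis using d unfolding iso_factorisations_def by (intro exI[of _ d]) (simp add: hom_iff)
qed

text \<open>By the kernel criterion the question is whether the kernel of the composite is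
  torsion-free: it is an extension of part of the kernel of \<open>g\<close> by part of the kernel
  of \<open>f\<close>.\<close>

lemma NExt_comp:
  assumes f: "f \<in> NExt C F \<eta>" and g: "g \<in> NExt C F \<eta>" and [simp]: "Cod C f = Dom C g"
  shows "g \<cdot> f \<in> NExt C F \<eta>"
proof -
  have ef: "effdesc f" "effdesc g" using f g by (auto simp: NExt_iff)
  hence [simp]: "f \<in> Arr C" "g \<in> Arr C" by (auto simp: effdesc_def regular_epi_arr)
  obtain kf where kf: "is_kernel C kf f" "Dom C kf \<in> \<F>" using f by (auto simp: NExt_iff kernel_obj_in_def)
  obtain kg where kg: "is_kernel C kg g" "Dom C kg \<in> \<F>" using g by (auto simp: NExt_iff kernel_obj_in_def)
  obtain k where k: "is_kernel C k (g \<cdot> f)" using kernel_exists[of "g \<cdot> f"] by auto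
  have [simp]: "k \<in> Arr C" "Cod C k = Dom C f" using kernelD[OF k] by auto
  note [simp] = kernelD[OF kf(1)] kernelD[OF kg(1)]
  have gfk: "g \<cdot> (f \<cdot> k) = zero_arr (Dom C k) (Cod C g)" using kernelD(4)[OF k] by simp
  obtain u where u: "u \<in> Arr C" "Dom C u = Dom C (f \<cdot> k)" "Cod C u = Dom C kg" "kg \<cdot> u = f \<cdot> k"
    by (rule kernel_factor[OF kg(1), of "f \<cdot> k"]) (simp_all add: gfk)
  \<comment> \<open>The kernel of the induced map \<open>u\<close> into the kernel of
    \<open>g\<close>. As \<open>f\<close> kills it, it embeds into the kernel of \<open>f\<close>
    and is torsion-free by closure under subobjects.\<close>
  obtain j where j: "is_kernel C j u" using kernel_exists[OF u(1)] .
  have [simp]: "j \<in> Arr C" "Cod C j = Dom C k" "u \<cdot> j = zero_arr (Dom C j) (Dom C kg)" using kernelD[OF j] u by auto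
  have fkj: "f \<cdot> (k \<cdot> j) = zero_arr (Dom C j) (Cod C f)"
  proof -
    have "f \<cdot> (k \<cdot> j) = kg \<cdot> (u \<cdot> j)" by (rule comp_eq_extend[OF u(4)[symmetric]]) (use u(1-3) in simp_all)
    thus ?thesis by simp
  qed
  obtain v where v: "v \<in> Arr C" "Dom C v = Dom C (k \<cdot> j)" "Cod C v = Dom C kf" "kf \<cdot> v = k \<cdot> j"
    by (rule kernel_factor[OF kf(1), of "k \<cdot> j"]) (simp_all add: fkj)
  have "monic (k \<cdot> j)" by (rule monic_comp) (simp_all add: kernel_monic[OF k] kernel_monic[OF j])
  hence "monic v" using v by - (rule monic_cancel[of kf v]; simp)
  from F_sub[OF this] have "Dom C j \<in> \<F>" using v kf by simp
  hence "Dom C k \<in> \<F>" using F_extension[OF u(1) _ j] u kg by simp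
  thus ?thesis using effdesc_comp[OF ef] k unfolding NExt_iff kernel_obj_in_def by auto
qed

lemma EffDes_simps:
  "Obj (EffDes C) = {f. effdesc f}"
  "(f, (u, v), g) \<in> hom (EffDes C) f' g' \<longleftrightarrow> f' = f \<and> g' = g \<and> effdesc f \<and> effdesc g \<and>
     u \<in> hom C (Dom C f) (Dom C g) \<and> v \<in> hom C (Cod C f) (Cod C g) \<and> g \<cdot> u = v \<cdot> f"
  "(f', (u', v'), h) \<cdot>\<^bsub>EffDes C\<^esub> (f, (u, v), g) = (f, (u' \<cdot> u, v' \<cdot> v), h)"
  unfolding EffDes_def hom_iff full_subcat_simps
  by (auto simp: arrow_cat_def effective_descent_iff effdesc_def regular_epi_arr hom_iff)

text \<open>The reflection of \<open>f\<close> is the second factor of its factorisation;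
  orthogonality of \<open>e\<close> to arrows with torsion-free kernel is its universal
  property.\<close>

lemma reflective_NExt: "reflective (EffDes C) (NExt C F \<eta>)"
proof (rule reflectiveI)
  show "category (EffDes C)" unfolding EffDes_def
    by (rule category.category_full_subcat[OF category_arrow_cat])
      (auto simp: arrow_cat_def effective_descent_def)
  show "NExt C F \<eta> \<subseteq> Obj (EffDes C)" by (auto simp: EffDes_simps NExt_iff)
  fix f assume "f \<in> Obj (EffDes C)"
  hence f: "effdesc f" by (simp add: EffDes_simps)
  hence fa: "f \<in> Arr C" by (simp add: effdesc_def regular_epi_arr)
  obtain m e where fac: "factors_as C (E_bar C \<T>) (M_bar C \<F>) f m e" using factorisation_exists[OF fa] .
  have [simp]: "e \<in> Arr C" "m \<in> Arr C" "Cod C e = Dom C m" and fme: "f = m \<cdot> e" and e: "e \<in> E_bar C \<T>"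
    using fac by (auto simp: factors_as_def)
  have re: "regular_epi C e" using e by (simp add: E_bar_iff)
  have mN: "m \<in> NExt C F \<eta>" using E_bar_M_bar_imp_stably_NExt[OF f fac] by (simp add: factors_as_def)
  hence em: "effdesc m" by (simp add: NExt_iff)
  \<comment> \<open>The unit is \<open>e\<close> on domains and the identity on codomains, so the
    codomain component of the extension is forced, and the domain component is unique because
    \<open>e\<close> is epic.\<close>
  let ?u = "(f, (e, Ide C (Cod C f)), m)"
  have u: "?u \<in> hom (EffDes C) f m" unfolding EffDes_simps using f em fme by (simp add: hom_iff)
  have "\<exists>!h. h \<in> hom (EffDes C) m g \<and> h \<cdot>\<^bsub>EffDes C\<^esub> ?u = w"
    if g: "g \<in> NExt C F \<eta>" and w: "w \<in> hom (EffDes C) f g" for g w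
  proof -
    have eg: "effdesc g" and kg: "kernel_obj_in C g \<F>" using g by (auto simp: NExt_iff)
    have [simp]: "g \<in> Arr C" using eg by (simp add: effdesc_def regular_epi_arr)
    obtain f' a b g' where w0: "w = (f', (a, b), g')" by (metis prod.exhaust)
    have w1: "w = (f, (a, b), g)" and [simp]: "a \<in> Arr C" "Dom C a = Dom C f" "Cod C a = Dom C g"
      "b \<in> Arr C" "Dom C b = Cod C f" "Cod C b = Cod C g" and gab: "g \<cdot> a = b \<cdot> f"
      using w unfolding w0 EffDes_simps by (simp_all add: hom_iff)
    obtain d where d: "d \<in> Arr C" "Dom C d = Cod C e" "Cod C d = Dom C g" "d \<cdot> e = a" "g \<cdot> d = b \<cdot> m"
      by (rule orthogonal[OF e kg, of a "b \<cdot> m"]) (use gab fme in simp_all)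
    show ?thesis
    proof (rule ex1I[of _ "(m, (d, b), g)"])
      show "(m, (d, b), g) \<in> hom (EffDes C) m g \<and> (m, (d, b), g) \<cdot>\<^bsub>EffDes C\<^esub> ?u = w"
        unfolding EffDes_simps w1 using em eg d fme by (simp add: hom_iff)
    next
      fix h assume h: "h \<in> hom (EffDes C) m g \<and> h \<cdot>\<^bsub>EffDes C\<^esub> ?u = w"
      obtain m' d' b' g' where h0: "h = (m', (d', b'), g')" by (metis prod.exhaust)
      have h1: "m' = m" "g' = g" "d' \<in> Arr C" "Dom C d' = Dom C m" "Cod C d' = Dom C g" "b' \<in> Arr C" "Dom C b' = Cod C m"
        using h unfolding h0 EffDes_simps by (simp_all add: hom_iff)
      have h2: "d' \<cdot> e = a" "b' \<cdot> Ide C (Cod C f) = b" using h unfolding h0 EffDes_simps w1 by simp_all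
      have "b' = b" using h1 h2(2) fme by simp
      moreover have "d' = d" by (rule epicD[OF regular_epi_epic[OF re]]) (use h1 h2 d in simp_all)
      ultimately show "h = (m, (d, b), g)" by (simp add: h0 h1)
    qed
  qed
  thus "\<exists>r u. r \<in> NExt C F \<eta> \<and> u \<in> hom (EffDes C) f r \<and>
      (\<forall>y\<in>NExt C F \<eta>. \<forall>w\<in>hom (EffDes C) f y. \<exists>!g. g \<in> hom (EffDes C) r y \<and> g \<cdot>\<^bsub>EffDes C\<^esub> u = w)"
    using mN u by blast
qed

end

theorem theorem3p7:
  fixes C :: "('o, 'm) cat"
    and \<T> \<F> :: "'o set"
    and F :: "('o, 'm, 'o, 'm) ftor"
    and \<eta> t :: "'o \<Rightarrow> 'm"
  assumes homological: "homological C"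
    and torsion: "torsion_theory C \<T> \<F>"
    and reflector: "torsion_reflector C \<T> \<F> F \<eta> t"
    and P: "protoadditive C (full_subcat C \<F>) F"
    and N: "\<forall>f k. f \<in> Arr C \<and> is_kernel C k f \<longrightarrow> normal_mono C (k \<cdot>\<^bsub>C\<^esub> t (Dom C k))"
  shows "reflective (EffDes C) (NExt C F \<eta>) \<and>
    (\<forall>f \<in> NExt C F \<eta>. \<forall>g \<in> NExt C F \<eta>. Cod C f = Dom C g \<longrightarrow> g \<cdot>\<^bsub>C\<^esub> f \<in> NExt C F \<eta>) \<and>
    (let stabE = stably C (inverted C (full_subcat C \<F>) F) in
     \<forall>f. effective_descent C f \<longrightarrow>
       (\<exists>m e. factors_as C stabE (NExt C F \<eta>) f m e) \<and>
       (\<forall>m e m' e'. factors_as C stabE (NExt C F \<eta>) f m e \<and>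
                    factors_as C stabE (NExt C F \<eta>) f m' e' \<longrightarrow>
                    iso_factorisations C m e m' e') \<and>
       (\<forall>m e. factors_as C stabE (NExt C F \<eta>) f m e \<longleftrightarrow>
              factors_as C (E_bar C \<T>) (M_bar C \<F>) f m e))"
proof -
  have "regular_cat C" using homological by (simp add: homological_def)
  moreover from this have "category C" by (simp add: regular_cat_def)
  ultimately interpret torsion C \<T> \<F> F \<eta> t
    by (intro torsion.intro homcat.intro regcat.intro regcat_axioms.intro homcat_axioms.intro torsion_axioms.intro)
      (use assms in auto)
  \<comment> \<open>Existence and uniqueness are both transferred along this equivalence from the
    factorisation with torsion kernel and torsion-free kernel.\<close>
  have iff: "factors_as C (stably C (inverted C Sub F)) (NExt C F \<eta>) f m e \<longleftrightarrow>
      factors_as C (E_bar C \<T>) (M_bar C \<F>) f m e" if "effdesc f" for f m e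
    using E_bar_M_bar_imp_stably_NExt[OF that] stably_NExt_imp_E_bar_M_bar[OF that] by blast
  have ex: "\<exists>m e. factors_as C (E_bar C \<T>) (M_bar C \<F>) f m e" if "effdesc f" for f
    using factorisation_exists that effdesc_def regular_epi_arr by metis
  show ?thesis
    unfolding Let_def effective_descent_iff
    using reflective_NExt NExt_comp iff ex factorisation_unique by simp blast
qed

end
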